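(* Let $1\le p_0<\infty$ and let $f$ and $g$ be two positive measurable functions on $\mathbb R^n$ such that, for every $w\in A_\infty$, $$\|g\|_{L^{p_0,\infty}(w)}\le \varphi(\|w\|_{A_\infty})\,\|f\|_{L^{p_0}(w)},$$ where $\varphi$ is a locally bounded function. Let $1\le p<\infty$, $0<q<\infty$ and let $u,v$ be weights. Then $$\|g\|_{L^{q,\infty}(v)}\le C\|f\|_{L^p(u)},$$ with $C$ independent of $f$ and $g$ (it may depend on $\varphi$, the weights and the parameters), if $(u,v)\in A_{p,q}$ and one of the following conditions holds: (a) there exists $0<s<\min(p,q)$ such that $\big(v^{1-\frac q{q-s}},u^{1-\frac p{p-s}}\big)\in S_{\mu\frac q{q-s},\,\mu\frac p{p-s}}$ for some $0<\mu<1$; (b) $q\le1$ and $M_\mu(v)\in L^{\frac p{p-q}}\big(u^{1-\frac p{p-q}}\big)$ for some $0<\mu<1$.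
   Context: Weights are positive locally integrable functions on $\mathbb R^n$. $M$ is the Hardy–Littlewood maximal operator $Mf(x)=\sup_{x\in Q}\frac1{|Q|}\int_Q|f|$ (supremum over cubes containing $x$), and for $0<\mu<1$, $M_\mu f=\big(M(|f|^{1/\mu})\big)^\mu$. $\|g\|_{L^{p,\infty}(w)}=\sup_{y>0}y\,w(\{|g|>y\})^{1/p}$. $A_\infty=\bigcup_{p>1}A_p$ is the union of the Muckenhoupt classes, with $\|w\|_{A_\infty}=\sup_Q\big(\frac1{|Q|}\int_Qw\big)\exp\big(\frac1{|Q|}\int_Q\log w^{-1}\big)$. For $0<p,q<\infty$ and positive measurable functions $u,v$: $(u,v)\in A_{p,q}$ means that $M:L^p(u)\to L^{q,\infty}(v)$ is bounded, and $(u,v)\in S_{p,q}$ means that $M:L^p(u)\to L^q(v)$ is bounded. In (b), in the degenerate case $p=q=1$ the condition is read as $u^{-1}M_\mu(v)\in L^\infty$. A function $\varphi$ on $(0,\infty)$ is locally bounded if $\sup_{0<t<K}\varphi(t)<\infty$ for every $K>0$. *)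

theory Defs
  imports "HOL-Analysis.Analysis"
begin

text \<open>Real powers of extended nonnegative numbers, used only for exponents \<open>a > 0\<close>.\<close>

definition ennreal_powr :: "ennreal \<Rightarrow> real \<Rightarrow> ennreal" where
  "ennreal_powr x a = (if x = \<infinity> then \<infinity> else ennreal (enn2real x powr a))"

text \<open>
  Cubes are nondegenerate, closed, with sides parallel to the axes. Taking open cubes instead
  changes none of the suprema below.
\<close>

definition cubes :: "'a::euclidean_space set set" where
  "cubes = {cbox a (a + l *\<^sub>R One) | a l. 0 < l}"

definition average :: "'a::euclidean_space set \<Rightarrow> ('a \<Rightarrow> ennreal) \<Rightarrow> ennreal" where
  "average Q F = (\<integral>\<^sup>+x\<in>Q. F x \<partial>lebesgue) / emeasure lebesgue Q"

definition maximal :: "('a::euclidean_space \<Rightarrow> real) \<Rightarrow> 'a \<Rightarrow> ennreal" where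
  "maximal f x = (SUP Q\<in>{Q \<in> cubes. x \<in> Q}. average Q (\<lambda>y. ennreal \<bar>f y\<bar>))"

definition maximal_powr :: "real \<Rightarrow> ('a::euclidean_space \<Rightarrow> real) \<Rightarrow> 'a \<Rightarrow> ennreal" where
  "maximal_powr \<mu> f x = ennreal_powr (maximal (\<lambda>y. \<bar>f y\<bar> powr (1 / \<mu>)) x) \<mu>"

definition weight :: "('a::euclidean_space \<Rightarrow> real) \<Rightarrow> bool" where
  "weight w \<longleftrightarrow> w \<in> borel_measurable lebesgue \<and> (\<forall>x. 0 < w x) \<and>
     (\<forall>K. compact K \<longrightarrow> w absolutely_integrable_on K)"

definition weighted :: "('a::euclidean_space \<Rightarrow> real) \<Rightarrow> 'a measure" where
  "weighted w = density lebesgue (\<lambda>x. ennreal (w x))"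

text \<open>
  Since the maximal function can be infinite, the (quasi-)norms are defined on
  \<open>ennreal\<close>-valued functions; they take the value \<open>\<infinity>\<close> outside the spaces.
\<close>

definition Lp_norm :: "real \<Rightarrow> ('a::euclidean_space \<Rightarrow> real) \<Rightarrow> ('a \<Rightarrow> ennreal) \<Rightarrow> ennreal" where
  "Lp_norm p w F = ennreal_powr (\<integral>\<^sup>+x. ennreal_powr (F x) p \<partial>weighted w) (1 / p)"

definition weak_Lp_norm :: "real \<Rightarrow> ('a::euclidean_space \<Rightarrow> real) \<Rightarrow> ('a \<Rightarrow> ennreal) \<Rightarrow> ennreal" where
  "weak_Lp_norm p w F =
     (SUP y\<in>{0<..}. ennreal y * ennreal_powr (emeasure (weighted w) {x. ennreal y < F x}) (1 / p))"

text \<open>The exponent \<open>-1 / (p - 1)\<close> is \<open>1 - p'\<close> for the conjugate exponent \<open>p'\<close>.\<close>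

definition Muckenhoupt :: "real \<Rightarrow> ('a::euclidean_space \<Rightarrow> real) set" where
  "Muckenhoupt p = {w. weight w \<and>
     (SUP Q\<in>cubes. average Q (\<lambda>x. ennreal (w x)) *
        ennreal_powr (average Q (\<lambda>x. ennreal (w x powr (-1 / (p - 1))))) (p - 1)) < \<infinity>}"

definition A_infty :: "('a::euclidean_space \<Rightarrow> real) set" where
  "A_infty = (\<Union>p\<in>{1<..}. Muckenhoupt p)"

text \<open>
  For a weight, the negative part of \<open>ln (inverse w)\<close> is bounded by \<open>w\<close> and hence
  integrable on every cube; so if \<open>ln (inverse w)\<close> is not integrable on a cube, its integral
  there is \<open>+\<infinity>\<close>. This does not happen for weights in \<open>A_infty\<close>.
\<close>

definition A_infty_const :: "('a::euclidean_space \<Rightarrow> real) \<Rightarrow> ennreal" where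
  "A_infty_const w = (SUP Q\<in>cubes.
     if (\<lambda>x. ln (inverse (w x))) absolutely_integrable_on Q
     then average Q (\<lambda>x. ennreal (w x)) *
       ennreal (exp ((LINT x:Q|lebesgue. ln (inverse (w x))) / measure lebesgue Q))
     else \<infinity>)"

definition weak_type_pair ::
  "real \<Rightarrow> real \<Rightarrow> ('a::euclidean_space \<Rightarrow> real) \<Rightarrow> ('a \<Rightarrow> real) \<Rightarrow> bool" where
  "weak_type_pair p q u v \<longleftrightarrow>
     (\<exists>C::real. \<forall>f \<in> borel_measurable lebesgue. Lp_norm p u (\<lambda>x. ennreal \<bar>f x\<bar>) < \<infinity> \<longrightarrow>
        weak_Lp_norm q v (maximal f) \<le> ennreal C * Lp_norm p u (\<lambda>x. ennreal \<bar>f x\<bar>))"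

definition strong_type_pair ::
  "real \<Rightarrow> real \<Rightarrow> ('a::euclidean_space \<Rightarrow> real) \<Rightarrow> ('a \<Rightarrow> real) \<Rightarrow> bool" where
  "strong_type_pair p q u v \<longleftrightarrow>
     (\<exists>C::real. \<forall>f \<in> borel_measurable lebesgue. Lp_norm p u (\<lambda>x. ennreal \<bar>f x\<bar>) < \<infinity> \<longrightarrow>
        Lp_norm q v (maximal f) \<le> ennreal C * Lp_norm p u (\<lambda>x. ennreal \<bar>f x\<bar>))"

definition ess_bounded :: "('a::euclidean_space \<Rightarrow> ennreal) \<Rightarrow> bool" where
  "ess_bounded F \<longleftrightarrow> (\<exists>C::real. AE x in lebesgue. F x \<le> ennreal C)"

definition locally_bounded :: "(real \<Rightarrow> real) \<Rightarrow> bool" where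
  "locally_bounded \<phi> \<longleftrightarrow> (\<forall>K>0. bdd_above (\<phi> ` {0<..<K}))"

end

theory Submission
  imports Defs
begin

text \<open>
  Fix \<open>y > 0\<close>. The weak type hypothesis on \<open>M\<close> controls the set where \<open>Mf > y\<close>, so only bounded subsets \<open>E\<close>
  of \<open>{g > y, Mf \<le> y}\<close> matter. The core is the estimate \<open>y\<^sup>s W(E) \<le> K \<integral> f\<^sup>s W\<close> for every \<open>s > 0\<close> and
  every \<open>A\<^sub>1\<close> weight \<open>W\<close>, with \<open>K\<close> depending only on the \<open>A\<^sub>1\<close> constant. It comes from testing the hypothesis on
  \<open>(f, g)\<close> with \<open>W (max y Mf)\<close> to the power \<open>s - p0\<close> when \<open>s < p0\<close>, and with \<open>W\<close> times a power of the
  maximal function of \<open>1\<^sub>E\<close> with respect to \<open>W\<close> when \<open>s > p0\<close>; both are \<open>A\<^sub>\<infinity>\<close> weights with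
  controlled constants, by a Coifman--Rochberg argument. Now take \<open>W = M\<^sub>\<mu> (v 1\<^sub>E)\<close> in case (a), and
  \<open>W = M\<^sub>\<mu> v\<close> with \<open>s = q\<close> in case (b). Since \<open>v \<le> W\<close> almost everywhere on \<open>E\<close>, Hoelder's inequality and
  the hypothesis on \<open>M\<^sub>\<mu>\<close> bound \<open>v(E)\<close>; in (a) the factor \<open>v(E)\<close> on the right has exponent \<open>1 - s/q < 1\<close>
  and is absorbed, being finite.
\<close>

text \<open>Since \<open>\<phi>\<close> is only locally bounded, a test weight helps only if its
  \<open>A_infty_const\<close> is bounded independently of \<open>f\<close>, \<open>g\<close>,
  \<open>y\<close> and \<open>E\<close>. All test weights are therefore built from \<open>A1\<close>
  weights: the easy half of the factorization of Muckenhoupt weights bounds the constant of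
  \<open>w1 * w2 powr (- b)\<close> by \<open>C1 * C2 powr b\<close>, and the Coifman--Rochberg
  constants depend only on the exponent and on the constants of the underlying weight. For
  \<open>s < p0\<close> the level \<open>y\<close> inside the maximum has two effects: on
  \<open>E\<close> the test weight is exactly \<open>y powr (s - p0) * W\<close>, and elsewhere
  \<open>f \<le> Mf\<close> still lets the negative power be compared with
  \<open>f powr (s - p0)\<close>. For \<open>s > p0\<close> the maximal operator must be relative to
  the measure \<open>W\<close>, because then \<open>W\<close> times a power below 1 of it is again
  an \<open>A1\<close> weight; this is why the maximal theory is set up for general doubling
  measures. The weights \<open>u powr (1 - p / (p - s))\<close> and
  \<open>v powr (1 - q / (q - s))\<close> are the duals produced by Hoelder's inequality with
  exponents \<open>p / s\<close> and \<open>q / s\<close>. Boundedness of \<open>E\<close> supplies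
  the finiteness that absorption requires.\<close>

lemma ennreal_powr_ennreal [simp]: "0 \<le> x \<Longrightarrow> ennreal_powr (ennreal x) a = ennreal (x powr a)"
  by (simp add: ennreal_powr_def)

lemma ennreal_powr_top [simp]: "ennreal_powr top a = top"
  by (simp add: ennreal_powr_def)

lemma ennreal_powr_0 [simp]: "ennreal_powr 0 a = 0"
  by (simp add: ennreal_powr_def)

lemma ennreal_powr_one [simp]: "ennreal_powr x 1 = x"
  by (cases x) auto

lemma ennreal_powr_mono: "0 \<le> a \<Longrightarrow> x \<le> y \<Longrightarrow> ennreal_powr x a \<le> ennreal_powr y a"
  by (cases x; cases y) (auto simp: top_unique intro!: ennreal_leI powr_mono2)

lemma ennreal_powr_mult:
  "0 < a \<Longrightarrow> ennreal_powr (x * y) a = ennreal_powr x a * ennreal_powr y a"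
  by (cases x; cases y)
     (auto simp: powr_mult ennreal_mult_top ennreal_top_mult simp flip: ennreal_mult)

lemma ennreal_powr_powr:
  "ennreal_powr (ennreal_powr x a) b = ennreal_powr x (a * b)"
  by (cases x) (auto simp: powr_powr)

lemma ennreal_powr_add:
  "ennreal_powr x a * ennreal_powr x b = ennreal_powr x (a + b)"
  by (cases x) (auto simp: powr_add ennreal_mult)

lemma ennreal_powr_eq_top_iff [simp]: "ennreal_powr x a = top \<longleftrightarrow> x = top"
  by (cases x) auto

lemma ennreal_powr_less_top_iff [simp]: "ennreal_powr x a < top \<longleftrightarrow> x < top"
  by (simp flip: less_top)

lemma borel_measurable_ennreal_powr [measurable (raw)]:
  assumes [measurable]: "f \<in> borel_measurable M"
  shows "(\<lambda>x. ennreal_powr (f x) a) \<in> borel_measurable M"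
  unfolding ennreal_powr_def by measurable

section \<open>Integrals of powers from weak type estimates\<close>

lemma suminf_geometric_mult_ennreal:
  assumes "0 \<le> c" "0 \<le> q" "q < 1"
  shows "(\<Sum>k. ennreal (c * q ^ k) * b) = ennreal (c / (1 - q)) * b"
proof -
  have "(\<lambda>k. c * q ^ k) sums (c / (1 - q))"
    using sums_mult[OF geometric_sums[of q], of c] assms by simp
  then have "(\<Sum>k. ennreal (c * q ^ k)) = ennreal (c / (1 - q))"
    using assms by (intro suminf_ennreal_eq) auto
  then show ?thesis by (simp add: ennreal_suminf_multc)
qed

lemma dyadic_level:
  assumes "0 < t" "t < (r::real)"
  obtains k :: nat where "2 ^ k * t < r" "r \<le> 2 ^ Suc k * t"
proof -
  obtain n :: nat where "r / t < 2 ^ n" using real_arch_pow[of 2 "r / t"] by auto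
  then have ex: "r \<le> 2 ^ n * t" using assms by (simp add: field_simps)
  define m where "m = (LEAST n. r \<le> 2 ^ n * t)"
  have m: "r \<le> 2 ^ m * t" unfolding m_def by (rule LeastI, rule ex)
  then obtain k where k: "m = Suc k" using assms by (cases m) auto
  have "\<not> r \<le> 2 ^ k * t" using not_less_Least[of k "\<lambda>n. r \<le> 2 ^ n * t"] k m_def by simp
  then show ?thesis using that[of k] m k by (simp add: not_le)
qed

text \<open>Kolmogorov's inequality. The part of \<open>B\<close> where \<open>G\<close> is at most
  \<open>t0\<close> costs \<open>t0 powr d\<close>, and the level between \<open>2 ^ k * t0\<close>
  and its double costs a multiple of \<open>2 powr (k * (d - 1))\<close>, which is summable because
  \<open>d < 1\<close>. The bound \<open>b\<close> is kept separate from \<open>emeasure N B\<close>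
  so that the larger mass of a tripled cube can be inserted.\<close>

lemma nn_integral_powr_le_weak_type_small:
  fixes G :: "'b \<Rightarrow> ennreal"
  assumes G[measurable]: "G \<in> borel_measurable N" and B[measurable]: "B \<in> sets N"
    and t0: "0 < t0" and d: "0 < d" "d < 1"
    and NB: "emeasure N B \<le> b"
    and weak: "\<And>t. t0 \<le> t \<Longrightarrow> emeasure N {x \<in> B. ennreal t < G x} \<le> ennreal (t0 / t) * b"
  shows "(\<integral>\<^sup>+x\<in>B. ennreal_powr (G x) d \<partial>N)
    \<le> ennreal ((1 + 2 powr d / (1 - 2 powr (d - 1))) * t0 powr d) * b"
proof -
  define S where "S k = {x \<in> B. ennreal (2 ^ k * t0) < G x}" for k :: nat
  have BN: "B \<subseteq> space N" using sets.sets_into_space[OF B] .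
  have S_eq: "S k = {x \<in> space N. ennreal (2 ^ k * t0) < G x} \<inter> B" for k
    unfolding S_def using BN by auto
  have S[measurable]: "S k \<in> sets N" for k
    unfolding S_eq by measurable
  define h where "h k x = ennreal ((2 ^ Suc k * t0) powr d) * indicator (S k) x" for k x
  have h[measurable]: "h k \<in> borel_measurable N" for k
    unfolding h_def by measurable
  have pw: "ennreal_powr (G x) d * indicator B x
      \<le> ennreal (t0 powr d) * indicator B x + (\<Sum>k. h k x)" for x
  proof (cases "x \<in> B")
    case xB: True
    have ge_h: "ennreal ((2 ^ Suc k * t0) powr d) \<le> (\<Sum>k. h k x)" if "x \<in> S k" for k
    proof -
      have "h k x \<le> (\<Sum>k. h k x)"
        using sum_le_suminf[of "\<lambda>k. h k x" "{k}"] by simp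
      then show ?thesis using that by (simp add: h_def)
    qed
    show ?thesis
    proof (cases "G x")
      case (real r)
      show ?thesis
      proof (cases "r \<le> t0")
        case True
        then have "ennreal_powr (G x) d \<le> ennreal (t0 powr d)"
          using real d by (auto intro!: ennreal_leI powr_mono2)
        then show ?thesis using xB by (simp add: add_increasing2)
      next
        case False
        then obtain k where k: "2 ^ k * t0 < r" "r \<le> 2 ^ Suc k * t0"
          using dyadic_level[of t0 r] t0 by auto
        have "x \<in> S k" unfolding S_def using xB real k t0 by (auto simp: ennreal_less_iff)
        moreover have "ennreal_powr (G x) d \<le> ennreal ((2 ^ Suc k * t0) powr d)"
          using real d k by (auto intro!: ennreal_leI powr_mono2)
        ultimately have "ennreal_powr (G x) d \<le> (\<Sum>k. h k x)" using ge_h order_trans by blast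
        then show ?thesis using xB by (simp add: add_increasing)
      qed
    next
      \<comment> \<open>Every superlevel set contains \<open>x\<close> and the values
        \<open>(2 powr d) ^ n\<close> are unbounded, so the series is infinite as well.\<close>
      case top
      have "(\<Sum>k. h k x) = top"
      proof (rule ccontr)
        assume "(\<Sum>k. h k x) \<noteq> top"
        then obtain R where R: "(\<Sum>k. h k x) = ennreal R" "0 \<le> R" by (cases "\<Sum>k. h k x") auto
        have "1 < 2 powr d" using d by simp
        then obtain n where n: "R / t0 powr d < (2 powr d) ^ n" using real_arch_pow by blast
        have "x \<in> S n" unfolding S_def using xB top by simp
        then have "ennreal ((2 ^ Suc n * t0) powr d) \<le> ennreal R" using ge_h R by simp
        then have "(2 ^ Suc n * t0) powr d \<le> R" using R by simp
        moreover have "(2 ^ n * t0) powr d \<le> (2 ^ Suc n * t0) powr d"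
          using t0 d by (intro powr_mono2) auto
        moreover have "(2 ^ n * t0) powr d = (2 powr d) ^ n * t0 powr d"
          using t0 by (simp add: powr_mult powr_power flip: powr_realpow)
            (simp add: powr_powr mult.commute)
        ultimately show False using n t0 by (simp add: field_simps)
      qed
      then show ?thesis by simp
    qed
  qed (simp)
  have "(\<integral>\<^sup>+x\<in>B. ennreal_powr (G x) d \<partial>N)
      \<le> (\<integral>\<^sup>+x. ennreal (t0 powr d) * indicator B x + (\<Sum>k. h k x) \<partial>N)"
    by (intro nn_integral_mono pw)
  also have "\<dots> = ennreal (t0 powr d) * emeasure N B + (\<Sum>k. \<integral>\<^sup>+x. h k x \<partial>N)"
    by (subst nn_integral_add) (auto simp: nn_integral_suminf nn_integral_cmult_indicator)
  also have "(\<Sum>k. \<integral>\<^sup>+x. h k x \<partial>N)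
      \<le> (\<Sum>k. ennreal ((2 powr d * t0 powr d) * (2 powr (d - 1)) ^ k) * b)"
  proof (intro suminf_le allI)
    fix k
    have "(\<integral>\<^sup>+x. h k x \<partial>N) = ennreal ((2 ^ Suc k * t0) powr d) * emeasure N (S k)"
      unfolding h_def by (simp add: nn_integral_cmult_indicator)
    also have "\<dots> \<le> ennreal ((2 ^ Suc k * t0) powr d) * (ennreal (t0 / (2 ^ k * t0)) * b)"
      unfolding S_def using t0 by (intro mult_left_mono weak) (auto simp: mult_le_cancel_right1)
    also have "\<dots> = ennreal ((2 ^ Suc k * t0) powr d * (t0 / (2 ^ k * t0))) * b"
      using t0 by (subst ennreal_mult') (simp_all add: mult.assoc)
    also have "(2 ^ Suc k * t0) powr d * (t0 / (2 ^ k * t0))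
        = (2 powr d * t0 powr d) * (2 powr (d - 1)) ^ k"
    proof -
      have "(2 ^ Suc k * t0) powr d = 2 powr d * (2 powr d) ^ k * t0 powr d"
        using t0 by (simp add: powr_mult powr_power flip: powr_realpow)
            (simp add: powr_powr powr_mult_base mult.commute)
      moreover have "(2 powr (d - 1)) ^ k = (2 powr d) ^ k / 2 ^ k"
        by (simp add: powr_diff power_divide)
      ultimately show ?thesis using t0 by simp
    qed
    finally show "(\<integral>\<^sup>+x. h k x \<partial>N) \<le> ennreal ((2 powr d * t0 powr d) * (2 powr (d - 1)) ^ k) * b" .
  qed auto
  also have "\<dots> = ennreal ((2 powr d * t0 powr d) / (1 - 2 powr (d - 1))) * b"
    using d by (intro suminf_geometric_mult_ennreal) (auto simp: powr_less_one)
  also have "ennreal (t0 powr d) * emeasure N B + \<dots>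
      \<le> ennreal (t0 powr d) * b + ennreal ((2 powr d * t0 powr d) / (1 - 2 powr (d - 1))) * b"
    by (intro add_mono mult_left_mono NB) auto
  also have "\<dots> = (ennreal (t0 powr d) + ennreal ((2 powr d * t0 powr d) / (1 - 2 powr (d - 1)))) * b"
    by (simp add: distrib_right)
  also have "\<dots> = ennreal ((1 + 2 powr d / (1 - 2 powr (d - 1))) * t0 powr d) * b"
    using d by (subst ennreal_plus[symmetric]) (auto simp: powr_less_one algebra_simps less_imp_le)
  finally show ?thesis by (simp add: add_left_mono)
qed

text \<open>The mirror image of the preceding estimate: \<open>G \<le> 1\<close> caps the levels
  from above, they now descend to 0, and the ratio \<open>2 powr (1 - a)\<close> is below 1 because
  \<open>a > 1\<close>. For functions bounded by 1 this replaces interpolation between weak type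
  (1,1) and the supremum bound.\<close>

lemma nn_integral_powr_le_weak_type_large:
  fixes G :: "'b \<Rightarrow> ennreal"
  assumes G[measurable]: "G \<in> borel_measurable N" and a: "1 < a"
    and le1: "\<And>x. x \<in> space N \<Longrightarrow> G x \<le> 1"
    and weak: "\<And>t. 0 < t \<Longrightarrow> emeasure N {x \<in> space N. ennreal t < G x} \<le> ennreal (1 / t) * b"
  shows "(\<integral>\<^sup>+x. ennreal_powr (G x) a \<partial>N) \<le> ennreal (2 / (1 - 2 powr (1 - a))) * b"
proof -
  define S where "S k = {x \<in> space N. ennreal ((1/2) ^ Suc k) < G x}" for k :: nat
  have S[measurable]: "S k \<in> sets N" for k
    unfolding S_def by measurable
  define h where "h k x = ennreal (((1/2) ^ k) powr a) * indicator (S k) x" for k x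
  have h[measurable]: "h k \<in> borel_measurable N" for k
    unfolding h_def by measurable
  have pw: "ennreal_powr (G x) a \<le> (\<Sum>k. h k x)" if x: "x \<in> space N" for x
  proof (cases "G x = 0")
    case False
    obtain r where r: "G x = ennreal r" "0 < r" "r \<le> 1"
      using le1[OF x] False by (cases "G x") (auto simp: top_unique)
    have "\<exists>k. (1/2) ^ Suc k < r \<and> r \<le> (1/2) ^ k"
    proof -
      define m where "m = (LEAST n. (1/2) ^ n < r)"
      obtain n where "(1/2::real) ^ n < r" using real_arch_pow_inv[of r "1/2"] r by auto
      then have m: "(1/2) ^ m < r" unfolding m_def by (rule LeastI)
      then obtain j where j: "m = Suc j" using r by (cases m) auto
      have "\<not> (1/2) ^ j < r" using not_less_Least[of j "\<lambda>n. (1/2) ^ n < r"] j m_def by simp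
      then show ?thesis using m j by (intro exI[of _ j]) auto
    qed
    then obtain k where k: "(1/2) ^ Suc k < r" "r \<le> (1/2) ^ k" by blast
    have "x \<in> S k" unfolding S_def using x r k by (auto simp: ennreal_less_iff)
    then have "ennreal (((1/2) ^ k) powr a) = h k x" by (simp add: h_def)
    also have "\<dots> \<le> (\<Sum>k. h k x)"
      using sum_le_suminf[of "\<lambda>k. h k x" "{k}"] by simp
    finally have "ennreal (((1/2) ^ k) powr a) \<le> (\<Sum>k. h k x)" .
    moreover have "ennreal_powr (G x) a \<le> ennreal (((1/2) ^ k) powr a)"
      using r a k by (auto intro!: ennreal_leI powr_mono2)
    ultimately show ?thesis by order
  qed simp
  have "(\<integral>\<^sup>+x. ennreal_powr (G x) a \<partial>N) \<le> (\<integral>\<^sup>+x. (\<Sum>k. h k x) \<partial>N)"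
    by (intro nn_integral_mono pw)
  also have "\<dots> = (\<Sum>k. \<integral>\<^sup>+x. h k x \<partial>N)"
    by (simp add: nn_integral_suminf)
  also have "\<dots> \<le> (\<Sum>k. ennreal (2 * (2 powr (1 - a)) ^ k) * b)"
  proof (intro suminf_le allI)
    fix k
    have "(\<integral>\<^sup>+x. h k x \<partial>N) = ennreal (((1/2) ^ k) powr a) * emeasure N (S k)"
      unfolding h_def by (simp add: nn_integral_cmult_indicator)
    also have "\<dots> \<le> ennreal (((1/2) ^ k) powr a) * (ennreal (1 / (1/2) ^ Suc k) * b)"
      unfolding S_def by (intro mult_left_mono weak) auto
    also have "\<dots> = ennreal (((1/2) ^ k) powr a * (1 / (1/2) ^ Suc k)) * b"
      by (subst ennreal_mult') (simp_all add: mult.assoc)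
    also have "((1/2) ^ k) powr a * (1 / (1/2) ^ Suc k) = 2 * (2 powr (1 - a)) ^ k"
    proof -
      have "((1/2::real) ^ k) powr a = ((1/2) powr a) ^ k"
        by (simp add: powr_power flip: powr_realpow) (simp add: powr_powr mult.commute)
      moreover have "(2 powr (1 - a)) ^ k = ((1/2) powr a) ^ k * 2 ^ k"
        by (simp add: powr_diff powr_divide power_divide)
      ultimately show ?thesis by (simp add: power_divide)
    qed
    finally show "(\<integral>\<^sup>+x. h k x \<partial>N) \<le> ennreal (2 * (2 powr (1 - a)) ^ k) * b" .
  qed auto
  also have "\<dots> = ennreal (2 / (1 - 2 powr (1 - a))) * b"
    using a by (intro suminf_geometric_mult_ennreal) (auto simp: powr_less_one)
  finally show ?thesis .
qed

subsection \<open>Cubes and maximal functions of doubling measures\<close>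

text \<open>Centre and half side length instead of corner and side length: enlarging a cube about
  its centre becomes a change of \<open>r\<close> alone.\<close>

definition cube :: "'a::euclidean_space \<Rightarrow> real \<Rightarrow> 'a set" where
  "cube c r = cbox (c - r *\<^sub>R One) (c + r *\<^sub>R One)"

lemma mem_cube: "x \<in> cube c r \<longleftrightarrow> (\<forall>i\<in>Basis. \<bar>x \<bullet> i - c \<bullet> i\<bar> \<le> r)"
  by (auto simp: cube_def mem_box inner_simps abs_le_iff algebra_simps)

lemma mem_interior_cube: "x \<in> interior (cube c r) \<longleftrightarrow> (\<forall>i\<in>Basis. \<bar>x \<bullet> i - c \<bullet> i\<bar> < r)"
  by (auto simp: cube_def interior_cbox mem_box inner_simps abs_less_iff algebra_simps)

lemma cbox_eq_cube: "cbox (a :: 'a::euclidean_space) (a + l *\<^sub>R One) = cube (a + (l / 2) *\<^sub>R One) (l / 2)"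
proof -
  have "(l / 2) *\<^sub>R One + (l / 2) *\<^sub>R One = (l *\<^sub>R One :: 'a)"
    by (simp flip: scaleR_add_left)
  then show ?thesis by (simp add: cube_def add.assoc)
qed

lemma cube_in_cubes: "0 < r \<Longrightarrow> cube c r \<in> cubes"
  using cbox_eq_cube[of "c - r *\<^sub>R One" "2 * r"] unfolding cubes_def
  by (auto intro!: exI[of _ "c - r *\<^sub>R One"] exI[of _ "2 * r"])

lemma cubesE:
  assumes "Q \<in> cubes"
  obtains c r where "Q = cube c r" "0 < r"
proof -
  obtain a l where "Q = cbox a (a + l *\<^sub>R One)" "0 < l" using assms unfolding cubes_def by blast
  then show ?thesis using that[of "a + (l/2) *\<^sub>R One" "l/2"] cbox_eq_cube[of a l] by auto
qed

lemma cube_sets [measurable, simp]: "cube c r \<in> sets lebesgue"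
  by (simp add: cube_def)

lemma compact_cube: "compact (cube c r)"
  by (simp add: cube_def compact_cbox)

lemma cube_mono: "r \<le> s \<Longrightarrow> cube c r \<subseteq> cube c s"
  by (meson mem_cube order_trans subsetI)

text \<open>The source of the factor 3 throughout. It serves both the covering argument and the
  comparison of averages over large cubes that meet a small one.\<close>

lemma cube_subset_triple:
  assumes "cube c r \<inter> cube d t \<noteq> {}" "r \<le> t"
  shows "cube c r \<subseteq> cube d (3 * t)"
proof
  fix x assume x: "x \<in> cube c r"
  obtain z where z: "z \<in> cube c r" "z \<in> cube d t" using assms by auto
  show "x \<in> cube d (3 * t)" unfolding mem_cube
  proof
    fix i :: 'a assume "i \<in> Basis"
    then have "\<bar>x \<bullet> i - c \<bullet> i\<bar> \<le> r" "\<bar>z \<bullet> i - c \<bullet> i\<bar> \<le> r" "\<bar>z \<bullet> i - d \<bullet> i\<bar> \<le> t"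
      using x z by (auto simp: mem_cube)
    then show "\<bar>x \<bullet> i - d \<bullet> i\<bar> \<le> 3 * t" using assms(2) by linarith
  qed
qed

lemma emeasure_cube: "0 < r \<Longrightarrow> emeasure lebesgue (cube c r :: 'a::euclidean_space set) = ennreal ((2 * r) ^ DIM('a))"
  unfolding cube_def emeasure_lborel_cbox_eq emeasure_completion
  by (simp add: emeasure_lborel_cbox_eq inner_simps mult_2[symmetric])

lemma ex_cube_subset: "bounded (B :: 'a::euclidean_space set) \<Longrightarrow> \<exists>r>0. B \<subseteq> cube c r"
proof -
  assume "bounded B"
  then obtain R where R: "\<And>x. x \<in> B \<Longrightarrow> dist c x \<le> R"
    using bounded_any_center by blast
  have "B \<subseteq> cube c (max 1 R)"
  proof
    fix x assume x: "x \<in> B"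
    show "x \<in> cube c (max 1 R)" unfolding mem_cube
    proof
      fix i :: 'a assume "i \<in> Basis"
      then have "\<bar>(x - c) \<bullet> i\<bar> \<le> norm (x - c)" by (rule Basis_le_norm)
      then show "\<bar>x \<bullet> i - c \<bullet> i\<bar> \<le> max 1 R"
        using R[OF x] by (simp add: inner_diff_left dist_norm norm_minus_commute)
    qed
  qed
  then show ?thesis by (intro exI[of _ "max 1 R"]) auto
qed

text \<open>Greedy selection: the largest cube goes first.\<close>

lemma finite_cubes_disjoint_subfamily:
  assumes "finite \<F>" "\<And>c r. (c, r) \<in> \<F> \<Longrightarrow> 0 < r"
  shows "\<exists>\<G>\<subseteq>\<F>. disjoint_family_on (\<lambda>(c, r). cube c r) \<G> \<and>
    (\<Union>(c, r)\<in>\<F>. cube c r) \<subseteq> (\<Union>(c, r)\<in>\<G>. cube c (3 * r :: real))"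
  using assms
proof (induction "card \<F>" arbitrary: \<F> rule: less_induct)
  case less
  show ?case
  proof (cases "\<F> = {}")
    case False
    obtain d t where dt: "(d, t) \<in> \<F>" "\<And>c r. (c, r) \<in> \<F> \<Longrightarrow> r \<le> t"
    proof -
      have "Max (snd ` \<F>) \<in> snd ` \<F>"
        using less.prems False by (intro Max_in) auto
      then obtain m where m: "m \<in> \<F>" "snd m = Max (snd ` \<F>)" by (metis imageE)
      have "r \<le> snd m" if "(c, r) \<in> \<F>" for c r
        unfolding m(2) using that less.prems by (intro Max_ge) force+
      then show ?thesis
        using that[of "fst m" "snd m"] m(1) by simp
    qed
    define \<F>' where "\<F>' = {(c, r) \<in> \<F>. cube c r \<inter> cube d t = {}}"
    have "cube d t \<noteq> {}" using less.prems(2)[OF dt(1)] mem_cube[of d d t] by auto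
    then have "(d, t) \<notin> \<F>'" by (auto simp: \<F>'_def)
    moreover have "\<F>' \<subseteq> \<F>" by (auto simp: \<F>'_def)
    ultimately have "\<F>' \<subset> \<F>" using dt(1) by blast
    then obtain \<G> where \<G>: "\<G> \<subseteq> \<F>'" "disjoint_family_on (\<lambda>(c, r). cube c r) \<G>"
      "(\<Union>(c, r)\<in>\<F>'. cube c r) \<subseteq> (\<Union>(c, r)\<in>\<G>. cube c (3 * r))"
    proof -
      have "\<exists>\<G>\<subseteq>\<F>'. disjoint_family_on (\<lambda>(c, r). cube c r) \<G> \<and>
          (\<Union>(c, r)\<in>\<F>'. cube c r) \<subseteq> (\<Union>(c, r)\<in>\<G>. cube c (3 * r))"
      proof (rule less.hyps)
        show "card \<F>' < card \<F>" using \<open>\<F>' \<subset> \<F>\<close> less.prems(1) by (rule psubset_card_mono[rotated])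
        show "finite \<F>'" using \<open>\<F>' \<subset> \<F>\<close> less.prems(1) finite_subset by blast
        show "0 < r" if "(c, r) \<in> \<F>'" for c r
          using that \<open>\<F>' \<subset> \<F>\<close> less.prems(2) by blast
      qed
      then show ?thesis using that by blast
    qed
    show ?thesis
    proof (intro exI[of _ "insert (d, t) \<G>"] conjI)
      show "insert (d, t) \<G> \<subseteq> \<F>" using dt \<G>(1) by (auto simp: \<F>'_def)
      show "disjoint_family_on (\<lambda>(c, r). cube c r) (insert (d, t) \<G>)"
        using \<G>(1,2) unfolding disjoint_family_on_def \<F>'_def by fastforce
      show "(\<Union>(c, r)\<in>\<F>. cube c r) \<subseteq> (\<Union>(c, r)\<in>insert (d, t) \<G>. cube c (3 * r))"
      proof safe
        fix x c r assume cr: "(c, r) \<in> \<F>" "x \<in> cube c r"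
        show "x \<in> (\<Union>(c, r)\<in>insert (d, t) \<G>. cube c (3 * r))"
        proof (cases "(c, r) \<in> \<F>'")
          case True
          then show ?thesis using cr \<G>(3) by blast
        next
          case False
          then have "cube c r \<subseteq> cube d (3 * t)"
            using cr dt by (intro cube_subset_triple) (auto simp: \<F>'_def)
          then show ?thesis using cr by auto
        qed
      qed
    qed
  qed (auto simp: disjoint_family_on_def)
qed

section \<open>The maximal operator of a measure that is doubling on cubes\<close>

text \<open>The measure is a parameter because two instances occur: Lebesgue measure, which gives
  \<open>M\<close>, and \<open>weighted W\<close>, which gives the operator used for
  duality.\<close>

definition cube_maximal :: "'a::euclidean_space measure \<Rightarrow> ('a \<Rightarrow> ennreal) \<Rightarrow> 'a \<Rightarrow> ennreal" where
  "cube_maximal N F x = (SUP Q\<in>{Q \<in> cubes. x \<in> Q}. (\<integral>\<^sup>+y\<in>Q. F y \<partial>N) / emeasure N Q)"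

lemma maximal_eq_cube_maximal: "maximal f = cube_maximal lebesgue (\<lambda>x. ennreal \<bar>f x\<bar>)"
  by (simp add: fun_eq_iff maximal_def cube_maximal_def average_def)

lemma ennreal_divide_le_iff:
  assumes "b \<noteq> 0" "b < top"
  shows "a / b \<le> c \<longleftrightarrow> a \<le> c * (b :: ennreal)"
proof
  assume "a / b \<le> c"
  then have "a / b * b \<le> c * b" by (rule mult_right_mono) simp
  then show "a \<le> c * b" using assms by (simp add: ennreal_divide_times)
next
  assume "a \<le> c * b"
  then have "a / b \<le> c * b / b" by (rule divide_right_mono_ennreal)
  then show "a / b \<le> c" using assms by (simp add: mult_divide_eq_ennreal)
qed

text \<open>Doubling is stated for the factor 3, the enlargement that the covering lemma
  produces.\<close>

locale cube_doubling =
  fixes N :: "'a::euclidean_space measure" and D :: real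
  assumes sets_eq [measurable_cong, simp]: "sets N = sets lebesgue"
    and emeasure_cube_pos: "0 < r \<Longrightarrow> 0 < emeasure N (cube c r)"
    and emeasure_cube_finite: "0 < r \<Longrightarrow> emeasure N (cube c r) < \<infinity>"
    and doubling: "0 < r \<Longrightarrow> emeasure N (cube c (3 * r)) \<le> ennreal D * emeasure N (cube c r)"
begin

lemma space_eq [simp]: "space N = UNIV"
  using sets_eq_imp_space_eq[OF sets_eq] by simp

lemma D_ge_1: "1 \<le> D"
proof -
  obtain b where b: "emeasure N (cube 0 1) = ennreal b" "0 < b"
    using emeasure_cube_pos[of 1 0] emeasure_cube_finite[of 1 0] by (cases "emeasure N (cube 0 1)") auto
  have "emeasure N (cube 0 1) \<le> emeasure N (cube 0 (3 * 1))"
    by (intro emeasure_mono cube_mono) auto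
  then have "ennreal b \<le> ennreal D * ennreal b" using doubling[of 1 0] b by simp
  then have "b \<le> D * b" using b by (simp add: ennreal_mult''[symmetric] ennreal_le_iff2)
  then show ?thesis using b by simp
qed

lemma average_le_cube_maximal:
  assumes "0 < r" "x \<in> cube c r"
  shows "(\<integral>\<^sup>+y\<in>cube c r. F y \<partial>N) \<le> cube_maximal N F x * emeasure N (cube c r)"
proof -
  have "(\<integral>\<^sup>+y\<in>cube c r. F y \<partial>N) / emeasure N (cube c r) \<le> cube_maximal N F x"
    unfolding cube_maximal_def using assms cube_in_cubes by (intro SUP_upper) auto
  then show ?thesis
    using emeasure_cube_pos[OF assms(1), of c] emeasure_cube_finite[OF assms(1), of c]
    by (simp add: ennreal_divide_le_iff)
qed

text \<open>Continuity from above along cubes that shrink to \<open>cube c r\<close>. It allows a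
  point of a closed cube to be moved into the interior of a slightly larger one.\<close>

lemma emeasure_enlarged_cube_less:
  assumes "0 < r" "emeasure N (cube c r) < b"
  shows "\<exists>s>r. emeasure N (cube c s) < b"
proof -
  define A where "A n = cube c (r + 1 / real (Suc n))" for n
  have "(\<Inter>n. A n) = cube c r"
  proof (intro equalityI subsetI)
    fix x assume x: "x \<in> (\<Inter>n. A n)"
    have "\<bar>x \<bullet> i - c \<bullet> i\<bar> \<le> r" if "i \<in> Basis" for i
    proof (rule field_le_epsilon)
      fix e :: real assume "0 < e"
      then obtain n where "1 / real (Suc n) < e"
        using reals_Archimedean[of e] by (auto simp: inverse_eq_divide)
      moreover have "x \<in> A n" using x by blast
      then have "\<bar>x \<bullet> i - c \<bullet> i\<bar> \<le> r + 1 / real (Suc n)"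
        using that by (simp add: A_def mem_cube)
      ultimately show "\<bar>x \<bullet> i - c \<bullet> i\<bar> \<le> r + e" by linarith
    qed
    then show "x \<in> cube c r" by (simp add: mem_cube)
  next
    fix x assume "x \<in> cube c r"
    then show "x \<in> (\<Inter>n. A n)" by (auto simp: A_def intro: subsetD[OF cube_mono[of r]])
  qed
  moreover have "(INF n. emeasure N (A n)) = emeasure N (\<Inter>n. A n)"
  proof (rule INF_emeasure_decseq)
    show "range A \<subseteq> sets N" unfolding A_def by auto
    show "decseq A" unfolding decseq_def A_def
    proof (intro allI impI cube_mono)
      fix m n :: nat assume "m \<le> n"
      then show "r + 1 / real (Suc n) \<le> r + 1 / real (Suc m)" by (simp add: frac_le)
    qed
    show "emeasure N (A n) \<noteq> \<infinity>" for n
      using emeasure_cube_finite[of "r + 1 / real (Suc n)" c] assms(1) by (auto simp: A_def add_pos_pos)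
  qed
  ultimately have "(INF n. emeasure N (A n)) < b" using assms(2) by simp
  then obtain n where "emeasure N (A n) < b" by (auto simp: INF_less_iff)
  then show ?thesis by (intro exI[of _ "r + 1 / real (Suc n)"]) (auto simp: A_def)
qed

text \<open>The strict inequality leaves room to enlarge the cube: its measure lies strictly below
  the integral divided by \<open>t\<close>, also when the integral is infinite, and this survives a
  small enlargement that puts \<open>x\<close> into the interior. Interiors are needed for openness
  and for compactness arguments.\<close>

lemma cube_maximal_greater:
  assumes t: "0 < t" and gt: "ennreal t < cube_maximal N F x"
  shows "\<exists>c r. 0 < r \<and> x \<in> interior (cube c r) \<and> ennreal t * emeasure N (cube c r) \<le> (\<integral>\<^sup>+y\<in>cube c r. F y \<partial>N)"
proof -
  obtain Q where Q: "Q \<in> cubes" "x \<in> Q" "ennreal t < (\<integral>\<^sup>+y\<in>Q. F y \<partial>N) / emeasure N Q"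
    using gt unfolding cube_maximal_def less_SUP_iff by blast
  obtain c r where cr: "Q = cube c r" "0 < r" using Q(1) by (rule cubesE)
  define I where "I = (\<integral>\<^sup>+y\<in>cube c r. F y \<partial>N)"
  obtain m where m: "emeasure N (cube c r) = ennreal m" "0 < m"
    using emeasure_cube_pos[of r c] emeasure_cube_finite[of r c] cr
    by (cases "emeasure N (cube c r)") auto
  have "emeasure N (cube c r) < I / ennreal t"
  proof (cases I)
    case (real i)
    then have "t < i / m" using Q(3) cr m t by (simp add: I_def[symmetric] divide_ennreal ennreal_less_iff)
    then have "m < i / t" using m t by (simp add: field_simps)
    then show ?thesis using real m t by (simp add: divide_ennreal ennreal_less_iff)
  next
    case top
    then show ?thesis using m t by (simp add: ennreal_top_divide)
  qed
  then obtain s where s: "s > r" "emeasure N (cube c s) < I / ennreal t"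
    using emeasure_enlarged_cube_less cr by blast
  have "ennreal t * emeasure N (cube c s) \<le> ennreal t * (I / ennreal t)"
    using s by (intro mult_left_mono) auto
  also have "\<dots> = I" using t by (simp add: ennreal_times_divide mult_divide_eq_ennreal mult.commute)
  also have "I \<le> (\<integral>\<^sup>+y\<in>cube c s. F y \<partial>N)"
    unfolding I_def using cube_mono[of r s c] s(1)
    by (intro nn_integral_mono) (auto simp: indicator_def)
  finally have "ennreal t * emeasure N (cube c s) \<le> (\<integral>\<^sup>+y\<in>cube c s. F y \<partial>N)" .
  moreover have "x \<in> interior (cube c s)"
    using Q(2) cr s(1) by (force simp: mem_cube mem_interior_cube)
  ultimately show ?thesis using s(1) cr(2) by (intro exI[of _ c] exI[of _ s]) auto
qed

text \<open>A cube that witnesses a large average at \<open>x\<close> witnesses it at each of its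
  points. Passing through a level \<open>t'\<close> strictly above \<open>t\<close> compensates for
  the non-strict inequality on the enlarged cube. The level 0 is reached as a union of positive
  levels.\<close>

lemma open_cube_maximal_gt:
  assumes "0 \<le> t"
  shows "open {x. ennreal t < cube_maximal N F x}"
proof -
  have pos: "open {x. ennreal t < cube_maximal N F x}" if t: "0 < t" for t
  proof (subst open_subopen, safe)
    fix x assume "ennreal t < cube_maximal N F x"
    then obtain t' where t': "ennreal t < ennreal t'" "ennreal t' < cube_maximal N F x"
      using dense[of "ennreal t" "cube_maximal N F x"]
      by (metis ennreal_cases less_top_ennreal order_less_imp_not_less top.not_eq_extremum)
    then have "0 < t'" "t < t'" using t by (auto simp: ennreal_less_iff)
    then obtain c r where cr: "0 < r" "x \<in> interior (cube c r)"
      "ennreal t' * emeasure N (cube c r) \<le> (\<integral>\<^sup>+y\<in>cube c r. F y \<partial>N)"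
      using cube_maximal_greater t'(2) by blast
    have "ennreal t < cube_maximal N F z" if z: "z \<in> cube c r" for z
    proof -
      have "ennreal t' * emeasure N (cube c r) \<le> cube_maximal N F z * emeasure N (cube c r)"
        using cr(3) average_le_cube_maximal[OF cr(1) z] by (rule order_trans)
      then have "ennreal t' \<le> cube_maximal N F z"
        using emeasure_cube_pos[OF cr(1), of c] emeasure_cube_finite[OF cr(1), of c]
        by (metis ennreal_divide_le_iff infinity_ennreal_def mult_divide_eq_ennreal order_less_irrefl)
      then show ?thesis using t'(1) by order
    qed
    then show "\<exists>T. open T \<and> x \<in> T \<and> T \<subseteq> {x. ennreal t < cube_maximal N F x}"
      using cr(2) interior_subset by (intro exI[of _ "interior (cube c r)"]) blast
  qed
  show ?thesis
  proof (cases "t = 0")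
    case True
    have "{x. ennreal t < cube_maximal N F x} = (\<Union>n. {x. ennreal (1 / real (Suc n)) < cube_maximal N F x})"
    proof (intro equalityI subsetI)
      fix x assume "x \<in> {x. ennreal t < cube_maximal N F x}"
      then have "0 < cube_maximal N F x" using True by simp
      then obtain s where "0 < s" "ennreal s < cube_maximal N F x"
        by (metis dense ennreal_cases ennreal_less_zero_iff less_top_ennreal order_less_imp_not_less top.not_eq_extremum)
      moreover then obtain n where "1 / real (Suc n) < s"
        using reals_Archimedean[of s] by (auto simp: inverse_eq_divide)
      then have "ennreal (1 / real (Suc n)) \<le> ennreal s" by (intro ennreal_leI) simp
      ultimately show "x \<in> (\<Union>n. {x. ennreal (1 / real (Suc n)) < cube_maximal N F x})"
        by (blast intro: le_less_trans)
    next
      fix x assume "x \<in> (\<Union>n. {x. ennreal (1 / real (Suc n)) < cube_maximal N F x})"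
      then show "x \<in> {x. ennreal t < cube_maximal N F x}" using True by (auto intro: le_less_trans)
    qed
    then show ?thesis using pos by (auto intro!: open_UN)
  qed (use pos assms in auto)
qed

lemma borel_measurable_cube_maximal_borel: "cube_maximal N F \<in> borel_measurable borel"
proof (rule borel_measurableI_greater)
  fix y :: ennreal
  show "{x \<in> space borel. y < cube_maximal N F x} \<in> sets borel"
  proof (cases y)
    case (real r)
    then show ?thesis using open_cube_maximal_gt[of r F] by simp
  qed simp
qed

lemma borel_measurable_cube_maximal [measurable]: "cube_maximal N F \<in> borel_measurable lebesgue"
  using borel_measurable_cube_maximal_borel by (intro measurable_completion) simp

text \<open>The Vitali covering argument. On a compact subset of the superlevel set finitely many
  interiors suffice, a disjoint subfamily covers after tripling, and tripling costs
  \<open>D\<close>. Since the superlevel set is open, an increasing sequence of compact sets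
  exhausts it, and continuity from below finishes the proof.\<close>

lemma weak_type_cube_maximal:
  assumes [measurable]: "F \<in> borel_measurable lebesgue" and t: "0 < t"
  shows "emeasure N {x. ennreal t < cube_maximal N F x} \<le> ennreal (D / t) * (\<integral>\<^sup>+x. F x \<partial>N)"
proof -
  have F[measurable]: "F \<in> borel_measurable N" by simp
  define U where "U = {x. ennreal t < cube_maximal N F x}"
  have compact_bound: "emeasure N K \<le> ennreal (D / t) * (\<integral>\<^sup>+x. F x \<partial>N)" if K: "compact K" "K \<subseteq> U" for K
  proof -
    define \<C> where "\<C> = {(c, r). 0 < r \<and> ennreal t * emeasure N (cube c r) \<le> (\<integral>\<^sup>+y\<in>cube c r. F y \<partial>N)}"
    have "K \<subseteq> (\<Union>(c, r)\<in>\<C>. interior (cube c r))"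
    proof
      fix x assume "x \<in> K"
      then have "ennreal t < cube_maximal N F x" using K(2) by (auto simp: U_def)
      then obtain c r where "0 < r" "x \<in> interior (cube c r)" "ennreal t * emeasure N (cube c r) \<le> (\<integral>\<^sup>+y\<in>cube c r. F y \<partial>N)"
        using cube_maximal_greater[OF t] by blast
      then show "x \<in> (\<Union>(c, r)\<in>\<C>. interior (cube c r))" by (auto simp: \<C>_def)
    qed
    then obtain \<F> where \<F>: "\<F> \<subseteq> \<C>" "finite \<F>" "K \<subseteq> (\<Union>(c, r)\<in>\<F>. interior (cube c r))"
      using compactE_image[OF K(1), of \<C> "\<lambda>(c, r). interior (cube c r)"] by (force simp: split_beta)
    obtain \<G> where \<G>: "\<G> \<subseteq> \<F>" "disjoint_family_on (\<lambda>(c, r). cube c r) \<G>"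
      "(\<Union>(c, r)\<in>\<F>. cube c r) \<subseteq> (\<Union>(c, r)\<in>\<G>. cube c (3 * r))"
      using finite_cubes_disjoint_subfamily[OF \<F>(2)] \<F>(1) unfolding \<C>_def by blast
    have fin: "finite \<G>" using \<G>(1) \<F>(2) by (rule finite_subset)
    have "(\<Union>(c, r)\<in>\<F>. interior (cube c r)) \<subseteq> (\<Union>(c, r)\<in>\<F>. cube c r)"
      by (intro UN_mono) (auto intro: subsetD[OF interior_subset])
    with \<F>(3) have "K \<subseteq> (\<Union>(c, r)\<in>\<F>. cube c r)" by (rule order_trans)
    then have "K \<subseteq> (\<Union>(c, r)\<in>\<G>. cube c (3 * r))" using \<G>(3) by (rule order_trans)
    then have "emeasure N K \<le> emeasure N (\<Union>(c, r)\<in>\<G>. cube c (3 * r))"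
      using fin by (intro emeasure_mono) (auto simp: split_beta)
    also have "\<dots> \<le> (\<Sum>(c, r)\<in>\<G>. emeasure N (cube c (3 * r)))"
      unfolding split_beta by (intro emeasure_subadditive_finite fin) auto
    also have "\<dots> \<le> (\<Sum>(c, r)\<in>\<G>. ennreal (D / t) * (\<integral>\<^sup>+y\<in>cube c r. F y \<partial>N))"
    proof (intro sum_mono, clarify)
      fix c r assume "(c, r) \<in> \<G>"
      then have cr: "0 < r" "ennreal t * emeasure N (cube c r) \<le> (\<integral>\<^sup>+y\<in>cube c r. F y \<partial>N)"
        using \<G>(1) \<F>(1) by (auto simp: \<C>_def)
      have "emeasure N (cube c (3 * r)) \<le> ennreal D * emeasure N (cube c r)" by (rule doubling[OF cr(1)])
      also have "\<dots> = ennreal (D / t) * (ennreal t * emeasure N (cube c r))"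
        using t D_ge_1 by (simp add: mult.assoc[symmetric] ennreal_mult[symmetric])
      also have "\<dots> \<le> ennreal (D / t) * (\<integral>\<^sup>+y\<in>cube c r. F y \<partial>N)"
        using cr(2) by (intro mult_left_mono) auto
      finally show "emeasure N (cube c (3 * r)) \<le> ennreal (D / t) * (\<integral>\<^sup>+y\<in>cube c r. F y \<partial>N)" .
    qed
    also have "\<dots> = ennreal (D / t) * (\<Sum>(c, r)\<in>\<G>. \<integral>\<^sup>+y\<in>cube c r. F y \<partial>N)"
      by (simp add: sum_distrib_left split_beta)
    also have "(\<Sum>(c, r)\<in>\<G>. \<integral>\<^sup>+y\<in>cube c r. F y \<partial>N) = (\<integral>\<^sup>+y. (\<Sum>(c, r)\<in>\<G>. F y * indicator (cube c r) y) \<partial>N)"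
      unfolding split_beta by (intro nn_integral_sum[symmetric]) measurable
    also have "\<dots> \<le> (\<integral>\<^sup>+y. F y \<partial>N)"
    proof (intro nn_integral_mono)
      fix y
      have "(\<Sum>(c, r)\<in>\<G>. F y * indicator (cube c r) y) = F y * (\<Sum>g\<in>\<G>. indicator ((\<lambda>(c, r). cube c r) g) y)"
        by (simp add: sum_distrib_left split_beta)
      also have "(\<Sum>g\<in>\<G>. indicator ((\<lambda>(c, r). cube c r) g) y :: ennreal) = indicator (\<Union>g\<in>\<G>. (\<lambda>(c, r). cube c r) g) y"
        by (rule indicator_UN_disjoint[OF fin \<G>(2), symmetric])
      also have "F y * \<dots> \<le> F y" by (simp add: indicator_def)
      finally show "(\<Sum>(c, r)\<in>\<G>. F y * indicator (cube c r) y) \<le> F y" .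
    qed
    finally show ?thesis by (simp add: mult_left_mono)
  qed
  obtain C where C: "\<And>n. compact (C n)" "\<And>n. C n \<subseteq> U" "\<And>n. C n \<subseteq> interior (C (Suc n))" "\<Union>(range C) = U"
    using open_Union_compact_subsets[of U] open_cube_maximal_gt[of t F] t unfolding U_def by (metis less_imp_le)
  have "incseq C" by (intro incseq_SucI order_trans[OF C(3)] interior_subset)
  moreover have "range C \<subseteq> sets N" using C(1) by (auto intro: lmeasurable_compact fmeasurableD)
  ultimately have "emeasure N U = (SUP n. emeasure N (C n))"
    using SUP_emeasure_incseq[of C N] C(4) by simp
  also have "\<dots> \<le> ennreal (D / t) * (\<integral>\<^sup>+x. F x \<partial>N)"
    using C by (intro SUP_least compact_bound) auto
  finally show ?thesis unfolding U_def .
qed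

text \<open>
  Coifman--Rochberg: on a cube, the part of \<open>F\<close> inside the tripled cube is handled by the weak
  type inequality, and cubes leaving the tripled cube have comparable averages.
\<close>

lemma nn_integral_cube_maximal_powr_le:
  assumes [measurable]: "F \<in> borel_measurable lebesgue" and r: "0 < r" and x: "x \<in> cube c r"
    and t0: "0 < t0" "cube_maximal N F x \<le> ennreal t0" and d: "0 < d" "d < 1"
  shows "(\<integral>\<^sup>+y\<in>cube c r. ennreal_powr (cube_maximal N F y) d \<partial>N)
    \<le> ennreal ((1 + 2 powr d / (1 - 2 powr (d - 1))) * D powr (d + 1) * t0 powr d) * emeasure N (cube c r)"
proof -
  have F[measurable]: "F \<in> borel_measurable N" by simp
  have M[measurable]: "cube_maximal N G \<in> borel_measurable N" for G by simp
  define F1 where "F1 y = F y * indicator (cube c (3 * r)) y" for y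
  have F1[measurable]: "F1 \<in> borel_measurable lebesgue" unfolding F1_def by measurable
  have D: "1 \<le> D" by (rule D_ge_1)
  have far: "cube_maximal N F z \<le> max (cube_maximal N F1 z) (ennreal (D * t0))" if z: "z \<in> cube c r" for z
    unfolding cube_maximal_def[of N F z]
  proof (rule SUP_least, clarify)
    fix Q assume Q: "Q \<in> cubes" "z \<in> Q"
    obtain e s where es: "Q = cube e s" "0 < s" using Q(1) by (rule cubesE)
    have pf: "emeasure N (cube e s) \<noteq> 0" "emeasure N (cube e s) < top"
      using emeasure_cube_pos[OF es(2), of e] emeasure_cube_finite[OF es(2), of e] by auto
    show "(\<integral>\<^sup>+y\<in>Q. F y \<partial>N) / emeasure N Q \<le> max (cube_maximal N F1 z) (ennreal (D * t0))"
    proof (cases "s \<le> r")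
      case True
      then have "cube e s \<subseteq> cube c (3 * r)"
        using Q z es by (intro cube_subset_triple) auto
      then have "(\<integral>\<^sup>+y\<in>cube e s. F y \<partial>N) = (\<integral>\<^sup>+y\<in>cube e s. F1 y \<partial>N)"
        unfolding F1_def by (intro nn_integral_cong) (auto simp: indicator_def)
      also have "\<dots> \<le> cube_maximal N F1 z * emeasure N (cube e s)"
        using Q es by (intro average_le_cube_maximal) auto
      finally show ?thesis using pf es by (simp add: ennreal_divide_le_iff le_max_iff_disj)
    next
      case False
      then have "cube c r \<subseteq> cube e (3 * s)"
        using Q z es by (intro cube_subset_triple) auto
      then have x3: "x \<in> cube e (3 * s)" using x by auto
      have "(\<integral>\<^sup>+y\<in>cube e s. F y \<partial>N) \<le> (\<integral>\<^sup>+y\<in>cube e (3 * s). F y \<partial>N)"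
        using cube_mono[of s "3 * s" e] es(2) by (intro nn_integral_mono) (auto simp: indicator_def)
      also have "\<dots> \<le> cube_maximal N F x * emeasure N (cube e (3 * s))"
        using x3 es by (intro average_le_cube_maximal) auto
      also have "\<dots> \<le> ennreal t0 * (ennreal D * emeasure N (cube e s))"
        using doubling[OF es(2), of e] t0 by (intro mult_mono) auto
      also have "\<dots> = ennreal (D * t0) * emeasure N (cube e s)"
        using D t0 by (simp add: ennreal_mult mult.assoc mult.left_commute)
      finally show ?thesis using pf es by (simp add: ennreal_divide_le_iff le_max_iff_disj)
    qed
  qed
  have weak: "emeasure N {y \<in> cube c r. ennreal t < cube_maximal N F y}
      \<le> ennreal ((D * t0) / t) * (ennreal D * emeasure N (cube c r))" if t: "D * t0 \<le> t" for t
  proof -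
    have tpos: "0 < t" using D t0 t by (meson less_le_trans mult_pos_pos zero_less_one)
    have "{y \<in> cube c r. ennreal t < cube_maximal N F y} \<subseteq> {y. ennreal t < cube_maximal N F1 y}"
    proof clarify
      fix y assume y: "y \<in> cube c r" "ennreal t < cube_maximal N F y"
      moreover have "ennreal (D * t0) \<le> ennreal t" using t by (rule ennreal_leI)
      ultimately show "ennreal t < cube_maximal N F1 y"
        using far[OF y(1)] by (auto simp: max_def split: if_splits)
    qed
    then have "emeasure N {y \<in> cube c r. ennreal t < cube_maximal N F y} \<le> emeasure N {y. ennreal t < cube_maximal N F1 y}"
      using open_cube_maximal_gt[of t F1] tpos by (intro emeasure_mono) auto
    also have "\<dots> \<le> ennreal (D / t) * (\<integral>\<^sup>+x. F1 x \<partial>N)"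
      by (intro weak_type_cube_maximal F1 tpos)
    also have "(\<integral>\<^sup>+x. F1 x \<partial>N) \<le> cube_maximal N F x * emeasure N (cube c (3 * r))"
      unfolding F1_def using r x cube_mono[of r "3 * r" c] by (intro average_le_cube_maximal) auto
    also have "\<dots> \<le> ennreal t0 * (ennreal D * emeasure N (cube c r))"
      using doubling[OF r, of c] t0 by (intro mult_mono) auto
    also have "ennreal (D / t) * (ennreal t0 * (ennreal D * emeasure N (cube c r)))
        = ennreal (D * t0 / t) * (ennreal D * emeasure N (cube c r))"
      using D t0 tpos by (subst mult.assoc[symmetric], subst ennreal_mult[symmetric]) auto
    finally show ?thesis by (simp add: mult_left_mono)
  qed
  \<comment> \<open>Above the level \<open>D * t0\<close> only the local part \<open>F1\<close>
    matters. Its total mass is at most \<open>t0 * D\<close> times the measure of the cube, so the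
    dyadic estimate is applied with \<open>D\<close> times that measure in place of
    \<open>b\<close>.\<close>
  have "(\<integral>\<^sup>+y\<in>cube c r. ennreal_powr (cube_maximal N F y) d \<partial>N)
      \<le> ennreal ((1 + 2 powr d / (1 - 2 powr (d - 1))) * (D * t0) powr d) * (ennreal D * emeasure N (cube c r))"
  proof (rule nn_integral_powr_le_weak_type_small)
    show "emeasure N (cube c r) \<le> ennreal D * emeasure N (cube c r)"
      using mult_right_mono[of 1 "ennreal D" "emeasure N (cube c r)"] D by simp
  qed (use weak D t0 d in auto)
  also have "\<dots> = ennreal ((1 + 2 powr d / (1 - 2 powr (d - 1))) * (D * t0) powr d * D) * emeasure N (cube c r)"
    using D d by (subst (2) ennreal_mult) (auto simp: mult.assoc powr_less_one less_imp_le intro!: mult_nonneg_nonneg add_nonneg_nonneg divide_nonneg_nonneg)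
  also have "(1 + 2 powr d / (1 - 2 powr (d - 1))) * (D * t0) powr d * D
      = (1 + 2 powr d / (1 - 2 powr (d - 1))) * D powr (d + 1) * t0 powr d"
    using D t0 by (simp add: powr_mult powr_add)
  finally show ?thesis .
qed

end

subsection \<open>Weighted measures and \<open>A\<^sub>1\<close> weights\<close>

declare emeasure_completion [simp del]

lemma
  fixes f :: "'a::euclidean_space \<Rightarrow> real"
  assumes f: "f \<in> borel_measurable lebesgue" and f0: "\<And>x. 0 \<le> f x" and S: "S \<in> sets lebesgue"
  shows set_integrable_lebesgue_iff_finite: "f absolutely_integrable_on S \<longleftrightarrow> (\<integral>\<^sup>+x\<in>S. ennreal (f x) \<partial>lebesgue) < \<infinity>"
    and set_nn_integral_eq_integral: "f absolutely_integrable_on S \<Longrightarrow> (\<integral>\<^sup>+x\<in>S. ennreal (f x) \<partial>lebesgue) = ennreal (integral S f)"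
proof -
  have eq: "(\<integral>\<^sup>+x\<in>S. ennreal (f x) \<partial>lebesgue) = (\<integral>\<^sup>+x. ennreal (indicator S x *\<^sub>R f x) \<partial>lebesgue)"
    by (intro nn_integral_cong) (auto simp: indicator_def)
  have m: "(\<lambda>x. indicator S x *\<^sub>R f x) \<in> borel_measurable lebesgue" using f S by measurable
  have n: "norm (indicator S x *\<^sub>R f x) = indicator S x *\<^sub>R f x" for x using f0 by simp
  show "f absolutely_integrable_on S \<longleftrightarrow> (\<integral>\<^sup>+x\<in>S. ennreal (f x) \<partial>lebesgue) < \<infinity>"
    unfolding eq set_integrable_def using m by (simp only: integrable_iff_bounded n) simp
  assume a: "f absolutely_integrable_on S"
  then have "(\<integral>\<^sup>+x. ennreal (indicator S x *\<^sub>R f x) \<partial>lebesgue) = ennreal (LINT x:S|lebesgue. f x)"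
    unfolding set_integrable_def set_lebesgue_integral_def
    by (intro nn_integral_eq_integral) (auto simp: f0)
  then show "(\<integral>\<^sup>+x\<in>S. ennreal (f x) \<partial>lebesgue) = ennreal (integral S f)"
    unfolding eq using set_lebesgue_integral_eq_integral(2)[OF a] by simp
qed

lemma
  assumes "weight w"
  shows weight_measurable [measurable]: "w \<in> borel_measurable lebesgue"
    and weight_pos: "0 < w x"
    and weight_nonneg: "0 \<le> w x"
    and weight_cube_finite: "(\<integral>\<^sup>+x\<in>cube c r. ennreal (w x) \<partial>lebesgue) < \<infinity>"
proof -
  show m: "w \<in> borel_measurable lebesgue" and p: "0 < w x" for x using assms by (auto simp: weight_def)
  then show "0 \<le> w x" by (simp add: less_imp_le)
  have "w absolutely_integrable_on cube c r" using assms compact_cube by (auto simp: weight_def)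
  then show "(\<integral>\<^sup>+x\<in>cube c r. ennreal (w x) \<partial>lebesgue) < \<infinity>"
    using m p by (subst (asm) set_integrable_lebesgue_iff_finite) (auto intro: less_imp_le)
qed

lemma weightI:
  fixes w :: "'a::euclidean_space \<Rightarrow> real"
  assumes m: "w \<in> borel_measurable lebesgue" and p: "\<And>x. 0 < w x"
    and f: "\<And>c r. 0 < r \<Longrightarrow> (\<integral>\<^sup>+x\<in>cube c r. ennreal (w x) \<partial>lebesgue) < \<infinity>"
  shows "weight w"
  unfolding weight_def
proof (intro conjI allI impI m p)
  fix K :: "'a set" assume K: "compact K"
  then obtain r where r: "0 < r" "K \<subseteq> cube 0 r" using ex_cube_subset compact_imp_bounded by blast
  have "(\<integral>\<^sup>+x\<in>K. ennreal (w x) \<partial>lebesgue) \<le> (\<integral>\<^sup>+x\<in>cube 0 r. ennreal (w x) \<partial>lebesgue)"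
    using r by (intro nn_integral_mono) (auto simp: indicator_def)
  also have "\<dots> < \<infinity>" using r by (intro f)
  finally show "w absolutely_integrable_on K"
    using m p K by (subst set_integrable_lebesgue_iff_finite) (auto intro: less_imp_le lmeasurable_compact fmeasurableD)
qed

lemma sets_weighted [simp, measurable_cong]: "sets (weighted w) = sets lebesgue"
  by (simp add: weighted_def)

lemma space_weighted [simp]: "space (weighted w) = UNIV"
  by (simp add: weighted_def)

lemma weighted_one [simp]: "weighted (\<lambda>_. 1) = lebesgue"
  by (simp add: weighted_def density_1)

lemma nn_integral_weighted:
  assumes "w \<in> borel_measurable lebesgue" "F \<in> borel_measurable lebesgue"
  shows "(\<integral>\<^sup>+x. F x \<partial>weighted w) = (\<integral>\<^sup>+x. ennreal (w x) * F x \<partial>lebesgue)"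
  unfolding weighted_def using assms by (intro nn_integral_density) auto

lemma set_nn_integral_weighted:
  assumes "w \<in> borel_measurable lebesgue" "F \<in> borel_measurable lebesgue" "A \<in> sets lebesgue"
  shows "(\<integral>\<^sup>+x\<in>A. F x \<partial>weighted w) = (\<integral>\<^sup>+x\<in>A. ennreal (w x) * F x \<partial>lebesgue)"
  using assms by (subst nn_integral_weighted) (auto simp: mult.assoc)

lemma emeasure_weighted:
  assumes "w \<in> borel_measurable lebesgue" "A \<in> sets lebesgue"
  shows "emeasure (weighted w) A = (\<integral>\<^sup>+x\<in>A. ennreal (w x) \<partial>lebesgue)"
  unfolding weighted_def using assms by (intro emeasure_density) auto

lemma AE_weighted_iff:
  assumes "weight w"
  shows "(AE x in weighted w. P x) \<longleftrightarrow> (AE x in lebesgue. P x)"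
proof -
  have "(\<lambda>x. ennreal (w x)) \<in> borel_measurable lebesgue" using assms by measurable
  then show ?thesis
    unfolding weighted_def using weight_pos[OF assms] by (simp add: AE_density)
qed

lemma emeasure_cube_pos_finite:
  assumes "0 < r"
  shows "emeasure lebesgue (cube c r) \<noteq> 0" "emeasure lebesgue (cube c r) < top"
  using assms by (auto simp: emeasure_cube)

lemma emeasure_weighted_cube_pos:
  assumes w: "weight w" and r: "0 < r"
  shows "0 < emeasure (weighted w) (cube c r)"
proof (rule ccontr)
  note [measurable] = weight_measurable[OF w]
  assume "\<not> 0 < emeasure (weighted w) (cube c r)"
  then have "AE x in lebesgue. ennreal (w x) * indicator (cube c r) x = 0"
    by (simp add: emeasure_weighted nn_integral_0_iff_AE not_less)
  then have "AE x in lebesgue. x \<notin> cube c r"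
    by eventually_elim (use weight_pos[OF w] in \<open>auto simp: indicator_def ennreal_eq_0_iff not_le[symmetric] split: if_splits\<close>)
  then have "emeasure lebesgue (cube c r) = 0"
    by (simp add: AE_iff_null null_setsD1)
  then show False using emeasure_cube_pos_finite(1)[OF r, of c] by simp
qed

lemma emeasure_weighted_cube_finite:
  assumes w: "weight w"
  shows "emeasure (weighted w) (cube c r) < \<infinity>"
  using weight_cube_finite[OF w, of c r] by (simp add: emeasure_weighted weight_measurable[OF w])

text \<open>The constant is explicit because uniformity in it is what the hypothesis on
  \<open>\<phi>\<close> requires. The exceptional null set may depend on the cube; each application
  concerns one cube at a time.\<close>

definition A1 :: "real \<Rightarrow> ('a::euclidean_space \<Rightarrow> real) \<Rightarrow> bool" where
  "A1 C w \<longleftrightarrow> weight w \<and> (\<forall>Q\<in>cubes. AE x in lebesgue. x \<in> Q \<longrightarrow>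
     average Q (\<lambda>y. ennreal (w y)) \<le> ennreal C * ennreal (w x))"

lemma average_weight: "weight w \<Longrightarrow> 0 < r \<Longrightarrow>
    average (cube c r) (\<lambda>y. ennreal (w y)) = emeasure (weighted w) (cube c r) / emeasure lebesgue (cube c r)"
  by (simp add: average_def emeasure_weighted weight_measurable)

text \<open>The average over the tripled cube is at most \<open>C * w x\<close> for almost every
  \<open>x\<close> in the small cube; integrating this over the small cube compares the two masses.
  The power of 3 is the ratio of the Lebesgue measures.\<close>

lemma A1_cube_doubling:
  fixes w :: "'a::euclidean_space \<Rightarrow> real"
  assumes A1: "A1 C w"
  shows "cube_doubling (weighted w) (C * 3 ^ DIM('a))"
proof
  have w: "weight w" using A1 by (simp add: A1_def)
  note [measurable] = weight_measurable[OF w]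
  fix c :: 'a and r :: real assume r: "0 < r"
  show "0 < emeasure (weighted w) (cube c r)" by (rule emeasure_weighted_cube_pos[OF w r])
  show "emeasure (weighted w) (cube c r) < \<infinity>" by (rule emeasure_weighted_cube_finite[OF w])
  define a where "a = average (cube c (3 * r)) (\<lambda>y. ennreal (w y))"
  have "AE x in lebesgue. x \<in> cube c (3 * r) \<longrightarrow> a \<le> ennreal C * ennreal (w x)"
    using A1 r cube_in_cubes[of "3 * r" c] unfolding A1_def a_def by auto
  then have "AE x in lebesgue. a * indicator (cube c r) x \<le> ennreal C * (ennreal (w x) * indicator (cube c r) x)"
    by eventually_elim (use cube_mono[of r "3 * r" c] r in \<open>auto simp: indicator_def\<close>)
  then have "(\<integral>\<^sup>+x. a * indicator (cube c r) x \<partial>lebesgue) \<le> (\<integral>\<^sup>+x. ennreal C * (ennreal (w x) * indicator (cube c r) x) \<partial>lebesgue)"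
    by (rule nn_integral_mono_AE)
  then have le: "a * emeasure lebesgue (cube c r) \<le> ennreal C * emeasure (weighted w) (cube c r)"
    by (simp add: nn_integral_cmult_indicator nn_integral_cmult emeasure_weighted)
  have "emeasure (weighted w) (cube c (3 * r)) = a * emeasure lebesgue (cube c (3 * r))"
    using emeasure_cube_pos_finite[of "3 * r" c] r
    by (simp add: a_def average_weight[OF w] ennreal_divide_times)
  also have "emeasure lebesgue (cube c (3 * r)) = ennreal (3 ^ DIM('a)) * emeasure lebesgue (cube c r)"
  proof -
    have "(2 * (3 * r)) ^ DIM('a) = 3 ^ DIM('a) * (2 * r) ^ DIM('a)"
      by (metis mult.left_commute power_mult_distrib)
    then show ?thesis
      using r emeasure_cube[of "3 * r" c] emeasure_cube[of r c] by (simp only: ennreal_mult zero_le_power zero_less_mult_iff) simp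
  qed
  also have "a * \<dots> = ennreal (3 ^ DIM('a)) * (a * emeasure lebesgue (cube c r))"
    by (simp add: mult_ac)
  also have "\<dots> \<le> ennreal (3 ^ DIM('a)) * (ennreal C * emeasure (weighted w) (cube c r))"
    by (intro mult_left_mono le) simp
  also have "\<dots> = ennreal (C * 3 ^ DIM('a)) * emeasure (weighted w) (cube c r)"
    by (subst ennreal_mult'') (simp_all add: mult_ac)
  finally show "emeasure (weighted w) (cube c (3 * r)) \<le> ennreal (C * 3 ^ DIM('a)) * emeasure (weighted w) (cube c r)" .
qed simp

lemma weight_one: "weight (\<lambda>_::'a::euclidean_space. 1)"
  by (intro weightI) (auto simp: emeasure_cube less_top[symmetric])

lemma A1_one: "A1 1 (\<lambda>_. 1)"
  unfolding A1_def
proof (intro conjI weight_one ballI AE_I2 impI)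
  fix Q x assume "Q \<in> cubes" "x \<in> Q"
  then obtain c r where "Q = cube c r" "0 < r" by (metis cubesE)
  then show "average Q (\<lambda>y. ennreal 1) \<le> ennreal 1 * ennreal 1"
    using emeasure_cube_pos_finite[of r c] by (simp add: average_def)
qed

text \<open>The doubling constant of a measure is at least 1, which forces the sign of
  \<open>C\<close>.\<close>

lemma A1_const_pos:
  assumes "A1 C w"
  shows "0 < C"
proof (rule ccontr)
  assume "\<not> 0 < C"
  interpret cube_doubling "weighted w" "C * 3 ^ DIM('a)" by (rule A1_cube_doubling[OF assms])
  have "C * 3 ^ DIM('a) \<le> 0" using \<open>\<not> 0 < C\<close> by (intro mult_nonpos_nonneg) auto
  then show False using D_ge_1 by linarith
qed

lemma cube_doubling_lebesgue: "cube_doubling (lebesgue :: 'a::euclidean_space measure) (3 ^ DIM('a))"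
  using A1_cube_doubling[OF A1_one] by simp

text \<open>Lebesgue differentiation along the cubes with lower corner \<open>x\<close>.\<close>

lemma AE_le_cube_maximal:
  fixes f w :: "'a::euclidean_space \<Rightarrow> real"
  assumes w: "weight w" and f[measurable]: "f \<in> borel_measurable lebesgue" and f0: "\<And>x. 0 \<le> f x"
    and fin: "\<And>c r. 0 < r \<Longrightarrow> (\<integral>\<^sup>+x\<in>cube c r. ennreal (w x * f x) \<partial>lebesgue) < \<infinity>"
  shows "AE x in lebesgue. ennreal (f x) \<le> cube_maximal (weighted w) (\<lambda>y. ennreal (f y)) x"
proof -
  note [measurable] = weight_measurable[OF w]
  have cb: "\<exists>r>0. cbox a b \<subseteq> cube 0 r" for a b :: 'a
    by (rule ex_cube_subset) simp
  have ai: "g absolutely_integrable_on cbox a b"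
    if g: "g \<in> borel_measurable lebesgue" "\<And>x. 0 \<le> g x"
      "\<And>c r. 0 < r \<Longrightarrow> (\<integral>\<^sup>+x\<in>cube c r. ennreal (g x) \<partial>lebesgue) < \<infinity>" for g and a b :: 'a
  proof -
    obtain r where r: "0 < r" "cbox a b \<subseteq> cube 0 r" using cb by blast
    have "(\<integral>\<^sup>+x\<in>cbox a b. ennreal (g x) \<partial>lebesgue) \<le> (\<integral>\<^sup>+x\<in>cube 0 r. ennreal (g x) \<partial>lebesgue)"
      using r by (intro nn_integral_mono) (auto simp: indicator_def)
    also have "\<dots> < \<infinity>" by (rule g(3)[OF r(1)])
    finally have fin_box: "(\<integral>\<^sup>+x\<in>cbox a b. ennreal (g x) \<partial>lebesgue) < \<infinity>" .
    have "cbox a b \<in> sets lebesgue" by simp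
    from set_integrable_lebesgue_iff_finite[OF g(1,2) this] fin_box show ?thesis by (rule iffD2)
  qed
  have wai: "w absolutely_integrable_on cbox a b" for a b
    by (rule ai[OF weight_measurable[OF w] weight_nonneg[OF w] weight_cube_finite[OF w]])
  have wfai: "(\<lambda>x. w x * f x) absolutely_integrable_on cbox a b" for a b
    by (rule ai[OF _ mult_nonneg_nonneg[OF weight_nonneg[OF w] f0] fin]) measurable
  obtain N1 where N1: "negligible N1" "\<And>x e. \<lbrakk>x \<notin> N1; 0 < e\<rbrakk> \<Longrightarrow>
      \<exists>d>0. \<forall>h. 0 < h \<and> h < d \<longrightarrow> norm(integral (cbox x (x + h *\<^sub>R One)) w /\<^sub>R h ^ DIM('a) - w x) < e"
    by (rule integrable_ccontinuous_explicit[of w, OF set_lebesgue_integral_eq_integral(1)[OF wai]]) blast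
  obtain N2 where N2: "negligible N2" "\<And>x e. \<lbrakk>x \<notin> N2; 0 < e\<rbrakk> \<Longrightarrow>
      \<exists>d>0. \<forall>h. 0 < h \<and> h < d \<longrightarrow> norm(integral (cbox x (x + h *\<^sub>R One)) (\<lambda>x. w x * f x) /\<^sub>R h ^ DIM('a) - w x * f x) < e"
    by (rule integrable_ccontinuous_explicit[of "\<lambda>x. w x * f x", OF set_lebesgue_integral_eq_integral(1)[OF wfai]]) blast
  have "AE x in lebesgue. x \<notin> N1" "AE x in lebesgue. x \<notin> N2"
    using N1(1) N2(1) by (auto simp: negligible_iff_null_sets AE_not_in)
  then show ?thesis
  proof eventually_elim
    case (elim x)
    \<comment> \<open>Averages with respect to the measure \<open>w\<close> are quotients of two
      Lebesgue averages, one of \<open>w * f\<close> and one of \<open>w\<close>. Both differentiate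
      almost everywhere, and \<open>w x > 0\<close> permits taking the limit of the
      quotient.\<close>
    define Q where "Q h = cbox x (x + h *\<^sub>R One)" for h
    define a where "a h = integral (Q h) (\<lambda>x. w x * f x) /\<^sub>R h ^ DIM('a)" for h
    define b where "b h = integral (Q h) w /\<^sub>R h ^ DIM('a)" for h
    have lim_a: "(a \<longlongrightarrow> w x * f x) (at_right 0)"
    proof (rule tendstoI)
      fix e :: real assume "0 < e"
      then obtain d where "0 < d" "\<And>h. 0 < h \<Longrightarrow> h < d \<Longrightarrow> norm (a h - w x * f x) < e"
        using N2(2)[OF elim(2) \<open>0 < e\<close>] unfolding a_def Q_def by blast
      then show "\<forall>\<^sub>F h in at_right 0. dist (a h) (w x * f x) < e"
        by (auto simp: eventually_at_right_field dist_norm)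
    qed
    have lim_b: "(b \<longlongrightarrow> w x) (at_right 0)"
    proof (rule tendstoI)
      fix e :: real assume "0 < e"
      then obtain d where "0 < d" "\<And>h. 0 < h \<Longrightarrow> h < d \<Longrightarrow> norm (b h - w x) < e"
        using N1(2)[OF elim(1) \<open>0 < e\<close>] unfolding b_def Q_def by blast
      then show "\<forall>\<^sub>F h in at_right 0. dist (b h) (w x) < e"
        by (auto simp: eventually_at_right_field dist_norm)
    qed
    have lim: "((\<lambda>h. a h / b h) \<longlongrightarrow> f x) (at_right 0)"
      using tendsto_divide[OF lim_a lim_b] weight_pos[OF w, of x] by simp
    show "ennreal (f x) \<le> cube_maximal (weighted w) (\<lambda>y. ennreal (f y)) x"
    proof (cases "cube_maximal (weighted w) (\<lambda>y. ennreal (f y)) x")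
      case (real m)
      have le: "a h / b h \<le> m" if h: "0 < h" for h
      proof -
        have Q: "Q h \<in> cubes" "x \<in> Q h" using h unfolding Q_def cubes_def
          by (auto simp: mem_box inner_simps)
        obtain c r where cr: "Q h = cube c r" "0 < r" using Q(1) by (metis cubesE)
        have ea: "(\<integral>\<^sup>+y\<in>Q h. ennreal (f y) \<partial>weighted w) = ennreal (integral (Q h) (\<lambda>x. w x * f x))"
        proof -
          have "(\<integral>\<^sup>+y\<in>Q h. ennreal (f y) \<partial>weighted w) = (\<integral>\<^sup>+y\<in>Q h. ennreal (w y * f y) \<partial>lebesgue)"
            unfolding cr by (subst set_nn_integral_weighted) (auto simp: ennreal_mult weight_nonneg[OF w] f0)
          then show ?thesis unfolding Q_def
            using wfai by (subst (asm) set_nn_integral_eq_integral) (auto simp: weight_nonneg[OF w] f0)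
        qed
        have eb: "emeasure (weighted w) (Q h) = ennreal (integral (Q h) w)"
          unfolding Q_def using wai by (simp add: emeasure_weighted set_nn_integral_eq_integral weight_nonneg[OF w])
        have "(\<integral>\<^sup>+y\<in>Q h. ennreal (f y) \<partial>weighted w) / emeasure (weighted w) (Q h) \<le> ennreal m"
          unfolding real(2)[symmetric] cube_maximal_def using Q by (intro SUP_upper) auto
        moreover have bp: "0 < integral (Q h) w"
          using emeasure_weighted_cube_pos[OF w cr(2), of c] eb cr by simp
        moreover have ap: "0 \<le> integral (Q h) (\<lambda>x. w x * f x)"
          by (intro Henstock_Kurzweil_Integration.integral_nonneg)
             (auto simp: weight_nonneg[OF w] f0 Q_def set_lebesgue_integral_eq_integral(1)[OF wfai])
        ultimately have "integral (Q h) (\<lambda>x. w x * f x) / integral (Q h) w \<le> m"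
          using real(1) by (simp add: ea eb divide_ennreal)
        then show ?thesis using h by (simp add: a_def b_def field_simps)
      qed
      have "f x \<le> m"
        by (rule tendsto_upperbound[OF lim]) (use le in \<open>auto simp: eventually_at_right_field intro: exI[of _ 1]\<close>)
      then show ?thesis using real by (simp add: ennreal_leI)
    qed simp
  qed
qed

section \<open>Powers of maximal functions as \<open>A1\<close> weights\<close>

lemma A1_weight: "A1 C w \<Longrightarrow> weight w"
  by (simp add: A1_def)

text \<open>If the maximal function vanished at a single point, \<open>F\<close> would vanish almost
  everywhere on every cube centred there, hence almost everywhere. This makes powers of maximal
  functions admissible as weights.\<close>

lemma (in cube_doubling) cube_maximal_pos:
  assumes F[measurable]: "F \<in> borel_measurable lebesgue" and nz: "\<not> (AE x in N. F x = 0)"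
  shows "0 < cube_maximal N F x"
proof (rule ccontr)
  assume "\<not> 0 < cube_maximal N F x"
  then have z: "cube_maximal N F x = 0" by simp
  have "AE y in N. y \<in> cube x (real (Suc n)) \<longrightarrow> F y = 0" for n
  proof -
    have "(\<integral>\<^sup>+y\<in>cube x (real (Suc n)). F y \<partial>N) \<le> cube_maximal N F x * emeasure N (cube x (real (Suc n)))"
      by (intro average_le_cube_maximal) (auto simp: mem_cube)
    then have "(\<integral>\<^sup>+y. F y * indicator (cube x (real (Suc n))) y \<partial>N) = 0" using z by simp
    then have "AE y in N. F y * indicator (cube x (real (Suc n))) y = 0"
      by (subst (asm) nn_integral_0_iff_AE) auto
    then show ?thesis by eventually_elim (auto simp: indicator_def)
  qed
  then have "AE y in N. \<forall>n. y \<in> cube x (real (Suc n)) \<longrightarrow> F y = 0"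
    unfolding AE_all_countable by blast
  then have "AE y in N. F y = 0"
  proof eventually_elim
    case (elim y)
    obtain r where r: "0 < r" "{y} \<subseteq> cube x r" using ex_cube_subset[of "{y}" x] by auto
    obtain n where "r \<le> real n" using real_arch_simple by blast
    then have "y \<in> cube x (real (Suc n))" using r cube_mono[of r "real (Suc n)" x] by auto
    then show ?case using elim by blast
  qed
  then show False using nz by simp
qed

text \<open>The value \<open>1\<close> at \<open>\<infinity>\<close> keeps powers of maximal functions positive, as weights must be.\<close>

definition finite_real :: "ennreal \<Rightarrow> real" where
  "finite_real x = (if x = \<infinity> then 1 else enn2real x)"

lemma finite_real_pos: "0 < x \<Longrightarrow> 0 < finite_real x"
  by (cases x) (auto simp: finite_real_def)

lemma ennreal_finite_real: "x < \<infinity> \<Longrightarrow> ennreal (finite_real x) = x"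
  by (cases x) (auto simp: finite_real_def)

lemma borel_measurable_finite_real [measurable (raw)]:
  assumes [measurable]: "f \<in> borel_measurable M"
  shows "(\<lambda>x. finite_real (f x)) \<in> borel_measurable M"
  unfolding finite_real_def by measurable

text \<open>Cubes have positive measure. The typical use picks one point of a cube at which a
  maximal function is finite; that value already bounds the integral over the cube.\<close>

lemma AE_ex_in_cube:
  assumes "AE x in lebesgue. P x" "0 < r"
  shows "\<exists>x\<in>cube c r. P x"
proof (rule ccontr)
  assume "\<not> (\<exists>x\<in>cube c r. P x)"
  then have "AE x in lebesgue. x \<notin> cube c r" using assms(1) by (auto elim: eventually_mono)
  then have "emeasure lebesgue (cube c r) = 0"
    by (simp add: AE_iff_null null_setsD1)
  then show False using emeasure_cube_pos_finite(1)[OF assms(2), of c] by simp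
qed

text \<open>The first factor sums the dyadic levels. In \<open>D powr (d + 1)\<close>, the part
  \<open>D powr d\<close> comes from the truncation level \<open>D * t0\<close> and the last
  \<open>D\<close> from the mass of the tripled cube.\<close>

definition rochberg_const :: "real \<Rightarrow> real \<Rightarrow> real" where
  "rochberg_const D d = (1 + 2 powr d / (1 - 2 powr (d - 1))) * D powr (d + 1)"

lemma rochberg_const_nonneg: "d < 1 \<Longrightarrow> 0 \<le> rochberg_const D d"
  unfolding rochberg_const_def by (intro mult_nonneg_nonneg add_nonneg_nonneg divide_nonneg_nonneg) (auto simp: powr_le_one_le less_imp_le powr_less_one)

text \<open>Coifman--Rochberg relative to the measure \<open>w\<close>: the \<open>w\<close>-average
  of the power over a cube is at most the Rochberg constant times its value at a point
  \<open>x\<close> of the cube, and the Lebesgue average of \<open>w\<close> itself costs another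
  \<open>C * w x\<close>. The resulting constant is independent of \<open>F\<close>.\<close>

lemma A1_mult_cube_maximal_powr:
  fixes w :: "'a::euclidean_space \<Rightarrow> real"
  assumes A1: "A1 C w" and F[measurable]: "F \<in> borel_measurable lebesgue"
    and fin: "AE x in lebesgue. cube_maximal (weighted w) F x < \<infinity>"
    and pos: "\<And>x. 0 < cube_maximal (weighted w) F x" and d: "0 < d" "d < 1"
  shows "A1 (rochberg_const (C * 3 ^ DIM('a)) d * C)
    (\<lambda>x. w x * finite_real (cube_maximal (weighted w) F x) powr d)" (is "A1 (?K * C) ?v")
proof -
  have w: "weight w" using A1 by (rule A1_weight)
  interpret cube_doubling "weighted w" "C * 3 ^ DIM('a)" by (rule A1_cube_doubling[OF A1])
  note [measurable] = weight_measurable[OF w]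
  have M[measurable]: "cube_maximal (weighted w) F \<in> borel_measurable lebesgue" by (rule borel_measurable_cube_maximal)
  define h where "h x = finite_real (cube_maximal (weighted w) F x) powr d" for x
  have h[measurable]: "h \<in> borel_measurable lebesgue" unfolding h_def by measurable
  have h0: "0 < h x" for x using finite_real_pos[OF pos[of x]] by (simp add: h_def)
  have K0: "0 \<le> ?K" using d by (intro rochberg_const_nonneg)
  have bound: "(\<integral>\<^sup>+y\<in>cube c r. ennreal (w y * h y) \<partial>lebesgue)
      \<le> ennreal (?K * h x) * emeasure (weighted w) (cube c r)"
    if r: "0 < r" and x: "x \<in> cube c r" and fx: "cube_maximal (weighted w) F x < \<infinity>" for c r x
  proof -
    have "(\<integral>\<^sup>+y\<in>cube c r. ennreal (w y * h y) \<partial>lebesgue) = (\<integral>\<^sup>+y\<in>cube c r. ennreal (h y) \<partial>weighted w)"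
      by (subst set_nn_integral_weighted) (auto simp: ennreal_mult weight_nonneg[OF w] h0 less_imp_le)
    also have "\<dots> \<le> (\<integral>\<^sup>+y\<in>cube c r. ennreal_powr (cube_maximal (weighted w) F y) d \<partial>weighted w)"
    proof (rule nn_integral_mono_AE)
      have "AE y in weighted w. cube_maximal (weighted w) F y < \<infinity>"
        using fin by (simp add: AE_weighted_iff[OF w])
      then show "AE y in weighted w. ennreal (h y) * indicator (cube c r) y
          \<le> ennreal_powr (cube_maximal (weighted w) F y) d * indicator (cube c r) y"
        by eventually_elim (auto simp: h_def finite_real_def ennreal_powr_def)
    qed
    also have "\<dots> \<le> ennreal (?K * finite_real (cube_maximal (weighted w) F x) powr d) * emeasure (weighted w) (cube c r)"
      unfolding rochberg_const_def
    proof (rule nn_integral_cube_maximal_powr_le[OF F r x _ _ d])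
      show "0 < finite_real (cube_maximal (weighted w) F x)" by (rule finite_real_pos[OF pos])
      show "cube_maximal (weighted w) F x \<le> ennreal (finite_real (cube_maximal (weighted w) F x))"
        using ennreal_finite_real[OF fx] by simp
    qed
    finally show ?thesis by (simp add: h_def)
  qed
  have "weight (\<lambda>x. w x * h x)"
  proof (rule weightI)
    show "0 < w x * h x" for x using h0 weight_pos[OF w] by simp
    fix c :: 'a and r :: real assume r: "0 < r"
    obtain x where x: "x \<in> cube c r" "cube_maximal (weighted w) F x < \<infinity>"
      using AE_ex_in_cube[OF fin r] by blast
    have "(\<integral>\<^sup>+y\<in>cube c r. ennreal (w y * h y) \<partial>lebesgue) \<le> ennreal (?K * h x) * emeasure (weighted w) (cube c r)"
      by (rule bound[OF r x])
    also have "\<dots> < \<infinity>" using emeasure_cube_finite[OF r, of c] by (simp add: ennreal_mult_less_top)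
    finally show "(\<integral>\<^sup>+y\<in>cube c r. ennreal (w y * h y) \<partial>lebesgue) < \<infinity>" .
  qed measurable
  moreover have "AE x in lebesgue. x \<in> Q \<longrightarrow> average Q (\<lambda>y. ennreal (w y * h y)) \<le> ennreal (?K * C) * ennreal (w x * h x)"
    if Q: "Q \<in> cubes" for Q
  proof -
    have "AE x in lebesgue. x \<in> Q \<longrightarrow> average Q (\<lambda>y. ennreal (w y)) \<le> ennreal C * ennreal (w x)"
      using A1 Q by (simp add: A1_def)
    then show ?thesis using fin
    proof (eventually_elim, intro impI)
      fix x assume a: "x \<in> Q \<longrightarrow> average Q (\<lambda>y. ennreal (w y)) \<le> ennreal C * ennreal (w x)"
        and f: "cube_maximal (weighted w) F x < \<infinity>" and x: "x \<in> Q"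
      obtain c r where cr: "Q = cube c r" "0 < r" using Q by (metis cubesE)
      note l = emeasure_cube_pos_finite[OF cr(2), of c]
      have "average Q (\<lambda>y. ennreal (w y * h y)) \<le> (ennreal (?K * h x) * emeasure (weighted w) (cube c r)) / emeasure lebesgue (cube c r)"
        unfolding average_def cr using x cr f by (intro divide_right_mono_ennreal bound) auto
      also have "\<dots> = ennreal (?K * h x) * average Q (\<lambda>y. ennreal (w y))"
        unfolding cr using cr by (simp add: average_weight[OF w] ennreal_times_divide)
      also have "\<dots> \<le> ennreal (?K * h x) * (ennreal C * ennreal (w x))"
        using a x by (intro mult_left_mono) auto
      also have "\<dots> = ennreal (?K * C) * ennreal (w x * h x)"
        using K0 h0[of x] weight_nonneg[OF w, of x] A1_const_pos[OF A1]
        by (simp add: ennreal_mult[symmetric] mult_ac)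
      finally show "average Q (\<lambda>y. ennreal (w y * h y)) \<le> ennreal (?K * C) * ennreal (w x * h x)" .
    qed
  qed
  ultimately show ?thesis unfolding A1_def h_def by blast
qed

text \<open>The power of a maximum is at most the sum of the powers, and both the constant and the
  Coifman--Rochberg part are controlled by the maximum at a given point. The resulting constant
  depends neither on \<open>t\<close> nor on \<open>F\<close>. On the null set where the maximal
  function is infinite, \<open>enn2real\<close> gives 0 and the maximum is \<open>t\<close>.\<close>

lemma A1_max_cube_maximal_powr:
  fixes F :: "'a::euclidean_space \<Rightarrow> ennreal"
  assumes F[measurable]: "F \<in> borel_measurable lebesgue"
    and fin: "AE x in lebesgue. cube_maximal lebesgue F x < \<infinity>"
    and t: "0 < t" and d: "0 < d" "d < 1"
  shows "A1 (1 + rochberg_const (3 ^ DIM('a)) d)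
    (\<lambda>x. max t (enn2real (cube_maximal lebesgue F x)) powr d)" (is "A1 (1 + ?K) ?v")
proof -
  interpret cube_doubling "weighted (\<lambda>_::'a. 1)" "1 * 3 ^ DIM('a)" by (rule A1_cube_doubling[OF A1_one])
  have M[measurable]: "cube_maximal lebesgue F \<in> borel_measurable lebesgue"
    using borel_measurable_cube_maximal[of F] by simp
  define m where "m x = max t (enn2real (cube_maximal lebesgue F x))" for x
  have m[measurable]: "m \<in> borel_measurable lebesgue" unfolding m_def by measurable
  have mt: "t \<le> m x" and m0: "0 < m x" for x using t by (auto simp: m_def)
  have K0: "0 \<le> ?K" using d by (intro rochberg_const_nonneg)
  have bound: "(\<integral>\<^sup>+y\<in>cube c r. ennreal (m y powr d) \<partial>lebesgue)
      \<le> (ennreal (1 + ?K) * ennreal (m x powr d)) * emeasure lebesgue (cube c r)"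
    if r: "0 < r" and x: "x \<in> cube c r" and fx: "cube_maximal lebesgue F x < \<infinity>" for c r x
  proof -
    have "(\<integral>\<^sup>+y\<in>cube c r. ennreal (m y powr d) \<partial>lebesgue)
        \<le> (\<integral>\<^sup>+y. ennreal (t powr d) * indicator (cube c r) y + ennreal_powr (cube_maximal lebesgue F y) d * indicator (cube c r) y \<partial>lebesgue)"
    proof (rule nn_integral_mono)
      fix y
      have "ennreal (m y powr d) \<le> ennreal (t powr d) + ennreal_powr (cube_maximal lebesgue F y) d"
        using t by (cases "cube_maximal lebesgue F y") (auto simp: m_def max_def add_increasing add_increasing2)
      then show "ennreal (m y powr d) * indicator (cube c r) y \<le> ennreal (t powr d) * indicator (cube c r) y + ennreal_powr (cube_maximal lebesgue F y) d * indicator (cube c r) y"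
        by (auto simp: indicator_def)
    qed
    also have "\<dots> = ennreal (t powr d) * emeasure lebesgue (cube c r) + (\<integral>\<^sup>+y\<in>cube c r. ennreal_powr (cube_maximal lebesgue F y) d \<partial>lebesgue)"
      by (subst nn_integral_add) (auto simp: nn_integral_cmult_indicator)
    also have "(\<integral>\<^sup>+y\<in>cube c r. ennreal_powr (cube_maximal lebesgue F y) d \<partial>lebesgue) \<le> ennreal (?K * m x powr d) * emeasure lebesgue (cube c r)"
    proof -
      have "cube_maximal lebesgue F x \<le> ennreal (m x)"
        using fx by (cases "cube_maximal lebesgue F x") (auto simp: m_def intro!: ennreal_leI)
      then show ?thesis
        using nn_integral_cube_maximal_powr_le[OF F r x m0[of x] _ d] by (simp add: rochberg_const_def)
    qed
    also have "ennreal (t powr d) * emeasure lebesgue (cube c r) \<le> ennreal (m x powr d) * emeasure lebesgue (cube c r)"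
      using mt t d by (intro mult_right_mono ennreal_leI powr_mono2) auto
    finally have "(\<integral>\<^sup>+y\<in>cube c r. ennreal (m y powr d) \<partial>lebesgue) \<le>
        ennreal (m x powr d) * emeasure lebesgue (cube c r) + ennreal (?K * m x powr d) * emeasure lebesgue (cube c r)"
      by (simp add: add_mono)
    also have "\<dots> = (ennreal (1 + ?K) * ennreal (m x powr d)) * emeasure lebesgue (cube c r)"
      using K0 by (simp add: ennreal_mult distrib_right)
    finally show ?thesis .
  qed
  have "weight (\<lambda>x. m x powr d)"
  proof (rule weightI)
    show "0 < m x powr d" for x using m0[of x] by simp
    fix c :: 'a and r :: real assume r: "0 < r"
    obtain x where x: "x \<in> cube c r" "cube_maximal lebesgue F x < \<infinity>"
      using AE_ex_in_cube[OF fin r] by blast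
    have "(\<integral>\<^sup>+y\<in>cube c r. ennreal (m y powr d) \<partial>lebesgue)
        \<le> (ennreal (1 + ?K) * ennreal (m x powr d)) * emeasure lebesgue (cube c r)"
      by (rule bound[OF r x])
    also have "\<dots> < \<infinity>" using emeasure_cube_pos_finite[OF r, of c] by (simp add: ennreal_mult_less_top)
    finally show "(\<integral>\<^sup>+y\<in>cube c r. ennreal (m y powr d) \<partial>lebesgue) < \<infinity>" .
  qed measurable
  moreover have "AE x in lebesgue. x \<in> Q \<longrightarrow> average Q (\<lambda>y. ennreal (m y powr d)) \<le> ennreal (1 + ?K) * ennreal (m x powr d)"
    if Q: "Q \<in> cubes" for Q
    using fin
  proof (eventually_elim, intro impI)
    fix x assume f: "cube_maximal lebesgue F x < \<infinity>" and x: "x \<in> Q"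
    obtain c r where cr: "Q = cube c r" "0 < r" using Q by (metis cubesE)
    show "average Q (\<lambda>y. ennreal (m y powr d)) \<le> ennreal (1 + ?K) * ennreal (m x powr d)"
      unfolding average_def cr
      using bound[OF cr(2) _ f] x cr emeasure_cube_pos_finite[OF cr(2), of c] by (simp add: ennreal_divide_le_iff)
  qed
  ultimately show ?thesis unfolding A1_def m_def by blast
qed

subsection \<open>\<open>A\<^sub>\<infinity>\<close> weights from pairs of \<open>A\<^sub>1\<close> weights\<close>

lemma nn_average_le:
  assumes "0 < r" "AE x in lebesgue. x \<in> cube c r \<longrightarrow> g x \<le> ennreal b * h x" "h \<in> borel_measurable lebesgue"
  shows "average (cube c r) g \<le> ennreal b * average (cube c r) h"
proof -
  have "(\<integral>\<^sup>+x\<in>cube c r. g x \<partial>lebesgue) \<le> (\<integral>\<^sup>+x. ennreal b * (h x * indicator (cube c r) x) \<partial>lebesgue)"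
    using assms(2) by (intro nn_integral_mono_AE) (auto elim!: eventually_mono simp: indicator_def)
  also have "\<dots> = ennreal b * (\<integral>\<^sup>+x\<in>cube c r. h x \<partial>lebesgue)"
    using assms(3) by (intro nn_integral_cmult) auto
  finally show ?thesis
    unfolding average_def by (metis divide_right_mono_ennreal ennreal_times_divide)
qed

lemma average_less_top_iff:
  "0 < r \<Longrightarrow> average (cube c r) g < \<infinity> \<longleftrightarrow> (\<integral>\<^sup>+x\<in>cube c r. g x \<partial>lebesgue) < \<infinity>"
  using emeasure_cube_pos_finite[of r c] by (simp add: average_def divide_less_ennreal ennreal_top_mult)

lemma average_weight_real:
  assumes "weight w" "0 < r"
  obtains a where "average (cube c r) (\<lambda>y. ennreal (w y)) = ennreal a" "0 < a"
proof -
  have "0 < average (cube c r) (\<lambda>y. ennreal (w y))"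
    using emeasure_weighted_cube_pos[OF assms, of c] emeasure_cube_pos_finite[OF assms(2), of c]
    by (simp add: average_weight[OF assms] ennreal_zero_less_divide)
  moreover have "average (cube c r) (\<lambda>y. ennreal (w y)) < \<infinity>"
    using weight_cube_finite[OF assms(1), of c r] average_less_top_iff[OF assms(2)] by blast
  ultimately show ?thesis using that by (cases "average (cube c r) (\<lambda>y. ennreal (w y))") auto
qed

text \<open>Local boundedness controls \<open>\<phi>\<close> only on intervals that start just above
  0, so the constant fed into it has to be strictly positive.\<close>

lemma A_infty_const_pos:
  assumes w: "weight w"
  shows "0 < A_infty_const w"
proof -
  obtain a where "average (cube 0 1) (\<lambda>y. ennreal (w y)) = ennreal a" "0 < a"
    using average_weight_real[OF w zero_less_one] by blast
  then show ?thesis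
    unfolding A_infty_const_def less_SUP_iff
    by (intro bexI[of _ "cube 0 1"]) (auto simp: cube_in_cubes ennreal_zero_less_mult_iff)
qed

lemma measure_cube_pos: "0 < r \<Longrightarrow> 0 < measure lebesgue (cube c r)"
  using emeasure_cube_pos_finite[of r c] by (simp add: measure_def enn2real_positive_iff zero_less_iff_neq_zero)

lemma average_eq_imp_integral:
  assumes r: "0 < r" and \<sigma>: "\<sigma> \<in> borel_measurable lebesgue" "\<And>x. 0 \<le> \<sigma> x"
    and m: "average (cube c r) (\<lambda>x. ennreal (\<sigma> x)) = ennreal m" "0 \<le> m"
  shows "\<sigma> absolutely_integrable_on cube c r"
    and "(LINT x:cube c r|lebesgue. \<sigma> x) = m * measure lebesgue (cube c r)"
proof -
  note l = emeasure_cube_pos_finite[OF r, of c]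
  have e: "(\<integral>\<^sup>+x\<in>cube c r. ennreal (\<sigma> x) \<partial>lebesgue) = ennreal m * emeasure lebesgue (cube c r)"
    unfolding m(1)[symmetric] average_def using l by (simp add: ennreal_divide_times)
  also have "\<dots> = ennreal (m * measure lebesgue (cube c r))"
    using l m by (simp add: emeasure_eq_ennreal_measure ennreal_mult)
  finally have e': "(\<integral>\<^sup>+x\<in>cube c r. ennreal (\<sigma> x) \<partial>lebesgue) = ennreal (m * measure lebesgue (cube c r))" .
  show i: "\<sigma> absolutely_integrable_on cube c r"
    by (rule iffD2[OF set_integrable_lebesgue_iff_finite[OF \<sigma> cube_sets]]) (simp add: e')
  have "0 \<le> integral (cube c r) \<sigma>"
    by (intro Henstock_Kurzweil_Integration.integral_nonneg set_lebesgue_integral_eq_integral(1)[OF i] \<sigma>(2))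
  then show "(LINT x:cube c r|lebesgue. \<sigma> x) = m * measure lebesgue (cube c r)"
    using e' set_nn_integral_eq_integral[OF \<sigma> cube_sets i] m set_lebesgue_integral_eq_integral(2)[OF i] by simp
qed

text \<open>Jensen's inequality for the logarithm, from \<open>ln (\<sigma> / m) \<le> \<sigma> / m - 1\<close>.\<close>

lemma average_ln_le:
  assumes r: "0 < r" and \<sigma>: "\<sigma> \<in> borel_measurable lebesgue" "\<And>x. 0 < \<sigma> x"
    and m: "average (cube c r) (\<lambda>x. ennreal (\<sigma> x)) = ennreal m" "0 < m"
    and ln: "(\<lambda>x. ln (\<sigma> x)) absolutely_integrable_on cube c r"
  shows "(LINT x:cube c r|lebesgue. ln (\<sigma> x)) / measure lebesgue (cube c r) \<le> ln m"
proof -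
  define l where "l = measure lebesgue (cube c r)"
  have l: "0 < l" unfolding l_def by (rule measure_cube_pos[OF r])
  note i = average_eq_imp_integral[OF r \<sigma>(1) less_imp_le[OF \<sigma>(2)] m(1) less_imp_le[OF m(2)]]
  have c1: "(\<lambda>x. k) absolutely_integrable_on cube c r" for k :: real
    unfolding cube_def by (intro absolutely_integrable_continuous continuous_on_const)
  have c2: "(LINT x:cube c r|lebesgue. k) = k * l" for k :: real
    using set_lebesgue_integral_eq_integral(2)[OF c1, of k] by (simp add: l_def cube_def)
  have ls: "(\<lambda>x. (1 / m) * \<sigma> x) absolutely_integrable_on cube c r"
    by (intro set_integrable_mult_right i(1))
  have "(LINT x:cube c r|lebesgue. ln (\<sigma> x)) \<le> (LINT x:cube c r|lebesgue. (ln m - 1) + (1 / m) * \<sigma> x)"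
  proof (rule set_integral_mono)
    fix x
    have "ln (\<sigma> x / m) \<le> \<sigma> x / m - 1" using \<sigma>(2)[of x] m(2) by (intro ln_le_minus_one) auto
    then show "ln (\<sigma> x) \<le> (ln m - 1) + (1 / m) * \<sigma> x" using \<sigma>(2)[of x] m(2) by (simp add: ln_div)
  qed (use ln c1 ls set_integral_add(1) in auto)
  also have "\<dots> = (ln m - 1) * l + (1 / m) * (m * l)"
    unfolding set_integral_add(2)[OF c1 ls] set_integral_mult_right i(2) c2 l_def ..
  also have "\<dots> = ln m * l" using m(2) by (simp add: algebra_simps)
  finally show ?thesis using l by (simp add: l_def[symmetric] field_simps)
qed

text \<open>The easy half of factorization: \<open>w = w1 * w2 powr (- b)\<close> is a Muckenhoupt
  weight for the exponent \<open>1 + b\<close>. Its dual weight is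
  \<open>\<sigma> = w1 powr (- 1 / b) * w2\<close>. The \<open>A1\<close> lower bounds replace
  \<open>w2\<close> in \<open>w\<close>, and \<open>w1\<close> in \<open>\<sigma>\<close>, by their
  averages. For the second claim, \<open>ln (inverse (w x)) = b * ln (\<sigma> x)\<close>, and
  Jensen's inequality for \<open>\<sigma>\<close> bounds the exponential by a power of its
  average.\<close>

lemma
  fixes w1 w2 :: "'a::euclidean_space \<Rightarrow> real"
  assumes A1: "A1 C1 w1" and A2: "A1 C2 w2" and b: "0 < b"
  shows A1_mult_powr_in_A_infty: "(\<lambda>x. w1 x * w2 x powr (- b)) \<in> A_infty"
    and A_infty_const_A1_mult_powr: "A_infty_const (\<lambda>x. w1 x * w2 x powr (- b)) \<le> ennreal (C1 * C2 powr b)"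
proof -
  define w where "w x = w1 x * w2 x powr (- b)" for x
  define \<sigma> where "\<sigma> x = w x powr (- 1 / b)" for x
  note W1 = A1_weight[OF A1] note W2 = A1_weight[OF A2]
  note C = A1_const_pos[OF A1] A1_const_pos[OF A2]
  note [measurable] = weight_measurable[OF W1] weight_measurable[OF W2]
  note p = weight_pos[OF W1] weight_pos[OF W2]
  have wm[measurable]: "w \<in> borel_measurable lebesgue" unfolding w_def by measurable
  have \<sigma>m[measurable]: "\<sigma> \<in> borel_measurable lebesgue" unfolding \<sigma>_def by measurable
  have w0: "0 < w x" and \<sigma>0: "0 < \<sigma> x" for x
    using p[of x] less_imp_neq[OF p(1)[of x]] less_imp_neq[OF p(2)[of x]] by (auto simp: w_def \<sigma>_def)
  have \<sigma>_eq: "\<sigma> x = w1 x powr (- 1 / b) * w2 x" for x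
    using p[of x] b by (simp add: \<sigma>_def w_def powr_mult powr_powr)
  have key: "\<exists>A S. average (cube c r) (\<lambda>x. ennreal (w x)) \<le> ennreal A \<and>
      average (cube c r) (\<lambda>x. ennreal (\<sigma> x)) \<le> ennreal S \<and> 0 < A \<and> 0 < S \<and> A * S powr b = C1 * C2 powr b"
    if r: "0 < r" for c r
  proof -
    obtain a1 where a1: "average (cube c r) (\<lambda>y. ennreal (w1 y)) = ennreal a1" "0 < a1"
      using average_weight_real[OF W1 r] by blast
    obtain a2 where a2: "average (cube c r) (\<lambda>y. ennreal (w2 y)) = ennreal a2" "0 < a2"
      using average_weight_real[OF W2 r] by blast
    have E1: "AE x in lebesgue. x \<in> cube c r \<longrightarrow> ennreal a1 \<le> ennreal C1 * ennreal (w1 x)"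
      using A1 cube_in_cubes[OF r] unfolding A1_def a1(1)[symmetric] by blast
    have E2: "AE x in lebesgue. x \<in> cube c r \<longrightarrow> ennreal a2 \<le> ennreal C2 * ennreal (w2 x)"
      using A2 cube_in_cubes[OF r] unfolding A1_def a2(1)[symmetric] by blast
    have F1: "AE x in lebesgue. x \<in> cube c r \<longrightarrow> ennreal (w x) \<le> ennreal ((a2 / C2) powr (- b)) * ennreal (w1 x)"
      using E2
    proof (eventually_elim, intro impI)
      fix x assume "x \<in> cube c r \<longrightarrow> ennreal a2 \<le> ennreal C2 * ennreal (w2 x)" "x \<in> cube c r"
      then have "a2 \<le> C2 * w2 x" using p[of x] C by (simp add: ennreal_mult[symmetric])
      then have "a2 / C2 \<le> w2 x" using C by (simp add: field_simps)
      then have "w2 x powr (- b) \<le> (a2 / C2) powr (- b)"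
        using a2 C b by (intro powr_mono2') auto
      then have "w x \<le> (a2 / C2) powr (- b) * w1 x"
        using p[of x] by (simp add: w_def mult.commute)
      then show "ennreal (w x) \<le> ennreal ((a2 / C2) powr (- b)) * ennreal (w1 x)"
        using p[of x] by (simp add: ennreal_mult[symmetric] ennreal_leI)
    qed
    have F2: "AE x in lebesgue. x \<in> cube c r \<longrightarrow> ennreal (\<sigma> x) \<le> ennreal ((a1 / C1) powr (- 1 / b)) * ennreal (w2 x)"
      using E1
    proof (eventually_elim, intro impI)
      fix x assume "x \<in> cube c r \<longrightarrow> ennreal a1 \<le> ennreal C1 * ennreal (w1 x)" "x \<in> cube c r"
      then have "a1 \<le> C1 * w1 x" using p[of x] C by (simp add: ennreal_mult[symmetric])
      then have "a1 / C1 \<le> w1 x" using C by (simp add: field_simps)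
      then have "w1 x powr (- 1 / b) \<le> (a1 / C1) powr (- 1 / b)"
        using a1 C b by (intro powr_mono2') auto
      then have "\<sigma> x \<le> (a1 / C1) powr (- 1 / b) * w2 x"
        using p[of x] by (simp add: \<sigma>_eq)
      then show "ennreal (\<sigma> x) \<le> ennreal ((a1 / C1) powr (- 1 / b)) * ennreal (w2 x)"
        using p[of x] by (simp add: ennreal_mult[symmetric] ennreal_leI)
    qed
    \<comment> \<open>In \<open>A * S powr b\<close> the averages \<open>a1\<close> and
      \<open>a2\<close> cancel, so that only the \<open>A1\<close> constants remain.\<close>
    define A where "A = (a2 / C2) powr (- b) * a1"
    define S where "S = (a1 / C1) powr (- 1 / b) * a2"
    have "average (cube c r) (\<lambda>x. ennreal (w x)) \<le> ennreal A"
      using nn_average_le[OF r F1] a1 by (simp add: A_def ennreal_mult)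
    moreover have "average (cube c r) (\<lambda>x. ennreal (\<sigma> x)) \<le> ennreal S"
      using nn_average_le[OF r F2] a2 by (simp add: S_def ennreal_mult)
    moreover have "0 < A" "0 < S" using a1 a2 C by (auto simp: A_def S_def)
    moreover have "A * S powr b = C1 * C2 powr b"
      using a1 a2 C b by (simp add: A_def S_def powr_mult powr_divide powr_powr powr_minus field_simps)
    ultimately show ?thesis by blast
  qed
  have ww: "weight w"
  proof (rule weightI[OF wm w0])
    fix c :: 'a and r :: real assume r: "0 < r"
    obtain A where "average (cube c r) (\<lambda>x. ennreal (w x)) \<le> ennreal A" using key[OF r] by blast
    then have "average (cube c r) (\<lambda>x. ennreal (w x)) < \<infinity>" by (simp add: le_less_trans)
    then show "(\<integral>\<^sup>+x\<in>cube c r. ennreal (w x) \<partial>lebesgue) < \<infinity>"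
      by (simp only: average_less_top_iff[OF r])
  qed
  have "w \<in> Muckenhoupt (1 + b)"
  proof -
    have "(SUP Q\<in>cubes. average Q (\<lambda>x. ennreal (w x)) *
        ennreal_powr (average Q (\<lambda>x. ennreal (w x powr (-1 / (1 + b - 1))))) (1 + b - 1)) \<le> ennreal (C1 * C2 powr b)"
    proof (rule SUP_least)
      fix Q :: "'a set" assume "Q \<in> cubes"
      then obtain c r where cr: "Q = cube c r" "0 < r" by (metis cubesE)
      obtain A S where AS: "average Q (\<lambda>x. ennreal (w x)) \<le> ennreal A"
        "average Q (\<lambda>x. ennreal (\<sigma> x)) \<le> ennreal S" "0 < A" "0 < S" "A * S powr b = C1 * C2 powr b"
        using key[OF cr(2), of c] unfolding cr by blast
      have "average Q (\<lambda>x. ennreal (w x)) * ennreal_powr (average Q (\<lambda>x. ennreal (\<sigma> x))) b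
          \<le> ennreal A * ennreal_powr (ennreal S) b"
        using AS b by (intro mult_mono ennreal_powr_mono) auto
      also have "\<dots> = ennreal (C1 * C2 powr b)" using AS by (simp add: ennreal_mult[symmetric])
      finally show "average Q (\<lambda>x. ennreal (w x)) *
        ennreal_powr (average Q (\<lambda>x. ennreal (w x powr (-1 / (1 + b - 1))))) (1 + b - 1) \<le> ennreal (C1 * C2 powr b)"
        by (simp add: \<sigma>_def)
    qed
    then show ?thesis unfolding Muckenhoupt_def using ww by (auto intro: le_less_trans)
  qed
  then show "(\<lambda>x. w1 x * w2 x powr (- b)) \<in> A_infty"
    unfolding A_infty_def w_def using b by (intro UN_I[of "1 + b"]) auto
  have "A_infty_const w \<le> ennreal (C1 * C2 powr b)"
    unfolding A_infty_const_def
  proof (rule SUP_least)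
    fix Q :: "'a set" assume "Q \<in> cubes"
    then obtain c r where cr: "Q = cube c r" "0 < r" by (metis cubesE)
    obtain A S where AS: "average Q (\<lambda>x. ennreal (w x)) \<le> ennreal A"
      "average Q (\<lambda>x. ennreal (\<sigma> x)) \<le> ennreal S" "0 < A" "0 < S" "A * S powr b = C1 * C2 powr b"
      using key[OF cr(2), of c] unfolding cr by blast
    have w\<sigma>: "weight \<sigma>"
    proof (rule weightI[OF \<sigma>m \<sigma>0])
      fix c :: 'a and r :: real assume r: "0 < r"
      obtain A where "average (cube c r) (\<lambda>x. ennreal (\<sigma> x)) \<le> ennreal A" using key[OF r] by blast
      then have "average (cube c r) (\<lambda>x. ennreal (\<sigma> x)) < \<infinity>" by (simp add: le_less_trans)
      then show "(\<integral>\<^sup>+x\<in>cube c r. ennreal (\<sigma> x) \<partial>lebesgue) < \<infinity>"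
        by (simp only: average_less_top_iff[OF r])
    qed
    obtain m where m: "average (cube c r) (\<lambda>x. ennreal (\<sigma> x)) = ennreal m" "0 < m"
      using average_weight_real[OF w\<sigma> cr(2)] by blast
    obtain n where n: "average (cube c r) (\<lambda>x. ennreal (w x)) = ennreal n" "0 < n"
      using average_weight_real[OF ww cr(2)] by blast
    have ln_eq: "ln (inverse (w x)) = b * ln (\<sigma> x)" for x
      using w0[of x] b by (simp add: \<sigma>_def ln_inverse ln_powr)
    \<comment> \<open>This function dominates the logarithm on both sides:
      \<open>ln (w x) \<le> w x\<close>, and
      \<open>- ln (w x) = b * ln (\<sigma> x) \<le> b * \<sigma> x\<close>. Hence the infinite
      branch of \<open>A_infty_const\<close> does not occur.\<close>
    have dom: "(\<lambda>x. w x + b * \<sigma> x) absolutely_integrable_on cube c r"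
      using average_eq_imp_integral(1)[OF cr(2) wm less_imp_le[OF w0] n(1) less_imp_le[OF n(2)]]
        average_eq_imp_integral(1)[OF cr(2) \<sigma>m less_imp_le[OF \<sigma>0] m(1) less_imp_le[OF m(2)]]
      by (intro set_integral_add(1) set_integrable_mult_right)
    have lnw: "(\<lambda>x. ln (inverse (w x))) absolutely_integrable_on cube c r"
    proof (rule set_integrable_bound[OF dom])
      show "set_borel_measurable lebesgue (cube c r) (\<lambda>x. ln (inverse (w x)))"
        unfolding set_borel_measurable_def by measurable
      show "AE x in lebesgue. x \<in> cube c r \<longrightarrow> norm (ln (inverse (w x))) \<le> norm (w x + b * \<sigma> x)"
      proof (intro AE_I2 impI)
        fix x
        have "ln (w x) \<le> w x" using ln_le_minus_one[OF w0, of x] by simp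
        moreover have "ln (inverse (w x)) = - ln (w x)" using w0[of x] by (simp add: ln_inverse)
        moreover have "b * ln (\<sigma> x) \<le> b * \<sigma> x"
          using ln_le_minus_one[OF \<sigma>0, of x] b by (intro mult_left_mono) auto
        moreover have "0 < b * \<sigma> x" using b \<sigma>0 by simp
        ultimately show "norm (ln (inverse (w x))) \<le> norm (w x + b * \<sigma> x)"
          using w0[of x] ln_eq[of x] by simp
      qed
    qed
    have ln\<sigma>: "(\<lambda>x. ln (\<sigma> x)) absolutely_integrable_on cube c r"
      using set_integrable_mult_right[of "1 / b", OF lnw] b by (simp add: ln_eq)
    have "(LINT x:cube c r|lebesgue. ln (inverse (w x))) / measure lebesgue (cube c r)
        = b * ((LINT x:cube c r|lebesgue. ln (\<sigma> x)) / measure lebesgue (cube c r))"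
      by (simp add: ln_eq)
    also have "\<dots> \<le> b * ln m"
      using average_ln_le[OF cr(2) \<sigma>m \<sigma>0 m ln\<sigma>] b by (intro mult_left_mono) auto
    also have "\<dots> \<le> b * ln S"
      using AS(2,4) m cr b by (intro mult_left_mono) auto
    finally have "exp ((LINT x:cube c r|lebesgue. ln (inverse (w x))) / measure lebesgue (cube c r)) \<le> S powr b"
      using AS(4) by (simp add: powr_def)
    then have "average Q (\<lambda>x. ennreal (w x)) * ennreal (exp ((LINT x:Q|lebesgue. ln (inverse (w x))) / measure lebesgue Q))
        \<le> ennreal A * ennreal (S powr b)"
      using AS(1) unfolding cr by (intro mult_mono ennreal_leI) auto
    also have "\<dots> = ennreal (C1 * C2 powr b)" using AS by (simp add: ennreal_mult[symmetric])
    finally show "(if (\<lambda>x. ln (inverse (w x))) absolutely_integrable_on Q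
      then average Q (\<lambda>x. ennreal (w x)) * ennreal (exp ((LINT x:Q|lebesgue. ln (inverse (w x))) / measure lebesgue Q))
      else \<infinity>) \<le> ennreal (C1 * C2 powr b)"
      using lnw cr by simp
  qed
  then show "A_infty_const (\<lambda>x. w1 x * w2 x powr (- b)) \<le> ennreal (C1 * C2 powr b)"
    by (simp add: w_def[abs_def])
qed

text \<open>This is where \<open>\<phi>\<close> disappears: from here on only a number remains,
  common to all pairs of weights with the given \<open>A1\<close> constants.\<close>

lemma locally_bounded_A_infty_const:
  assumes "locally_bounded \<phi>" "0 < b"
  shows "\<exists>B>0. \<forall>w1 w2 :: 'a::euclidean_space \<Rightarrow> real. A1 C1 w1 \<longrightarrow> A1 C2 w2 \<longrightarrow>
    \<phi> (enn2real (A_infty_const (\<lambda>x. w1 x * w2 x powr (- b)))) \<le> B"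
proof -
  \<comment> \<open>No \<open>A1\<close> weight is fixed yet, so the sign of \<open>C1\<close> is
    unknown and the maximum keeps \<open>K\<close> positive. The added 1 places the bound strictly
    inside the open interval.\<close>
  define K where "K = max 0 (C1 * C2 powr b) + 1"
  have "0 < K" by (simp add: K_def)
  then have "bdd_above (\<phi> ` {0<..<K})" using assms(1) by (simp add: locally_bounded_def)
  then obtain B where "\<forall>t\<in>{0<..<K}. \<phi> t \<le> B" by (auto simp: bdd_above_def)
  then have B: "\<phi> t \<le> B" if "0 < t" "t < K" for t using that by simp
  show ?thesis
  proof (intro exI[of _ "max 1 B"] conjI allI impI)
    fix w1 w2 :: "'a \<Rightarrow> real" assume A: "A1 C1 w1" "A1 C2 w2"
    define w where "w = (\<lambda>x. w1 x * w2 x powr (- b))"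
    have "weight w" using A1_mult_powr_in_A_infty[OF A assms(2)] by (auto simp: A_infty_def Muckenhoupt_def w_def)
    then have pos: "0 < A_infty_const w" by (rule A_infty_const_pos)
    have le: "A_infty_const w \<le> ennreal (C1 * C2 powr b)" unfolding w_def by (rule A_infty_const_A1_mult_powr[OF A assms(2)])
    obtain k where k: "A_infty_const w = ennreal k" "0 < k"
      using pos le by (cases "A_infty_const w") (auto simp: top_unique)
    then have "k < K" using le by (auto simp: K_def ennreal_le_iff2)
    then have "\<phi> (enn2real (A_infty_const w)) \<le> B" using B k by simp
    then show "\<phi> (enn2real (A_infty_const (\<lambda>x. w1 x * w2 x powr (- b)))) \<le> max 1 B" by (simp add: w_def)
  qed simp
qed

subsection \<open>Distribution estimates for \<open>A\<^sub>1\<close> weights\<close>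

text \<open>Young's inequality after normalizing both integrals to 1. The exponents
  \<open>\<theta>\<close> and \<open>1 - \<theta>\<close> fit the later uses, where
  \<open>\<theta>\<close> is \<open>p0 / s\<close> or \<open>s / p\<close>. Zero and infinite
  integrals are separated first, since normalization divides by them.\<close>

lemma nn_integral_Hoelder:
  assumes [measurable]: "a \<in> borel_measurable M" "b \<in> borel_measurable M" and \<theta>: "0 < \<theta>" "\<theta> < 1"
  shows "(\<integral>\<^sup>+x. ennreal_powr (a x) \<theta> * ennreal_powr (b x) (1 - \<theta>) \<partial>M)
    \<le> ennreal_powr (\<integral>\<^sup>+x. a x \<partial>M) \<theta> * ennreal_powr (\<integral>\<^sup>+x. b x \<partial>M) (1 - \<theta>)"
proof -
  define A where "A = (\<integral>\<^sup>+x. a x \<partial>M)"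
  define B where "B = (\<integral>\<^sup>+x. b x \<partial>M)"
  consider "A = 0" | "B = 0" | "A \<noteq> 0" "B \<noteq> 0" "A = top \<or> B = top"
    | \<alpha> \<beta> where "A = ennreal \<alpha>" "0 < \<alpha>" "B = ennreal \<beta>" "0 < \<beta>"
    by (cases A; cases B) (auto simp: less_le)
  then have "(\<integral>\<^sup>+x. ennreal_powr (a x) \<theta> * ennreal_powr (b x) (1 - \<theta>) \<partial>M) \<le> ennreal_powr A \<theta> * ennreal_powr B (1 - \<theta>)"
  proof cases
    case 1
    then have "AE x in M. a x = 0" unfolding A_def by (subst (asm) nn_integral_0_iff_AE) auto
    then have "AE x in M. ennreal_powr (a x) \<theta> * ennreal_powr (b x) (1 - \<theta>) = 0" by eventually_elim simp
    then have "(\<integral>\<^sup>+x. ennreal_powr (a x) \<theta> * ennreal_powr (b x) (1 - \<theta>) \<partial>M) = 0"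
      by (subst nn_integral_0_iff_AE) auto
    then show ?thesis by simp
  next
    case 2
    then have "AE x in M. b x = 0" unfolding B_def by (subst (asm) nn_integral_0_iff_AE) auto
    then have "AE x in M. ennreal_powr (a x) \<theta> * ennreal_powr (b x) (1 - \<theta>) = 0" by eventually_elim simp
    then have "(\<integral>\<^sup>+x. ennreal_powr (a x) \<theta> * ennreal_powr (b x) (1 - \<theta>) \<partial>M) = 0"
      by (subst nn_integral_0_iff_AE) auto
    then show ?thesis by simp
  next
    case 3
    then have "ennreal_powr A \<theta> * ennreal_powr B (1 - \<theta>) = top"
      by (cases A; cases B) (auto simp: ennreal_mult_top ennreal_top_mult)
    then show ?thesis by simp
  next
    case (4 \<alpha> \<beta>)
    define c where "c = \<alpha> powr \<theta> * \<beta> powr (1 - \<theta>)"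
    have c: "0 < c" using 4 by (simp add: c_def)
    have Young: "ennreal_powr (a x) \<theta> * ennreal_powr (b x) (1 - \<theta>) \<le> ennreal (c * \<theta> / \<alpha>) * a x + ennreal (c * (1 - \<theta>) / \<beta>) * b x" for x
    proof (cases "a x")
      case (real s)
      show ?thesis
      proof (cases "b x")
        case (real t)
        have "s powr \<theta> * t powr (1 - \<theta>) \<le> c * \<theta> / \<alpha> * s + c * (1 - \<theta>) / \<beta> * t"
        proof (cases "s = 0 \<or> t = 0")
          case True
          then show ?thesis using \<open>0 \<le> s\<close> \<open>0 \<le> t\<close> c 4 \<theta> by (auto intro!: add_nonneg_nonneg mult_nonneg_nonneg divide_nonneg_nonneg)
        next
          case False
          then have st: "0 < s" "0 < t" using \<open>0 \<le> s\<close> \<open>0 \<le> t\<close> by auto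
          have "(s / \<alpha>) powr \<theta> * (t / \<beta>) powr (1 - \<theta>) \<le> \<theta> * (s / \<alpha>) + (1 - \<theta>) * (t / \<beta>)"
            using st 4 \<theta> by (intro Youngs_inequality_0) auto
          then have "c * ((s / \<alpha>) powr \<theta> * (t / \<beta>) powr (1 - \<theta>)) \<le> c * (\<theta> * (s / \<alpha>) + (1 - \<theta>) * (t / \<beta>))"
            using c by (intro mult_left_mono) auto
          moreover have "c * ((s / \<alpha>) powr \<theta> * (t / \<beta>) powr (1 - \<theta>)) = s powr \<theta> * t powr (1 - \<theta>)"
            using st 4 by (simp add: c_def powr_divide)
          ultimately show ?thesis by (simp add: distrib_left)
        qed
        then show ?thesis
          using \<open>a x = ennreal s\<close> real \<open>0 \<le> s\<close> c 4 \<theta>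
          by (simp add: ennreal_mult[symmetric] ennreal_plus[symmetric] ennreal_leI del: ennreal_plus)
      next
        case top
        then show ?thesis using c 4 \<theta> by (simp add: ennreal_mult_top)
      qed
    next
      case top
      then show ?thesis using c 4 \<theta> by (simp add: ennreal_mult_top)
    qed
    have "(\<integral>\<^sup>+x. ennreal_powr (a x) \<theta> * ennreal_powr (b x) (1 - \<theta>) \<partial>M)
        \<le> (\<integral>\<^sup>+x. ennreal (c * \<theta> / \<alpha>) * a x + ennreal (c * (1 - \<theta>) / \<beta>) * b x \<partial>M)"
      by (intro nn_integral_mono Young)
    also have "\<dots> = ennreal (c * \<theta> / \<alpha>) * A + ennreal (c * (1 - \<theta>) / \<beta>) * B"
      by (simp add: nn_integral_add nn_integral_cmult A_def B_def)
    also have "\<dots> = ennreal (c * \<theta> + c * (1 - \<theta>))"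
      using 4 c \<theta> by (simp add: ennreal_mult[symmetric] del: ennreal_plus add: ennreal_plus[symmetric])
    also have "c * \<theta> + c * (1 - \<theta>) = c" by (simp add: algebra_simps)
    also have "ennreal c = ennreal_powr A \<theta> * ennreal_powr B (1 - \<theta>)"
      using 4 by (simp add: c_def ennreal_mult)
    finally show ?thesis .
  qed
  then show ?thesis by (simp add: A_def B_def)
qed

text \<open>Division by \<open>m\<close> to the power \<open>1 - \<theta>\<close>, legitimate since
  \<open>m\<close> is neither 0 nor infinite. Each application takes for \<open>m\<close> the
  weighted measure of a bounded set.\<close>

lemma ennreal_absorb_power:
  assumes m: "m \<noteq> 0" "m \<noteq> top" and le: "x * m \<le> z * ennreal_powr m (1 - \<theta>)"
  shows "x * ennreal_powr m \<theta> \<le> z"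
proof -
  define c where "c = ennreal_powr m (1 - \<theta>)"
  have c: "c \<noteq> 0" "c \<noteq> top" using m by (cases m; auto simp: c_def)+
  have "m = ennreal_powr m \<theta> * c" unfolding c_def ennreal_powr_add by simp
  then have "c * (x * ennreal_powr m \<theta>) \<le> c * z"
    using le by (metis c_def mult.assoc mult.commute)
  then show ?thesis using c by (simp add: ennreal_mult_le_mult_iff)
qed

lemma less_set_lebesgue: "g \<in> borel_measurable lebesgue \<Longrightarrow> {x. (y::real) < g x} \<in> sets lebesgue"
  using borel_measurable_less[of "\<lambda>_. y" lebesgue g] by simp

lemma Lp_norm_eq:
  assumes "w \<in> borel_measurable lebesgue" "F \<in> borel_measurable lebesgue"
  shows "Lp_norm p w F = ennreal_powr (\<integral>\<^sup>+x. ennreal (w x) * ennreal_powr (F x) p \<partial>lebesgue) (1 / p)"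
  unfolding Lp_norm_def using assms by (subst nn_integral_weighted) auto

lemma weak_Lp_norm_bound:
  assumes w[measurable]: "w \<in> borel_measurable lebesgue" "\<And>x. 0 \<le> w x" and f[measurable]: "f \<in> borel_measurable lebesgue" "\<And>x. 0 \<le> f x"
    and p: "0 < p" and y: "0 < y" and B: "b \<le> B" "0 \<le> B"
    and le: "weak_Lp_norm p w G \<le> ennreal b * Lp_norm p w (\<lambda>x. ennreal (f x))"
  shows "ennreal (y powr p) * emeasure (weighted w) {x. ennreal y < G x} \<le> ennreal (B powr p) * (\<integral>\<^sup>+x. ennreal (f x powr p * w x) \<partial>lebesgue)"
proof -
  have I: "(\<integral>\<^sup>+x. ennreal (w x) * ennreal_powr (ennreal (f x)) p \<partial>lebesgue) = (\<integral>\<^sup>+x. ennreal (f x powr p * w x) \<partial>lebesgue)"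
    using w f by (intro nn_integral_cong) (simp add: ennreal_mult[symmetric] mult.commute)
  have "ennreal y * ennreal_powr (emeasure (weighted w) {x. ennreal y < G x}) (1 / p) \<le> weak_Lp_norm p w G"
    unfolding weak_Lp_norm_def using y by (intro SUP_upper) auto
  also note le
  also have "ennreal b * Lp_norm p w (\<lambda>x. ennreal (f x)) \<le> ennreal B * Lp_norm p w (\<lambda>x. ennreal (f x))"
    using B by (intro mult_right_mono ennreal_leI) auto
  finally have "ennreal y * ennreal_powr (emeasure (weighted w) {x. ennreal y < G x}) (1 / p)
      \<le> ennreal B * ennreal_powr (\<integral>\<^sup>+x. ennreal (f x powr p * w x) \<partial>lebesgue) (1 / p)"
    by (simp add: Lp_norm_eq I)
  then have "ennreal_powr (ennreal y * ennreal_powr (emeasure (weighted w) {x. ennreal y < G x}) (1 / p)) p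
      \<le> ennreal_powr (ennreal B * ennreal_powr (\<integral>\<^sup>+x. ennreal (f x powr p * w x) \<partial>lebesgue) (1 / p)) p"
    using p by (intro ennreal_powr_mono) auto
  then show ?thesis using p y B by (simp add: ennreal_powr_mult ennreal_powr_powr)
qed

text \<open>Lebesgue differentiation requires \<open>f\<close> to be locally integrable, which is
  read off from the finiteness of \<open>maximal f\<close> at one point of each cube.\<close>

lemma AE_le_maximal:
  fixes f :: "'a::euclidean_space \<Rightarrow> real"
  assumes f[measurable]: "f \<in> borel_measurable lebesgue" and f0: "\<And>x. 0 \<le> f x"
    and fin: "AE x in lebesgue. maximal f x < \<infinity>"
  shows "AE x in lebesgue. ennreal (f x) \<le> maximal f x"
proof -
  interpret cube_doubling "weighted (\<lambda>_::'a. 1)" "1 * 3 ^ DIM('a)" by (rule A1_cube_doubling[OF A1_one])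
  have e: "maximal f = cube_maximal lebesgue (\<lambda>y. ennreal (f y))"
    using f0 by (simp add: maximal_eq_cube_maximal)
  have "AE x in lebesgue. ennreal (f x) \<le> cube_maximal (weighted (\<lambda>_. 1)) (\<lambda>y. ennreal (f y)) x"
  proof (rule AE_le_cube_maximal[OF weight_one f f0])
    fix c :: 'a and r :: real assume r: "0 < r"
    obtain x where x: "x \<in> cube c r" "maximal f x < \<infinity>" using AE_ex_in_cube[OF fin r] by blast
    have "(\<integral>\<^sup>+y\<in>cube c r. ennreal (1 * f y) \<partial>lebesgue) \<le> maximal f x * emeasure lebesgue (cube c r)"
      using average_le_cube_maximal[OF r x(1), of "\<lambda>y. ennreal (f y)"] by (simp add: e)
    also have "\<dots> < \<infinity>" using x(2) emeasure_cube_pos_finite[OF r, of c] by (simp add: ennreal_mult_less_top)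
    finally show "(\<integral>\<^sup>+y\<in>cube c r. ennreal (1 * f y) \<partial>lebesgue) < \<infinity>" .
  qed
  then show ?thesis by (simp add: e)
qed

lemma borel_measurable_maximal [measurable]: "maximal (f :: 'a::euclidean_space \<Rightarrow> real) \<in> borel_measurable lebesgue"
  unfolding maximal_eq_cube_maximal by (rule cube_doubling.borel_measurable_cube_maximal[OF cube_doubling_lebesgue])

text \<open>With \<open>G = v powr (1 / \<mu>)\<close> the weight is
  \<open>maximal_powr \<mu> v\<close> up to a null set, and the second claim says that it dominates
  \<open>v\<close> almost everywhere. The constant does not depend on \<open>G\<close>, which
  matters when \<open>G\<close> involves the set \<open>E\<close>.\<close>

lemma A1_maximal_powr:
  fixes G :: "'a::euclidean_space \<Rightarrow> real"
  assumes G: "G \<in> borel_measurable lebesgue" "\<And>x. 0 \<le> G x" "\<not> (AE x in lebesgue. G x = 0)"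
    and fin: "AE x in lebesgue. maximal G x < \<infinity>" and \<mu>: "0 < \<mu>" "\<mu> < 1"
  shows "A1 (rochberg_const (3 ^ DIM('a)) \<mu>) (\<lambda>x. finite_real (maximal G x) powr \<mu>)"
    and "AE x in lebesgue. G x powr \<mu> \<le> finite_real (maximal G x) powr \<mu>"
proof -
  have e: "maximal G = cube_maximal lebesgue (\<lambda>y. ennreal (G y))"
    using G by (simp add: maximal_eq_cube_maximal)
  have nz: "\<not> (AE x in lebesgue. ennreal (G x) = 0)"
    using G(2,3) by (simp add: ennreal_eq_0_iff) (metis (mono_tags, lifting) AE_cong antisym)
  have m: "(\<lambda>x. ennreal (G x)) \<in> borel_measurable lebesgue" using G(1) by measurable
  show "A1 (rochberg_const (3 ^ DIM('a)) \<mu>) (\<lambda>x. finite_real (maximal G x) powr \<mu>)"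
    using A1_mult_cube_maximal_powr[OF A1_one m _ _ \<mu>] fin
      cube_doubling.cube_maximal_pos[OF cube_doubling_lebesgue m nz]
    by (simp add: e)
  show "AE x in lebesgue. G x powr \<mu> \<le> finite_real (maximal G x) powr \<mu>"
    using AE_le_maximal[OF G(1,2) fin] fin
  proof eventually_elim
    case (elim x)
    then have "ennreal (G x) \<le> ennreal (finite_real (maximal G x))" by (simp add: ennreal_finite_real)
    then have "G x \<le> finite_real (maximal G x)"
      using G(2)[of x] by (cases "maximal G x") (auto simp: finite_real_def ennreal_le_iff2 split: if_splits)
    then show ?case using G(2) \<mu> by (intro powr_mono2) auto
  qed
qed

section \<open>From the hypothesis on \<open>A_infty\<close> weights to distribution
  estimates\<close>

text \<open>All assumptions on the pair are bundled so that constants can be obtained before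
  \<open>f\<close> and \<open>g\<close> are quantified.\<close>

definition weak_A_infty_bound :: "real \<Rightarrow> (real \<Rightarrow> real) \<Rightarrow> ('a::euclidean_space \<Rightarrow> real) \<Rightarrow> ('a \<Rightarrow> real) \<Rightarrow> bool" where
  "weak_A_infty_bound p0 \<phi> f g \<longleftrightarrow> f \<in> borel_measurable lebesgue \<and> (\<forall>x. 0 \<le> f x) \<and>
     g \<in> borel_measurable lebesgue \<and> (\<forall>x. 0 \<le> g x) \<and>
     (\<forall>w\<in>A_infty. weak_Lp_norm p0 w (\<lambda>x. ennreal (g x))
        \<le> ennreal (\<phi> (enn2real (A_infty_const w))) * Lp_norm p0 w (\<lambda>x. ennreal (f x)))"

lemma weak_A_infty_bound_A1:
  assumes \<phi>: "locally_bounded \<phi>" and p0: "0 < p0" and b: "0 < b"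
  obtains B where "0 < B" "\<And>f g (w1 :: 'a::euclidean_space \<Rightarrow> real) w2 y. \<lbrakk>weak_A_infty_bound p0 \<phi> f g; A1 C1 w1; A1 C2 w2; 0 < y\<rbrakk> \<Longrightarrow>
    ennreal (y powr p0) * emeasure (weighted (\<lambda>x. w1 x * w2 x powr (- b))) {x. y < g x}
      \<le> ennreal B * (\<integral>\<^sup>+x. ennreal (f x powr p0 * (w1 x * w2 x powr (- b))) \<partial>lebesgue)"
proof -
  obtain B where B: "0 < B" "\<And>w1 w2 :: 'a \<Rightarrow> real. A1 C1 w1 \<Longrightarrow> A1 C2 w2 \<Longrightarrow>
    \<phi> (enn2real (A_infty_const (\<lambda>x. w1 x * w2 x powr (- b)))) \<le> B"
    using locally_bounded_A_infty_const[OF \<phi> b, of C1 C2, where ?'a = 'a] by blast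
  show ?thesis
  proof (rule that[of "B powr p0"])
    show "0 < B powr p0" using B by simp
    fix f g w1 w2 :: "'a \<Rightarrow> real" and y :: real
    assume H: "weak_A_infty_bound p0 \<phi> f g" and A: "A1 C1 w1" "A1 C2 w2" and y: "0 < y"
    define w where "w = (\<lambda>x. w1 x * w2 x powr (- b))"
    have wA: "w \<in> A_infty" unfolding w_def by (rule A1_mult_powr_in_A_infty[OF A b])
    then have ww: "weight w" by (auto simp: A_infty_def Muckenhoupt_def)
    have "ennreal (y powr p0) * emeasure (weighted w) {x. ennreal y < ennreal (g x)} \<le> ennreal (B powr p0) * (\<integral>\<^sup>+x. ennreal (f x powr p0 * w x) \<partial>lebesgue)"
    proof (rule weak_Lp_norm_bound[OF weight_measurable[OF ww] weight_nonneg[OF ww] _ _ p0 y])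
      show "\<phi> (enn2real (A_infty_const w)) \<le> B" unfolding w_def by (rule B(2)[OF A])
    qed (use H wA B in \<open>auto simp: weak_A_infty_bound_def\<close>)
    moreover have "{x. ennreal y < ennreal (g x)} = {x. y < g x}" using y by (simp add: ennreal_less_iff)
    ultimately show "ennreal (y powr p0) * emeasure (weighted (\<lambda>x. w1 x * w2 x powr (- b))) {x. y < g x}
      \<le> ennreal (B powr p0) * (\<integral>\<^sup>+x. ennreal (f x powr p0 * (w1 x * w2 x powr (- b))) \<partial>lebesgue)"
      by (simp add: w_def)
  qed
qed

text \<open>For \<open>s < p0\<close> the weight \<open>W (max y Mf) powr (s - p0)\<close> turns \<open>f powr p0\<close> into \<open>f powr s\<close>.\<close>

lemma A1_distribution_bound_less:
  assumes \<phi>: "locally_bounded \<phi>" and s: "0 < s" "s < p0"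
  obtains K where "0 < K" "\<And>f g (W :: 'a::euclidean_space \<Rightarrow> real) y E. \<lbrakk>weak_A_infty_bound p0 \<phi> f g; A1 C W; 0 < y;
      E \<in> sets lebesgue; E \<subseteq> {x. y < g x \<and> maximal f x \<le> ennreal y}; AE x in lebesgue. maximal f x < \<infinity>\<rbrakk> \<Longrightarrow>
    ennreal (y powr s) * emeasure (weighted W) E \<le> ennreal K * (\<integral>\<^sup>+x. ennreal (f x powr s * W x) \<partial>lebesgue)"
proof -
  \<comment> \<open>Coifman--Rochberg needs an exponent below 1, so the second weight is the square
    root of \<open>max y Mf\<close>, and the factor 2 restores the desired power
    \<open>s - p0\<close>.\<close>
  define b where "b = 2 * (p0 - s)"
  have b: "0 < b" and p0: "0 < p0" using s by (auto simp: b_def)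
  obtain B where B: "0 < B" "\<And>f g (w1 :: 'a \<Rightarrow> real) w2 y. \<lbrakk>weak_A_infty_bound p0 \<phi> f g; A1 C w1; A1 (1 + rochberg_const (3 ^ DIM('a)) (1/2)) w2; 0 < y\<rbrakk> \<Longrightarrow>
    ennreal (y powr p0) * emeasure (weighted (\<lambda>x. w1 x * w2 x powr (- b))) {x. y < g x}
      \<le> ennreal B * (\<integral>\<^sup>+x. ennreal (f x powr p0 * (w1 x * w2 x powr (- b))) \<partial>lebesgue)"
    using weak_A_infty_bound_A1[OF \<phi> p0 b, of C "1 + rochberg_const (3 ^ DIM('a)) (1/2)", where ?'a = 'a] by blast
  show ?thesis
  proof (rule that[OF B(1)])
    fix f g W :: "'a \<Rightarrow> real" and y :: real and E :: "'a set"
    assume H: "weak_A_infty_bound p0 \<phi> f g" and A: "A1 C W" and y: "0 < y"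
      and E[measurable]: "E \<in> sets lebesgue" and Es: "E \<subseteq> {x. y < g x \<and> maximal f x \<le> ennreal y}"
      and fin: "AE x in lebesgue. maximal f x < \<infinity>"
    have f[measurable]: "f \<in> borel_measurable lebesgue" and f0: "\<And>x. 0 \<le> f x"
      and g[measurable]: "g \<in> borel_measurable lebesgue"
      using H by (auto simp: weak_A_infty_bound_def)
    note WW = A1_weight[OF A]
    note [measurable] = weight_measurable[OF WW]
    have e: "maximal f = cube_maximal lebesgue (\<lambda>y. ennreal (f y))"
      using f0 by (simp add: maximal_eq_cube_maximal)
    define m where "m x = max y (enn2real (maximal f x))" for x
    have m0: "0 < m x" for x using y by (simp add: m_def)
    have mm[measurable]: "m \<in> borel_measurable lebesgue" unfolding m_def by measurable
    define w2 where "w2 x = m x powr (1/2)" for x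
    have A2: "A1 (1 + rochberg_const (3 ^ DIM('a)) (1/2)) w2"
      unfolding w2_def m_def e using fin y
      by (intro A1_max_cube_maximal_powr) (auto simp: e)
    define w where "w x = W x * m x powr (s - p0)" for x
    have w_eq: "(\<lambda>x. W x * w2 x powr (- b)) = w"
    proof
      have "1 / 2 * (- b) = s - p0" by (simp add: b_def field_simps)
      then show "W x * w2 x powr (- b) = w x" for x by (simp only: w_def w2_def powr_powr)
    qed
    have wm[measurable]: "w \<in> borel_measurable lebesgue" unfolding w_def by measurable
    have wE: "w x = y powr (s - p0) * W x" if "x \<in> E" for x
    proof -
      have "maximal f x \<le> ennreal y" using that Es by auto
      then have "enn2real (maximal f x) \<le> y" using y by (simp add: enn2real_leI)
      then show ?thesis by (simp add: w_def m_def max_def)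
    qed
    have "emeasure (weighted w) E = (\<integral>\<^sup>+x. ennreal (y powr (s - p0)) * (ennreal (W x) * indicator E x) \<partial>lebesgue)"
      by (subst emeasure_weighted) (auto intro!: nn_integral_cong simp: indicator_def wE ennreal_mult weight_nonneg[OF WW])
    then have "emeasure (weighted w) E = ennreal (y powr (s - p0)) * emeasure (weighted W) E"
      by (simp add: nn_integral_cmult emeasure_weighted)
    then have "ennreal (y powr s) * emeasure (weighted W) E = ennreal (y powr p0) * emeasure (weighted w) E"
      by (simp add: mult.assoc[symmetric] ennreal_mult[symmetric] flip: powr_add)
    also have "\<dots> \<le> ennreal (y powr p0) * emeasure (weighted w) {x. y < g x}"
      using Es less_set_lebesgue[OF g, of y] by (intro mult_left_mono emeasure_mono) auto
    also have "\<dots> \<le> ennreal B * (\<integral>\<^sup>+x. ennreal (f x powr p0 * w x) \<partial>lebesgue)"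
      using B(2)[OF H A A2 y] unfolding w_eq by (simp add: w_eq[unfolded fun_eq_iff, rule_format])
    also have "\<dots> \<le> ennreal B * (\<integral>\<^sup>+x. ennreal (f x powr s * W x) \<partial>lebesgue)"
    proof (intro mult_left_mono nn_integral_mono_AE)
      show "AE x in lebesgue. ennreal (f x powr p0 * w x) \<le> ennreal (f x powr s * W x)"
        using AE_le_maximal[OF f f0 fin] fin
      proof eventually_elim
        case (elim x)
        have fm: "f x \<le> m x"
          using elim f0[of x] by (cases "maximal f x") (auto simp: m_def)
        \<comment> \<open>Here \<open>f x \<le> m x\<close> is raised to the negative power
          \<open>s - p0\<close>, which reverses the inequality.\<close>
        have "f x powr p0 * m x powr (s - p0) \<le> f x powr s"
        proof (cases "f x = 0")
          case False
          then have "m x powr (s - p0) \<le> f x powr (s - p0)"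
            using fm f0[of x] s by (intro powr_mono2') auto
          then have "f x powr p0 * m x powr (s - p0) \<le> f x powr p0 * f x powr (s - p0)"
            by (intro mult_left_mono) auto
          then show ?thesis by (simp flip: powr_add)
        qed simp
        then have "f x powr p0 * m x powr (s - p0) * W x \<le> f x powr s * W x"
          by (intro mult_right_mono weight_nonneg[OF WW])
        then show ?case by (intro ennreal_leI) (simp add: w_def mult_ac)
      qed
    qed simp
    finally show "ennreal (y powr s) * emeasure (weighted W) E \<le> ennreal B * (\<integral>\<^sup>+x. ennreal (f x powr s * W x) \<partial>lebesgue)" .
  qed
qed

text \<open>An \<open>A1\<close> weight is itself a test weight, with constant second factor.
  Besides settling \<open>s = p0\<close>, this is applied below to the \<open>A1\<close> weight
  \<open>W * H\<close>.\<close>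

lemma A1_distribution_bound_eq:
  assumes \<phi>: "locally_bounded \<phi>" and p0: "0 < p0"
  obtains K where "0 < K" "\<And>f g (W :: 'a::euclidean_space \<Rightarrow> real) y E. \<lbrakk>weak_A_infty_bound p0 \<phi> f g; A1 C W; 0 < y;
      E \<in> sets lebesgue; E \<subseteq> {x. y < g x}\<rbrakk> \<Longrightarrow>
    ennreal (y powr p0) * emeasure (weighted W) E \<le> ennreal K * (\<integral>\<^sup>+x. ennreal (f x powr p0 * W x) \<partial>lebesgue)"
proof -
  obtain B where B: "0 < B" "\<And>f g (w1 :: 'a \<Rightarrow> real) w2 y. \<lbrakk>weak_A_infty_bound p0 \<phi> f g; A1 C w1; A1 1 w2; 0 < y\<rbrakk> \<Longrightarrow>
    ennreal (y powr p0) * emeasure (weighted (\<lambda>x. w1 x * w2 x powr (- 1))) {x. y < g x}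
      \<le> ennreal B * (\<integral>\<^sup>+x. ennreal (f x powr p0 * (w1 x * w2 x powr (- 1))) \<partial>lebesgue)"
    using weak_A_infty_bound_A1[OF \<phi> p0 zero_less_one, of C 1, where ?'a = 'a] by blast
  show ?thesis
  proof (rule that[OF B(1)])
    fix f g W :: "'a \<Rightarrow> real" and y :: real and E :: "'a set"
    assume H: "weak_A_infty_bound p0 \<phi> f g" and A: "A1 C W" and y: "0 < y"
      and E: "E \<in> sets lebesgue" "E \<subseteq> {x. y < g x}"
    have g[measurable]: "g \<in> borel_measurable lebesgue" using H by (auto simp: weak_A_infty_bound_def)
    have "emeasure (weighted W) E \<le> emeasure (weighted W) {x. y < g x}"
      using E less_set_lebesgue[OF g, of y] by (intro emeasure_mono) auto
    then have "ennreal (y powr p0) * emeasure (weighted W) E \<le> ennreal (y powr p0) * emeasure (weighted W) {x. y < g x}"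
      by (intro mult_left_mono) auto
    also have "\<dots> \<le> ennreal B * (\<integral>\<^sup>+x. ennreal (f x powr p0 * W x) \<partial>lebesgue)"
      using B(2)[OF H A A1_one y] by simp
    finally show "ennreal (y powr p0) * emeasure (weighted W) E \<le> ennreal B * (\<integral>\<^sup>+x. ennreal (f x powr p0 * W x) \<partial>lebesgue)" .
  qed
qed

text \<open>
  For \<open>s > p0\<close> one dualizes with \<open>H = (M\<^sub>W 1\<^sub>E) powr d\<close>, the maximal function with respect
  to the measure \<open>W\<close>: \<open>H W\<close> is an \<open>A\<^sub>1\<close> weight, and already the weak type inequality bounds
  the norm of \<open>H\<close>, because \<open>1\<^sub>E\<close> is a characteristic function.
\<close>

lemma A1_distribution_bound_greater:
  assumes \<phi>: "locally_bounded \<phi>" and p0: "0 < p0" "p0 < s"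
  obtains K where "0 < K" "\<And>f g (W :: 'a::euclidean_space \<Rightarrow> real) y E. \<lbrakk>weak_A_infty_bound p0 \<phi> f g; A1 C W; 0 < y;
      E \<in> sets lebesgue; bounded E; E \<subseteq> {x. y < g x}\<rbrakk> \<Longrightarrow>
    ennreal (y powr s) * emeasure (weighted W) E \<le> ennreal K * (\<integral>\<^sup>+x. ennreal (f x powr s * W x) \<partial>lebesgue)"
proof -
  \<comment> \<open>\<open>1 / \<theta>\<close> is the Hoelder exponent that turns
    \<open>f powr p0\<close> into \<open>f powr s\<close>. The exponent \<open>d\<close> has to lie
    strictly between \<open>1 - \<theta>\<close> and 1: below 1 for Coifman--Rochberg, above
    \<open>1 - \<theta>\<close> so that the dual norm of \<open>H\<close> integrates a power
    \<open>a > 1\<close> of the maximal function. The midpoint is taken.\<close>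
  define \<theta> where "\<theta> = p0 / s"
  have \<theta>: "0 < \<theta>" "\<theta> < 1" using p0 by (auto simp: \<theta>_def)
  define d where "d = 1 - \<theta> / 2"
  have d: "0 < d" "d < 1" using \<theta> by (auto simp: d_def)
  define a where "a = d / (1 - \<theta>)"
  have a: "1 < a" using \<theta> by (simp add: a_def d_def)
  define D where "D = C * 3 ^ DIM('a)"
  \<comment> \<open>\<open>max 1 D\<close> keeps \<open>L\<close> positive before a weight with
    constant \<open>C\<close> is given; once there is one, \<open>D\<close> is at least 1.\<close>
  define L where "L = (2 / (1 - 2 powr (1 - a))) * max 1 D"
  have L: "0 < L" using a by (auto simp: L_def powr_less_one intro!: mult_pos_pos divide_pos_pos)
  obtain B where B: "0 < B" "\<And>f g (w1 :: 'a \<Rightarrow> real) y E. \<lbrakk>weak_A_infty_bound p0 \<phi> f g; A1 (rochberg_const D d * C) w1; 0 < y; E \<in> sets lebesgue; E \<subseteq> {x. y < g x}\<rbrakk> \<Longrightarrow>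
    ennreal (y powr p0) * emeasure (weighted w1) E \<le> ennreal B * (\<integral>\<^sup>+x. ennreal (f x powr p0 * w1 x) \<partial>lebesgue)"
    by (rule A1_distribution_bound_eq[OF \<phi> p0(1), of "rochberg_const D d * C", where ?'a = 'a]) blast
  show ?thesis
  proof (rule that[of "(B * L powr (1 - \<theta>)) powr (s / p0)"])
    show "0 < (B * L powr (1 - \<theta>)) powr (s / p0)" using B(1) L by simp
    fix f g W :: "'a \<Rightarrow> real" and y :: real and E :: "'a set"
    assume H: "weak_A_infty_bound p0 \<phi> f g" and A: "A1 C W" and y: "0 < y"
      and E[measurable]: "E \<in> sets lebesgue" and bE: "bounded E" and Es: "E \<subseteq> {x. y < g x}"
    have f[measurable]: "f \<in> borel_measurable lebesgue" and f0: "\<And>x. 0 \<le> f x"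
      using H by (auto simp: weak_A_infty_bound_def)
    note WW = A1_weight[OF A]
    note [measurable] = weight_measurable[OF WW]
    interpret cube_doubling "weighted W" D unfolding D_def by (rule A1_cube_doubling[OF A])
    define m where "m = emeasure (weighted W) E"
    define I where "I = (\<integral>\<^sup>+x. ennreal (f x powr s * W x) \<partial>lebesgue)"
    show "ennreal (y powr s) * emeasure (weighted W) E \<le> ennreal ((B * L powr (1 - \<theta>)) powr (s / p0)) * (\<integral>\<^sup>+x. ennreal (f x powr s * W x) \<partial>lebesgue)"
    proof (cases "m = 0")
      case True
      then show ?thesis by (simp add: m_def)
    next
      case False
      have mfin: "m \<noteq> top"
      proof -
        obtain r where "E \<subseteq> cube 0 r" using ex_cube_subset[OF bE] by blast
        then have "m \<le> emeasure (weighted W) (cube 0 r)" unfolding m_def by (intro emeasure_mono) auto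
        then show ?thesis using emeasure_weighted_cube_finite[OF WW, of 0 r] by (auto simp: top_unique)
      qed
      define F where "F x = ennreal (indicator E x)" for x
      have F[measurable]: "F \<in> borel_measurable lebesgue" unfolding F_def by measurable
      define M where "M = cube_maximal (weighted W) F"
      have Mm[measurable]: "M \<in> borel_measurable lebesgue" unfolding M_def by (rule borel_measurable_cube_maximal)
      have IF: "(\<integral>\<^sup>+x. F x \<partial>weighted W) = m"
        unfolding F_def m_def by (simp add: ennreal_indicator)
      have M1: "M x \<le> 1" for x
        unfolding M_def cube_maximal_def
      proof (rule SUP_least, clarify)
        fix Q :: "'a set" assume "Q \<in> cubes"
        then obtain c r where cr: "Q = cube c r" "0 < r" by (metis cubesE)
        have "(\<integral>\<^sup>+y\<in>Q. F y \<partial>weighted W) \<le> (\<integral>\<^sup>+y. indicator Q y \<partial>weighted W)"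
          by (intro nn_integral_mono) (auto simp: F_def indicator_def)
        then have "(\<integral>\<^sup>+y\<in>Q. F y \<partial>weighted W) \<le> 1 * emeasure (weighted W) Q"
          using cr by simp
        then show "(\<integral>\<^sup>+y\<in>Q. F y \<partial>weighted W) / emeasure (weighted W) Q \<le> 1"
          using cr emeasure_cube_pos[OF cr(2), of c] emeasure_cube_finite[OF cr(2), of c]
          by (subst ennreal_divide_le_iff) auto
      qed
      then have Mfin: "M x < \<infinity>" for x using le_less_trans[of "M x" 1] by auto
      have Mpos: "0 < M x" for x
        unfolding M_def
      proof (rule cube_maximal_pos[OF F])
        show "\<not> (AE x in weighted W. F x = 0)"
        proof
          assume "AE x in weighted W. F x = 0"
          then have "(\<integral>\<^sup>+x. F x \<partial>weighted W) = 0" by (subst nn_integral_0_iff_AE) auto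
          then show False using IF False by simp
        qed
      qed
      define H where "H x = finite_real (M x) powr d" for x
      have Hm[measurable]: "H \<in> borel_measurable lebesgue" unfolding H_def by measurable
      have H0: "0 < H x" for x unfolding H_def using finite_real_pos[OF Mpos[of x]] by simp
      have AH: "A1 (rochberg_const D d * C) (\<lambda>x. W x * H x)"
        unfolding H_def M_def D_def using Mfin Mpos d by (intro A1_mult_cube_maximal_powr[OF A F]) (auto simp: M_def)
      \<comment> \<open>The maximal function of the indicator of \<open>E\<close> is at least 1
        almost everywhere on \<open>E\<close>, so passing from \<open>W\<close> to
        \<open>W * H\<close> does not decrease the mass of \<open>E\<close>.\<close>
      have le: "AE x in lebesgue. x \<in> E \<longrightarrow> 1 \<le> H x"
      proof -
        have "AE x in lebesgue. ennreal (indicator E x) \<le> M x"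
          unfolding M_def F_def
        proof (rule AE_le_cube_maximal[OF WW])
          fix c :: 'a and r :: real
          have "(\<integral>\<^sup>+x\<in>cube c r. ennreal (W x * indicator E x) \<partial>lebesgue) \<le> (\<integral>\<^sup>+x\<in>cube c r. ennreal (W x) \<partial>lebesgue)"
            using weight_nonneg[OF WW] by (intro nn_integral_mono) (auto simp: indicator_def)
          also have "\<dots> < \<infinity>" by (rule weight_cube_finite[OF WW])
          finally show "(\<integral>\<^sup>+x\<in>cube c r. ennreal (W x * indicator E x) \<partial>lebesgue) < \<infinity>" .
        qed auto
        then show ?thesis
        proof (eventually_elim, intro impI)
          fix x assume *: "ennreal (indicator E x) \<le> M x" "x \<in> E"
          then have "ennreal 1 \<le> ennreal (finite_real (M x))" using Mfin by (simp add: ennreal_finite_real)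
          then have "1 \<le> finite_real (M x)" by (simp add: ennreal_le_iff2)
          then show "1 \<le> H x" unfolding H_def using d by (simp add: ge_one_powr_ge_zero)
        qed
      qed
      have mH: "m \<le> emeasure (weighted (\<lambda>x. W x * H x)) E"
      proof -
        have "m = (\<integral>\<^sup>+x\<in>E. ennreal (W x) \<partial>lebesgue)" by (simp add: m_def emeasure_weighted)
        also have "\<dots> \<le> (\<integral>\<^sup>+x\<in>E. ennreal (W x * H x) \<partial>lebesgue)"
        proof (rule nn_integral_mono_AE)
          show "AE x in lebesgue. ennreal (W x) * indicator E x \<le> ennreal (W x * H x) * indicator E x"
            using le by eventually_elim (use weight_pos[OF WW] in \<open>auto simp: indicator_def intro!: ennreal_leI\<close>)
        qed
        also have "\<dots> = emeasure (weighted (\<lambda>x. W x * H x)) E"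
          by (subst emeasure_weighted) auto
        finally show ?thesis .
      qed
      have HL: "(\<integral>\<^sup>+x. ennreal (H x powr (1 / (1 - \<theta>)) * W x) \<partial>lebesgue) \<le> ennreal L * m"
      proof -
        have "(\<integral>\<^sup>+x. ennreal (H x powr (1 / (1 - \<theta>)) * W x) \<partial>lebesgue) = (\<integral>\<^sup>+x. ennreal_powr (M x) a \<partial>weighted W)"
        proof (subst nn_integral_weighted)
          show "(\<integral>\<^sup>+x. ennreal (H x powr (1 / (1 - \<theta>)) * W x) \<partial>lebesgue) = (\<integral>\<^sup>+x. ennreal (W x) * ennreal_powr (M x) a \<partial>lebesgue)"
          proof (intro nn_integral_cong)
            fix x
            have "ennreal_powr (M x) a = ennreal (finite_real (M x) powr a)"
              using Mfin[of x] by (cases "M x") (auto simp: finite_real_def)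
            then show "ennreal (H x powr (1 / (1 - \<theta>)) * W x) = ennreal (W x) * ennreal_powr (M x) a"
              using weight_nonneg[OF WW, of x] by (simp add: H_def powr_powr a_def ennreal_mult[symmetric] mult.commute)
          qed
        qed auto
        also have "\<dots> \<le> ennreal (2 / (1 - 2 powr (1 - a))) * (ennreal D * m)"
        proof (rule nn_integral_powr_le_weak_type_large[OF _ a])
          show "emeasure (weighted W) {x \<in> space (weighted W). ennreal t < M x} \<le> ennreal (1 / t) * (ennreal D * m)" if "0 < t" for t
            using weak_type_cube_maximal[OF F that] D_ge_1 that unfolding IF M_def
            by (simp add: mult.assoc[symmetric] ennreal_mult[symmetric])
        qed (use M1 in auto)
        also have "\<dots> = ennreal L * m"
        proof -
          have "ennreal L = ennreal (2 / (1 - 2 powr (1 - a))) * ennreal D"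
            using D_ge_1 a by (subst ennreal_mult[symmetric]) (auto simp: L_def powr_less_one less_imp_le)
          then show ?thesis by (simp add: mult.assoc)
        qed
        finally show ?thesis .
      qed
      have "(\<integral>\<^sup>+x. ennreal (f x powr p0 * (W x * H x)) \<partial>lebesgue)
          = (\<integral>\<^sup>+x. ennreal_powr (ennreal (f x powr s * W x)) \<theta> * ennreal_powr (ennreal (H x powr (1 / (1 - \<theta>)) * W x)) (1 - \<theta>) \<partial>lebesgue)"
      proof (intro nn_integral_cong)
        fix x
        have "W x powr \<theta> * W x powr (1 - \<theta>) = W x"
          using weight_pos[OF WW, of x] by (simp flip: powr_add)
        then have "f x powr p0 * (W x * H x) = (f x powr s * W x) powr \<theta> * (H x powr (1 / (1 - \<theta>)) * W x) powr (1 - \<theta>)"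
          using \<theta> p0 f0[of x] H0[of x] weight_pos[OF WW, of x] by (simp add: powr_mult powr_powr \<theta>_def mult_ac)
        then show "ennreal (f x powr p0 * (W x * H x)) = ennreal_powr (ennreal (f x powr s * W x)) \<theta> * ennreal_powr (ennreal (H x powr (1 / (1 - \<theta>)) * W x)) (1 - \<theta>)"
          using weight_nonneg[OF WW, of x] H0[of x] by (simp add: ennreal_mult[symmetric])
      qed
      also have "\<dots> \<le> ennreal_powr I \<theta> * ennreal_powr (\<integral>\<^sup>+x. ennreal (H x powr (1 / (1 - \<theta>)) * W x) \<partial>lebesgue) (1 - \<theta>)"
        unfolding I_def using \<theta> by (intro nn_integral_Hoelder) auto
      also have "\<dots> \<le> ennreal_powr I \<theta> * ennreal_powr (ennreal L * m) (1 - \<theta>)"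
        using \<theta> by (intro mult_left_mono ennreal_powr_mono HL) auto
      finally have Hold: "(\<integral>\<^sup>+x. ennreal (f x powr p0 * (W x * H x)) \<partial>lebesgue) \<le> ennreal_powr I \<theta> * ennreal_powr (ennreal L * m) (1 - \<theta>)" .
      have "ennreal (y powr p0) * m \<le> ennreal (y powr p0) * emeasure (weighted (\<lambda>x. W x * H x)) E"
        by (intro mult_left_mono mH) simp
      also have "\<dots> \<le> ennreal B * (\<integral>\<^sup>+x. ennreal (f x powr p0 * (W x * H x)) \<partial>lebesgue)"
        by (rule B(2)[OF \<open>weak_A_infty_bound p0 \<phi> f g\<close> AH y E Es])
      also have "\<dots> \<le> ennreal B * (ennreal_powr I \<theta> * ennreal_powr (ennreal L * m) (1 - \<theta>))"
        by (intro mult_left_mono Hold) simp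
      also have "\<dots> = (ennreal (B * L powr (1 - \<theta>)) * ennreal_powr I \<theta>) * ennreal_powr m (1 - \<theta>)"
        using \<theta> B(1) L by (simp add: ennreal_powr_mult ennreal_mult mult_ac)
      finally have "ennreal (y powr p0) * ennreal_powr m \<theta> \<le> ennreal (B * L powr (1 - \<theta>)) * ennreal_powr I \<theta>"
        by (rule ennreal_absorb_power[OF False mfin])
      then have "ennreal_powr (ennreal (y powr p0) * ennreal_powr m \<theta>) (s / p0) \<le> ennreal_powr (ennreal (B * L powr (1 - \<theta>)) * ennreal_powr I \<theta>) (s / p0)"
        using p0 by (intro ennreal_powr_mono) auto
      then show ?thesis
        using p0 B(1) L by (simp add: ennreal_powr_mult ennreal_powr_powr powr_powr \<theta>_def m_def I_def)
    qed
  qed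
qed

text \<open>Extrapolation from \<open>p0\<close> to an arbitrary exponent \<open>s\<close> within
  the class of \<open>A1\<close> weights; the three ranges of \<open>s\<close> are put under one
  common set of assumptions on \<open>E\<close>.\<close>

lemma A1_distribution_bound:
  assumes \<phi>: "locally_bounded \<phi>" and p0: "0 < p0" and s: "0 < s"
  obtains K where "0 < K" "\<And>f g (W :: 'a::euclidean_space \<Rightarrow> real) y E. \<lbrakk>weak_A_infty_bound p0 \<phi> f g; A1 C W; 0 < y;
      E \<in> sets lebesgue; bounded E; E \<subseteq> {x. y < g x \<and> maximal f x \<le> ennreal y}; AE x in lebesgue. maximal f x < \<infinity>\<rbrakk> \<Longrightarrow>
    ennreal (y powr s) * emeasure (weighted W) E \<le> ennreal K * (\<integral>\<^sup>+x. ennreal (f x powr s * W x) \<partial>lebesgue)"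
proof (cases s p0 rule: linorder_cases)
  case less
  show ?thesis by (rule A1_distribution_bound_less[OF \<phi> s less, of C]) (rule that, assumption, blast)
next
  case equal
  obtain K where K: "0 < K" "\<And>f g (W :: 'a \<Rightarrow> real) y E. \<lbrakk>weak_A_infty_bound p0 \<phi> f g; A1 C W; 0 < y;
      E \<in> sets lebesgue; E \<subseteq> {x. y < g x}\<rbrakk> \<Longrightarrow>
    ennreal (y powr p0) * emeasure (weighted W) E \<le> ennreal K * (\<integral>\<^sup>+x. ennreal (f x powr p0 * W x) \<partial>lebesgue)"
    by (rule A1_distribution_bound_eq[OF \<phi> p0, of C, where ?'a = 'a]) blast
  show ?thesis
    by (rule that[OF K(1)], unfold equal, rule K(2)) auto
next
  case greater
  obtain K where K: "0 < K" "\<And>f g (W :: 'a \<Rightarrow> real) y E. \<lbrakk>weak_A_infty_bound p0 \<phi> f g; A1 C W; 0 < y;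
      E \<in> sets lebesgue; bounded E; E \<subseteq> {x. y < g x}\<rbrakk> \<Longrightarrow>
    ennreal (y powr s) * emeasure (weighted W) E \<le> ennreal K * (\<integral>\<^sup>+x. ennreal (f x powr s * W x) \<partial>lebesgue)"
    by (rule A1_distribution_bound_greater[OF \<phi> p0 greater, of C, where ?'a = 'a]) blast
  show ?thesis
    by (rule that[OF K(1)], rule K(2)) auto
qed

subsection \<open>Two-weight bounds\<close>

text \<open>In the second form the measure stands alone, so that bounds can be added and passed to
  suprema.\<close>

lemma mult_powr_le_iff:
  assumes y: "0 < y" and q: "0 < q"
  shows "ennreal y * ennreal_powr a (1 / q) \<le> Z \<longleftrightarrow> a \<le> ennreal_powr (Z / ennreal y) q"
proof -
  have "ennreal y * ennreal_powr a (1 / q) \<le> Z \<longleftrightarrow> ennreal_powr a (1 / q) \<le> Z / ennreal y"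
  proof
    assume "ennreal y * ennreal_powr a (1 / q) \<le> Z"
    then have "ennreal y * ennreal_powr a (1 / q) / ennreal y \<le> Z / ennreal y" by (rule divide_right_mono_ennreal)
    then show "ennreal_powr a (1 / q) \<le> Z / ennreal y"
      using y by (simp add: mult.commute[of "ennreal y"] mult_divide_eq_ennreal)
  next
    assume "ennreal_powr a (1 / q) \<le> Z / ennreal y"
    then have "ennreal y * ennreal_powr a (1 / q) \<le> ennreal y * (Z / ennreal y)" by (rule mult_left_mono) simp
    then show "ennreal y * ennreal_powr a (1 / q) \<le> Z"
      using y by (simp add: ennreal_times_divide mult.commute[of "ennreal y"] mult_divide_eq_ennreal)
  qed
  also have "\<dots> \<longleftrightarrow> a \<le> ennreal_powr (Z / ennreal y) q"
  proof
    assume "ennreal_powr a (1 / q) \<le> Z / ennreal y"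
    then have "ennreal_powr (ennreal_powr a (1 / q)) q \<le> ennreal_powr (Z / ennreal y) q"
      using q by (intro ennreal_powr_mono) auto
    then show "a \<le> ennreal_powr (Z / ennreal y) q" using q by (simp add: ennreal_powr_powr)
  next
    assume "a \<le> ennreal_powr (Z / ennreal y) q"
    then have "ennreal_powr a (1 / q) \<le> ennreal_powr (ennreal_powr (Z / ennreal y) q) (1 / q)"
      using q by (intro ennreal_powr_mono) auto
    then show "ennreal_powr a (1 / q) \<le> Z / ennreal y" using q by (simp add: ennreal_powr_powr)
  qed
  finally show ?thesis .
qed

text \<open>The set where \<open>F\<close> is infinite lies in every superlevel set, so its measure
  times arbitrarily large factors stays bounded. A null set for a positive weight is Lebesgue
  null.\<close>

lemma weak_Lp_norm_finite_imp_AE: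
  fixes F :: "'a::euclidean_space \<Rightarrow> ennreal"
  assumes v: "weight v" and F[measurable]: "F \<in> borel_measurable lebesgue" and q: "0 < q"
    and fin: "weak_Lp_norm q v F < \<infinity>"
  shows "AE x in lebesgue. F x < \<infinity>"
proof -
  define N where "N = {x. F x = top}"
  have Nm: "N \<in> sets lebesgue" using measurable_sets[OF F, of "{top}"] by (simp add: N_def vimage_def)
  have "{x. ennreal y < F x} \<in> sets lebesgue" for y
    using borel_measurable_less[of "\<lambda>_. ennreal y" lebesgue F] by simp
  then have "emeasure (weighted v) N \<le> emeasure (weighted v) {x. ennreal y < F x}" for y
    by (intro emeasure_mono) (auto simp: N_def)
  moreover have "ennreal y * ennreal_powr (emeasure (weighted v) {x. ennreal y < F x}) (1 / q) \<le> weak_Lp_norm q v F" if "0 < y" for y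
    unfolding weak_Lp_norm_def using that by (intro SUP_upper) auto
  ultimately have le: "ennreal y * ennreal_powr (emeasure (weighted v) N) (1 / q) \<le> weak_Lp_norm q v F" if "0 < y" for y
    using q that by (meson ennreal_powr_mono mult_left_mono order_trans zero_le divide_nonneg_pos zero_le_one)
  obtain Z where Z: "weak_Lp_norm q v F = ennreal Z" "0 \<le> Z" using fin by (cases "weak_Lp_norm q v F") auto
  obtain c where c: "ennreal_powr (emeasure (weighted v) N) (1 / q) = ennreal c" "0 \<le> c"
    using le[of 1] Z by (cases "ennreal_powr (emeasure (weighted v) N) (1 / q)") (auto simp: top_unique)
  have "c = 0"
  proof (rule ccontr)
    assume "c \<noteq> 0"
    then have "0 < c" using c by simp
    have "ennreal ((Z + 1) / c) * ennreal c \<le> ennreal Z" using le[of "(Z + 1) / c"] Z c \<open>0 < c\<close> by simp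
    then have "(Z + 1) / c * c \<le> Z" using Z c \<open>0 < c\<close> by (simp add: ennreal_mult[symmetric])
    then show False using \<open>0 < c\<close> by simp
  qed
  then have "emeasure (weighted v) N = 0"
    using c q ennreal_powr_powr[of "emeasure (weighted v) N" "1 / q" q] by simp
  then have "AE x in weighted v. x \<notin> N" using Nm by (intro AE_not_in) auto
  then have "AE x in lebesgue. x \<notin> N" by (simp only: AE_weighted_iff[OF v])
  then show ?thesis by eventually_elim (auto simp: N_def less_top)
qed

text \<open>The set \<open>{g > y}\<close> is split according to whether \<open>F\<close> exceeds
  \<open>y\<close>, and the part where it does not is exhausted by its intersections with balls.
  Both parts obey the same bound, and the sum of two gives the factor
  \<open>2 powr (1 / q)\<close>.\<close>

lemma weak_Lp_norm_le_of_bounded_sets: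
  fixes g :: "'a::euclidean_space \<Rightarrow> real" and F :: "'a \<Rightarrow> ennreal"
  assumes v: "weight v" and g: "g \<in> borel_measurable lebesgue" and F[measurable]: "F \<in> borel_measurable lebesgue"
    and q: "0 < q" and A: "weak_Lp_norm q v F \<le> Z"
    and B: "\<And>y E. \<lbrakk>0 < y; E \<in> sets lebesgue; bounded E; E \<subseteq> {x. y < g x \<and> F x \<le> ennreal y}\<rbrakk> \<Longrightarrow>
      ennreal y * ennreal_powr (emeasure (weighted v) E) (1 / q) \<le> Z"
  shows "weak_Lp_norm q v (\<lambda>x. ennreal (g x)) \<le> ennreal (2 powr (1 / q)) * Z"
  unfolding weak_Lp_norm_def
proof (rule SUP_least)
  fix y :: real assume "y \<in> {0<..}"
  then have y: "0 < y" by simp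
  define S1 where "S1 = {x. ennreal y < F x}"
  define S2 where "S2 = {x. y < g x} - S1"
  define E where "E n = S2 \<inter> cball 0 (real n)" for n
  have S1m[measurable]: "S1 \<in> sets lebesgue"
    unfolding S1_def using borel_measurable_less[of "\<lambda>_. ennreal y" lebesgue F] by simp
  have S2m[measurable]: "S2 \<in> sets lebesgue" unfolding S2_def using less_set_lebesgue[OF g] by simp
  have Em: "E n \<in> sets lebesgue" for n
    unfolding E_def by (intro sets.Int S2m fmeasurableD lmeasurable_cball)
  have S2E: "S2 = (\<Union>n. E n)"
    by (auto simp: E_def intro: real_arch_simple)
  have "(SUP n. emeasure (weighted v) (E n)) = emeasure (weighted v) (\<Union>n. E n)"
  proof (rule SUP_emeasure_incseq)
    show "range E \<subseteq> sets (weighted v)" using Em by auto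
    show "incseq E" by (intro incseq_SucI) (auto simp: E_def)
  qed
  moreover have "emeasure (weighted v) (E n) \<le> ennreal_powr (Z / ennreal y) q" for n
    unfolding mult_powr_le_iff[OF y q, symmetric]
  proof (rule B[OF y Em])
    show "bounded (E n)" unfolding E_def by (rule bounded_subset[OF bounded_cball]) auto
    show "E n \<subseteq> {x. y < g x \<and> F x \<le> ennreal y}" by (auto simp: E_def S2_def S1_def not_less)
  qed
  ultimately have b2: "emeasure (weighted v) S2 \<le> ennreal_powr (Z / ennreal y) q"
    unfolding S2E by (metis SUP_least)
  have "ennreal y * ennreal_powr (emeasure (weighted v) S1) (1 / q) \<le> weak_Lp_norm q v F"
    unfolding weak_Lp_norm_def S1_def using y by (intro SUP_upper) auto
  then have "ennreal y * ennreal_powr (emeasure (weighted v) S1) (1 / q) \<le> Z" using A by order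
  then have b1: "emeasure (weighted v) S1 \<le> ennreal_powr (Z / ennreal y) q" unfolding mult_powr_le_iff[OF y q] .
  have gset: "{x. ennreal y < ennreal (g x)} = {x. y < g x}" using y by (simp add: ennreal_less_iff)
  have "emeasure (weighted v) {x. y < g x} \<le> emeasure (weighted v) (S1 \<union> S2)"
  proof (rule emeasure_mono)
    show "{x. y < g x} \<subseteq> S1 \<union> S2" by (auto simp: S2_def)
    show "S1 \<union> S2 \<in> sets (weighted v)" using S1m S2m by (simp del: Un_Diff_cancel)
  qed
  also have "\<dots> \<le> emeasure (weighted v) S1 + emeasure (weighted v) S2"
    by (intro emeasure_subadditive) auto
  also have "\<dots> \<le> ennreal_powr (Z / ennreal y) q + ennreal_powr (Z / ennreal y) q"
    by (intro add_mono b1 b2)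
  also have "\<dots> = ennreal_powr (ennreal (2 powr (1 / q)) * Z / ennreal y) q"
    using q by (simp add: ennreal_times_divide[symmetric] ennreal_powr_mult powr_powr mult_2[symmetric])
  finally show "ennreal y * ennreal_powr (emeasure (weighted v) {x. ennreal y < ennreal (g x)}) (1 / q) \<le> ennreal (2 powr (1 / q)) * Z"
    unfolding gset mult_powr_le_iff[OF y q] .
qed

text \<open>The integrand is split as \<open>f powr p * u\<close> to the power \<open>s / p\<close>
  times \<open>W powr (p / (p - s)) * u powr (1 - p / (p - s))\<close> to the power
  \<open>1 - s / p\<close>; the powers of \<open>u\<close> cancel. This is the origin of the dual
  weight of \<open>u\<close> in both conditions.\<close>

lemma nn_integral_Hoelder_weight:
  fixes f W u :: "'a::euclidean_space \<Rightarrow> real"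
  assumes s: "0 < s" "s < p" and f[measurable]: "f \<in> borel_measurable lebesgue" and f0: "\<And>x. 0 \<le> f x"
    and W[measurable]: "W \<in> borel_measurable lebesgue" and W0: "\<And>x. 0 \<le> W x" and u: "weight u"
  shows "(\<integral>\<^sup>+x. ennreal (f x powr s * W x) \<partial>lebesgue) \<le> ennreal_powr (Lp_norm p u (\<lambda>x. ennreal (f x))) s *
    Lp_norm (p / (p - s)) (\<lambda>x. u x powr (1 - p / (p - s))) (\<lambda>x. ennreal (W x))"
proof -
  note [measurable] = weight_measurable[OF u]
  define \<theta> where "\<theta> = s / p"
  have \<theta>: "0 < \<theta>" "\<theta> < 1" using s by (auto simp: \<theta>_def)
  have P: "(1 - p / (p - s)) * (1 - \<theta>) = - \<theta>" "p / (p - s) * (1 - \<theta>) = 1" "1 / (p / (p - s)) = 1 - \<theta>"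
    using s by (auto simp: \<theta>_def field_simps)
  define a where "a x = ennreal (u x) * ennreal_powr (ennreal (f x)) p" for x
  define b where "b x = ennreal (u x powr (1 - p / (p - s))) * ennreal_powr (ennreal (W x)) (p / (p - s))" for x
  have "(\<integral>\<^sup>+x. ennreal (f x powr s * W x) \<partial>lebesgue) = (\<integral>\<^sup>+x. ennreal_powr (a x) \<theta> * ennreal_powr (b x) (1 - \<theta>) \<partial>lebesgue)"
  proof (intro nn_integral_cong)
    fix x
    have u0: "0 < u x" by (rule weight_pos[OF u])
    have "(u x * f x powr p) powr \<theta> * (u x powr (1 - p / (p - s)) * W x powr (p / (p - s))) powr (1 - \<theta>)
        = (u x powr \<theta> * f x powr (p * \<theta>)) * (u x powr (- \<theta>) * W x powr 1)"
      using u0 f0[of x] W0[of x] by (simp only: powr_mult powr_powr P powr_ge_zero less_imp_le)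
    also have "\<dots> = (u x powr \<theta> * u x powr (- \<theta>)) * (f x powr s * W x)"
      using W0[of x] s by (simp add: \<theta>_def)
    also have "u x powr \<theta> * u x powr (- \<theta>) = 1" using u0 by (simp flip: powr_add)
    finally show "ennreal (f x powr s * W x) = ennreal_powr (a x) \<theta> * ennreal_powr (b x) (1 - \<theta>)"
      using u0 f0[of x] W0[of x] by (simp add: a_def b_def ennreal_mult[symmetric])
  qed
  also have "\<dots> \<le> ennreal_powr (\<integral>\<^sup>+x. a x \<partial>lebesgue) \<theta> * ennreal_powr (\<integral>\<^sup>+x. b x \<partial>lebesgue) (1 - \<theta>)"
    using \<theta> by (intro nn_integral_Hoelder) (auto simp: a_def[abs_def] b_def[abs_def])
  also have "ennreal_powr (\<integral>\<^sup>+x. a x \<partial>lebesgue) \<theta> = ennreal_powr (Lp_norm p u (\<lambda>x. ennreal (f x))) s"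
    by (simp add: Lp_norm_eq ennreal_powr_powr a_def \<theta>_def)
  also have "ennreal_powr (\<integral>\<^sup>+x. b x \<partial>lebesgue) (1 - \<theta>) = Lp_norm (p / (p - s)) (\<lambda>x. u x powr (1 - p / (p - s))) (\<lambda>x. ennreal (W x))"
    unfolding P(3)[symmetric] b_def by (subst Lp_norm_eq) auto
  finally show ?thesis .
qed

lemma Lp_norm_cong_AE:
  assumes "AE x in lebesgue. F x = G x" "w \<in> borel_measurable lebesgue" "F \<in> borel_measurable lebesgue" "G \<in> borel_measurable lebesgue"
  shows "Lp_norm p w F = Lp_norm p w G"
  using assms by (simp add: Lp_norm_eq) (intro arg_cong2[where f = ennreal_powr] nn_integral_cong_AE refl, auto elim!: eventually_mono)

lemma Lp_norm_finite_imp_AE: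
  assumes w[measurable]: "w \<in> borel_measurable lebesgue" "\<And>x. 0 < w x" and F[measurable]: "F \<in> borel_measurable lebesgue"
    and p: "0 < p" and fin: "Lp_norm p w F < \<infinity>"
  shows "AE x in lebesgue. F x < \<infinity>"
proof -
  have "(\<integral>\<^sup>+x. ennreal (w x) * ennreal_powr (F x) p \<partial>lebesgue) \<noteq> \<infinity>"
    using fin by (simp add: Lp_norm_eq less_top[symmetric])
  then have "AE x in lebesgue. ennreal (w x) * ennreal_powr (F x) p \<noteq> \<infinity>"
    by (intro nn_integral_PInf_AE) auto
  then show ?thesis
  proof eventually_elim
    case (elim x)
    then show ?case using w(2)[of x] by (cases "F x") (auto simp: ennreal_mult_top)
  qed
qed

text \<open>It trades \<open>maximal_powr \<mu>\<close> for the plain maximal function, which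
  accounts for the factor \<open>\<mu>\<close> in the exponents of condition (a).\<close>

lemma Lp_norm_ennreal_powr:
  assumes "w \<in> borel_measurable lebesgue" "F \<in> borel_measurable lebesgue" "0 < \<mu>"
  shows "Lp_norm p w (\<lambda>x. ennreal_powr (F x) \<mu>) = ennreal_powr (Lp_norm (\<mu> * p) w F) \<mu>"
  using assms by (subst (1 2) Lp_norm_eq) (auto simp: ennreal_powr_powr)

lemma emeasure_weighted_mono_AE:
  assumes v: "v \<in> borel_measurable lebesgue" and w: "w \<in> borel_measurable lebesgue" and E: "E \<in> sets lebesgue"
    and le: "AE x in lebesgue. x \<in> E \<longrightarrow> v x \<le> w x"
  shows "emeasure (weighted v) E \<le> emeasure (weighted w) E"
  unfolding emeasure_weighted[OF v E] emeasure_weighted[OF w E]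
  by (rule nn_integral_mono_AE) (use le in \<open>auto elim!: eventually_mono simp: indicator_def intro!: ennreal_leI\<close>)

text \<open>Both conditions only have to provide the estimate on bounded sets; the weak type of
  \<open>M\<close> supplies the rest. If the norm of \<open>f\<close> is infinite there is nothing
  to prove; if it is finite, the weak type also shows that \<open>maximal f\<close> is finite almost
  everywhere, as the distribution estimates require.\<close>

lemma weak_Lp_norm_bound_of_bounded_sets:
  fixes u v :: "'a::euclidean_space \<Rightarrow> real"
  assumes v: "weight v" and q: "0 < q" and pair: "weak_type_pair p q u v"
    and K: "0 < K" "\<And>f g y E. \<lbrakk>weak_A_infty_bound p0 \<phi> f g; AE x in lebesgue. maximal f x < \<infinity>; 0 < y;
      E \<in> sets lebesgue; bounded E; E \<subseteq> {x. y < g x \<and> maximal f x \<le> ennreal y}\<rbrakk> \<Longrightarrow>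
      ennreal y * ennreal_powr (emeasure (weighted v) E) (1 / q) \<le> ennreal K * Lp_norm p u (\<lambda>x. ennreal (f x))"
  shows "\<exists>C>0. \<forall>f g. weak_A_infty_bound p0 \<phi> f g \<longrightarrow>
    weak_Lp_norm q v (\<lambda>x. ennreal (g x)) \<le> ennreal C * Lp_norm p u (\<lambda>x. ennreal (f x))"
proof -
  obtain C0 where C0: "\<And>f. f \<in> borel_measurable lebesgue \<Longrightarrow> Lp_norm p u (\<lambda>x. ennreal \<bar>f x\<bar>) < \<infinity> \<Longrightarrow>
      weak_Lp_norm q v (maximal f) \<le> ennreal C0 * Lp_norm p u (\<lambda>x. ennreal \<bar>f x\<bar>)"
    using pair unfolding weak_type_pair_def by blast
  define L where "L = max K C0"
  have L: "0 < L" using K(1) by (simp add: L_def)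
  show ?thesis
  proof (intro exI[of _ "2 powr (1 / q) * L"] conjI allI impI)
    show "0 < 2 powr (1 / q) * L" using L by simp
    fix f g :: "'a \<Rightarrow> real" assume H: "weak_A_infty_bound p0 \<phi> f g"
    define N where "N = Lp_norm p u (\<lambda>x. ennreal (f x))"
    have f: "f \<in> borel_measurable lebesgue" "\<And>x. 0 \<le> f x" and g: "g \<in> borel_measurable lebesgue"
      using H by (auto simp: weak_A_infty_bound_def)
    show "weak_Lp_norm q v (\<lambda>x. ennreal (g x)) \<le> ennreal (2 powr (1 / q) * L) * Lp_norm p u (\<lambda>x. ennreal (f x))"
      unfolding N_def[symmetric]
    proof (cases "N = top")
      case True
      then show "weak_Lp_norm q v (\<lambda>x. ennreal (g x)) \<le> ennreal (2 powr (1 / q) * L) * N"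
        using L by (simp add: ennreal_mult_top)
    next
      case False
      have max: "weak_Lp_norm q v (maximal f) \<le> ennreal C0 * N"
        using C0[OF f(1)] f(2) False by (simp add: N_def less_top)
      also have "\<dots> \<le> ennreal L * N" by (intro mult_right_mono ennreal_leI) (auto simp: L_def)
      finally have max: "weak_Lp_norm q v (maximal f) \<le> ennreal L * N" .
      have "ennreal L * N < \<infinity>" using False by (simp add: ennreal_mult_less_top less_top)
      with max have "weak_Lp_norm q v (maximal f) < \<infinity>" by (rule le_less_trans)
      then have fin: "AE x in lebesgue. maximal f x < \<infinity>"
        by (intro weak_Lp_norm_finite_imp_AE[OF v _ q]) auto
      have "weak_Lp_norm q v (\<lambda>x. ennreal (g x)) \<le> ennreal (2 powr (1 / q)) * (ennreal L * N)"
      proof (rule weak_Lp_norm_le_of_bounded_sets[OF v g borel_measurable_maximal q max])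
        fix y E assume *: "0 < y" "E \<in> sets lebesgue" "bounded E" "E \<subseteq> {x. y < g x \<and> maximal f x \<le> ennreal y}"
        have "ennreal y * ennreal_powr (emeasure (weighted v) E) (1 / q) \<le> ennreal K * N"
          unfolding N_def by (rule K(2)[OF H fin *])
        also have "\<dots> \<le> ennreal L * N" by (intro mult_right_mono ennreal_leI) (auto simp: L_def)
        finally show "ennreal y * ennreal_powr (emeasure (weighted v) E) (1 / q) \<le> ennreal L * N" .
      qed
      then show "weak_Lp_norm q v (\<lambda>x. ennreal (g x)) \<le> ennreal (2 powr (1 / q) * L) * N"
        using L by (simp add: ennreal_mult mult.assoc)
    qed
  qed
qed

section \<open>The estimates on bounded sets under conditions (a) and (b)\<close>

lemma bounded_sets_bound_of_strong_type:
  fixes u v :: "'a::euclidean_space \<Rightarrow> real"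
  assumes \<phi>: "locally_bounded \<phi>" and p0: "0 < p0" and u: "weight u" and v: "weight v"
    and s: "0 < s" "s < p" "s < q" and \<mu>: "0 < \<mu>" "\<mu> < 1"
    and strong: "strong_type_pair (\<mu> * (q / (q - s))) (\<mu> * (p / (p - s)))
              (\<lambda>x. v x powr (1 - q / (q - s))) (\<lambda>x. u x powr (1 - p / (p - s)))"
  obtains K where "0 < K" "\<And>f g y E. \<lbrakk>weak_A_infty_bound p0 \<phi> f g; AE x in lebesgue. maximal f x < \<infinity>; 0 < y;
      E \<in> sets lebesgue; bounded E; E \<subseteq> {x. y < g x \<and> maximal f x \<le> ennreal y}\<rbrakk> \<Longrightarrow>
      ennreal y * ennreal_powr (emeasure (weighted v) E) (1 / q) \<le> ennreal K * Lp_norm p u (\<lambda>x. ennreal (f x))"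
proof -
  note [measurable] = weight_measurable[OF u] weight_measurable[OF v]
  define P where "P = p / (p - s)"
  define Q where "Q = q / (q - s)"
  have PQ: "0 < P" "0 < Q" "1 / Q = 1 - s / q" using s by (auto simp: P_def Q_def field_simps)
  define uP where "uP x = u x powr (1 - P)" for x
  define vQ where "vQ x = v x powr (1 - Q)" for x
  have uP[measurable]: "uP \<in> borel_measurable lebesgue" unfolding uP_def by measurable
  have vQ[measurable]: "vQ \<in> borel_measurable lebesgue" unfolding vQ_def by measurable
  have uP0: "0 < uP x" for x using weight_pos[OF u, of x] by (simp add: uP_def)
  obtain C1 where C1: "\<And>f. f \<in> borel_measurable lebesgue \<Longrightarrow> Lp_norm (\<mu> * Q) vQ (\<lambda>x. ennreal \<bar>f x\<bar>) < \<infinity> \<Longrightarrow>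
      Lp_norm (\<mu> * P) uP (maximal f) \<le> ennreal C1 * Lp_norm (\<mu> * Q) vQ (\<lambda>x. ennreal \<bar>f x\<bar>)"
    using strong unfolding strong_type_pair_def P_def Q_def uP_def[abs_def] vQ_def[abs_def] by blast
  define C2 where "C2 = max 1 C1"
  have C2: "0 < C2" by (simp add: C2_def)
  obtain K where K: "0 < K" "\<And>f g (W :: 'a \<Rightarrow> real) y E. \<lbrakk>weak_A_infty_bound p0 \<phi> f g; A1 (rochberg_const (3 ^ DIM('a)) \<mu>) W; 0 < y;
      E \<in> sets lebesgue; bounded E; E \<subseteq> {x. y < g x \<and> maximal f x \<le> ennreal y}; AE x in lebesgue. maximal f x < \<infinity>\<rbrakk> \<Longrightarrow>
    ennreal (y powr s) * emeasure (weighted W) E \<le> ennreal K * (\<integral>\<^sup>+x. ennreal (f x powr s * W x) \<partial>lebesgue)"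
    by (rule A1_distribution_bound[OF \<phi> p0 s(1), of "rochberg_const (3 ^ DIM('a)) \<mu>", where ?'a = 'a]) blast
  show ?thesis
  proof (rule that[of "(K * C2 powr \<mu>) powr (1 / s)"])
    show "0 < (K * C2 powr \<mu>) powr (1 / s)" using K(1) C2 by simp
    fix f g :: "'a \<Rightarrow> real" and y :: real and E :: "'a set"
    assume H: "weak_A_infty_bound p0 \<phi> f g" and fin: "AE x in lebesgue. maximal f x < \<infinity>" and y: "0 < y"
      and E[measurable]: "E \<in> sets lebesgue" and bE: "bounded E" and Es: "E \<subseteq> {x. y < g x \<and> maximal f x \<le> ennreal y}"
    have f: "f \<in> borel_measurable lebesgue" "\<And>x. 0 \<le> f x" using H by (auto simp: weak_A_infty_bound_def)
    define N where "N = Lp_norm p u (\<lambda>x. ennreal (f x))"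
    define m where "m = emeasure (weighted v) E"
    show "ennreal y * ennreal_powr (emeasure (weighted v) E) (1 / q) \<le> ennreal ((K * C2 powr \<mu>) powr (1 / s)) * Lp_norm p u (\<lambda>x. ennreal (f x))"
      unfolding N_def[symmetric] m_def[symmetric]
    proof (cases "m = 0")
      case False
      have mfin: "m \<noteq> top"
      proof -
        obtain r where "E \<subseteq> cube 0 r" using ex_cube_subset[OF bE] by blast
        then have "m \<le> emeasure (weighted v) (cube 0 r)" unfolding m_def by (intro emeasure_mono) auto
        then show ?thesis using emeasure_weighted_cube_finite[OF v, of 0 r] by (auto simp: top_unique)
      qed
      \<comment> \<open>The power is chosen so that the maximal function of \<open>G\<close> to the
        power \<open>\<mu>\<close> is \<open>M\<close> with index \<open>\<mu>\<close> applied to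
        \<open>v\<close> restricted to \<open>E\<close>.\<close>
      define G where "G x = (v x * indicator E x) powr (1 / \<mu>)" for x
      have G[measurable]: "G \<in> borel_measurable lebesgue" unfolding G_def by measurable
      have G0: "0 \<le> G x" for x by (simp add: G_def)
      have nz: "\<not> (AE x in lebesgue. G x = 0)"
      proof
        assume "AE x in lebesgue. G x = 0"
        then have "AE x in lebesgue. x \<notin> E"
          by eventually_elim (use weight_pos[OF v] less_imp_neq[OF weight_pos[OF v]] in \<open>auto simp: G_def\<close>)
        then have "AE x in weighted v. x \<notin> E" by (simp only: AE_weighted_iff[OF v])
        then have "m = 0" unfolding m_def by (simp add: AE_iff_null null_setsD1)
        then show False using False by simp
      qed
      \<comment> \<open>The dual weight of \<open>v\<close> is designed for this identity:
        \<open>v powr (1 - Q) * v powr Q = v\<close>. After raising to the power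
        \<open>\<mu>\<close> the exponent of \<open>m\<close> becomes
        \<open>1 / Q = 1 - s / q\<close>, which is below 1 and leaves something after
        absorption.\<close>
      have NG: "Lp_norm (\<mu> * Q) vQ (\<lambda>x. ennreal \<bar>G x\<bar>) = ennreal_powr m (1 / (\<mu> * Q))"
      proof -
        have "(\<integral>\<^sup>+x. ennreal (vQ x) * ennreal_powr (ennreal \<bar>G x\<bar>) (\<mu> * Q) \<partial>lebesgue) = (\<integral>\<^sup>+x\<in>E. ennreal (v x) \<partial>lebesgue)"
        proof (intro nn_integral_cong)
          fix x
          have "v x powr (1 - Q) * v x powr Q = v x" using weight_pos[OF v, of x] by (simp flip: powr_add)
          then show "ennreal (vQ x) * ennreal_powr (ennreal \<bar>G x\<bar>) (\<mu> * Q) = ennreal (v x) * indicator E x"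
            using \<mu> PQ G0[of x] by (auto simp: vQ_def G_def powr_powr indicator_def ennreal_mult[symmetric])
        qed
        then show ?thesis by (subst Lp_norm_eq) (auto simp: m_def emeasure_weighted)
      qed
      have "Lp_norm (\<mu> * P) uP (maximal G) \<le> ennreal C1 * ennreal_powr m (1 / (\<mu> * Q))"
        using C1[OF G] mfin unfolding NG by (simp add: less_top)
      also have "\<dots> \<le> ennreal C2 * ennreal_powr m (1 / (\<mu> * Q))"
        by (intro mult_right_mono ennreal_leI) (auto simp: C2_def)
      finally have NM: "Lp_norm (\<mu> * P) uP (maximal G) \<le> ennreal C2 * ennreal_powr m (1 / (\<mu> * Q))" .
      also have "\<dots> < \<infinity>" using mfin by (simp add: ennreal_mult_less_top less_top)
      \<comment> \<open>Finiteness of \<open>m\<close> enters here for the first time: with the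
        strong type bound it makes the maximal function of \<open>G\<close> finite almost
        everywhere, so that \<open>W\<close> is a genuine weight.\<close>
      finally have finG: "AE x in lebesgue. maximal G x < \<infinity>"
        using \<mu> PQ by (intro Lp_norm_finite_imp_AE[OF uP uP0 borel_measurable_maximal, of "\<mu> * P"]) auto
      define W where "W x = finite_real (maximal G x) powr \<mu>" for x
      have A: "A1 (rochberg_const (3 ^ DIM('a)) \<mu>) W"
        unfolding W_def by (rule A1_maximal_powr(1)[OF G G0 nz finG \<mu>])
      have GW: "AE x in lebesgue. G x powr \<mu> \<le> W x"
        unfolding W_def by (rule A1_maximal_powr(2)[OF G G0 nz finG \<mu>])
      note [measurable] = weight_measurable[OF A1_weight[OF A]]
      have "m \<le> emeasure (weighted W) E"
        unfolding m_def
      proof (rule emeasure_weighted_mono_AE)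
        show "AE x in lebesgue. x \<in> E \<longrightarrow> v x \<le> W x"
          using GW by eventually_elim (use \<mu> weight_pos[OF v] in \<open>auto simp: G_def powr_powr less_imp_le\<close>)
      qed measurable
      then have "ennreal (y powr s) * m \<le> ennreal (y powr s) * emeasure (weighted W) E"
        by (intro mult_left_mono) auto
      also have "\<dots> \<le> ennreal K * (\<integral>\<^sup>+x. ennreal (f x powr s * W x) \<partial>lebesgue)"
        by (rule K(2)[OF H A y E bE Es fin])
      also have "\<dots> \<le> ennreal K * (ennreal_powr N s * Lp_norm P uP (\<lambda>x. ennreal (W x)))"
        unfolding N_def P_def uP_def
        by (intro mult_left_mono nn_integral_Hoelder_weight[OF s(1,2) f] u) (auto simp: W_def)
      also have "Lp_norm P uP (\<lambda>x. ennreal (W x)) = ennreal_powr (Lp_norm (\<mu> * P) uP (maximal G)) \<mu>"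
      proof (subst Lp_norm_ennreal_powr[symmetric])
        show "Lp_norm P uP (\<lambda>x. ennreal (W x)) = Lp_norm P uP (\<lambda>x. ennreal_powr (maximal G x) \<mu>)"
        proof (rule Lp_norm_cong_AE)
          show "AE x in lebesgue. ennreal (W x) = ennreal_powr (maximal G x) \<mu>"
            using finG by eventually_elim (auto simp: W_def finite_real_def ennreal_powr_def)
        qed measurable
      qed (use \<mu> in auto)
      also have "\<dots> \<le> ennreal_powr (ennreal C2 * ennreal_powr m (1 / (\<mu> * Q))) \<mu>"
        using \<mu> by (intro ennreal_powr_mono NM) auto
      also have "\<dots> = ennreal (C2 powr \<mu>) * ennreal_powr m (1 - s / q)"
        using \<mu> C2 by (simp add: ennreal_powr_mult ennreal_powr_powr PQ(3)[symmetric])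
      also have "ennreal K * (ennreal_powr N s * (ennreal (C2 powr \<mu>) * ennreal_powr m (1 - s / q)))
          = (ennreal (K * C2 powr \<mu>) * ennreal_powr N s) * ennreal_powr m (1 - s / q)"
        using K(1) by (simp add: ennreal_mult mult_ac)
      finally have "ennreal (y powr s) * m \<le> (ennreal (K * C2 powr \<mu>) * ennreal_powr N s) * ennreal_powr m (1 - s / q)"
        by (simp add: mult_left_mono)
      then have "ennreal (y powr s) * ennreal_powr m (s / q) \<le> ennreal (K * C2 powr \<mu>) * ennreal_powr N s"
        by (rule ennreal_absorb_power[OF False mfin])
      then have "ennreal_powr (ennreal (y powr s) * ennreal_powr m (s / q)) (1 / s) \<le> ennreal_powr (ennreal (K * C2 powr \<mu>) * ennreal_powr N s) (1 / s)"
        using s by (intro ennreal_powr_mono) auto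
      then show "ennreal y * ennreal_powr m (1 / q) \<le> ennreal ((K * C2 powr \<mu>) powr (1 / s)) * N"
        using s y K(1) by (simp add: ennreal_powr_mult ennreal_powr_powr powr_powr)
    qed simp
  qed
qed

text \<open>The weight \<open>W\<close> comes from all of \<open>v\<close> and is fixed before
  \<open>f\<close>, \<open>g\<close> and \<open>E\<close>. With \<open>s = q\<close> Hoelder's
  inequality leaves its norm as a constant, so no power of the measure of \<open>E\<close> appears
  on the right. For \<open>p = q = 1\<close> the pointwise bound of \<open>W\<close> by a multiple
  of \<open>u\<close> takes the place of Hoelder's inequality.\<close>

lemma bounded_sets_bound_of_maximal_powr:
  fixes u v :: "'a::euclidean_space \<Rightarrow> real"
  assumes \<phi>: "locally_bounded \<phi>" and p0: "0 < p0" and u: "weight u" and v: "weight v"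
    and q: "0 < q" "q \<le> 1" and p: "1 \<le> p" and \<mu>: "0 < \<mu>" "\<mu> < 1"
    and cond: "if p = 1 \<and> q = 1
             then ess_bounded (\<lambda>x. ennreal (inverse (u x)) * maximal_powr \<mu> v x)
             else Lp_norm (p / (p - q)) (\<lambda>x. u x powr (1 - p / (p - q))) (maximal_powr \<mu> v) < \<infinity>"
  obtains K where "0 < K" "\<And>f g y E. \<lbrakk>weak_A_infty_bound p0 \<phi> f g; AE x in lebesgue. maximal f x < \<infinity>; 0 < y;
      E \<in> sets lebesgue; bounded E; E \<subseteq> {x. y < g x \<and> maximal f x \<le> ennreal y}\<rbrakk> \<Longrightarrow>
      ennreal y * ennreal_powr (emeasure (weighted v) E) (1 / q) \<le> ennreal K * Lp_norm p u (\<lambda>x. ennreal (f x))"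
proof -
  note [measurable] = weight_measurable[OF u] weight_measurable[OF v]
  define G where "G x = v x powr (1 / \<mu>)" for x
  have G[measurable]: "G \<in> borel_measurable lebesgue" unfolding G_def by measurable
  have Gpos: "0 < G x" for x using weight_pos[OF v, of x] by (simp add: G_def)
  have nz: "\<not> (AE x in lebesgue. G x = 0)"
  proof
    assume "AE x in lebesgue. G x = 0"
    from AE_ex_in_cube[OF this zero_less_one, of 0] show False using Gpos less_imp_neq by fastforce
  qed
  have mp: "maximal_powr \<mu> v = (\<lambda>x. ennreal_powr (maximal G x) \<mu>)"
    using weight_nonneg[OF v] by (simp add: fun_eq_iff maximal_powr_def G_def[abs_def])
  have mpm[measurable]: "maximal_powr \<mu> v \<in> borel_measurable lebesgue" unfolding mp by measurable
  have "AE x in lebesgue. maximal_powr \<mu> v x < \<infinity>"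
  proof (cases "p = 1 \<and> q = 1")
    case True
    then obtain c where "AE x in lebesgue. ennreal (inverse (u x)) * maximal_powr \<mu> v x \<le> ennreal c"
      using cond by (auto simp: ess_bounded_def)
    then show ?thesis
    proof eventually_elim
      case (elim x)
      then show ?case using weight_pos[OF u, of x]
        by (cases "maximal_powr \<mu> v x") (auto simp: ennreal_mult_top top_unique)
    qed
  next
    case False
    \<comment> \<open>Since \<open>q \<le> 1 \<le> p\<close>, equality could only hold at the
      excluded pair \<open>p = q = 1\<close>; hence the exponent \<open>p / (p - q)\<close> is
      meaningful.\<close>
    then have "q < p" using q p by linarith
    then have "0 < p / (p - q)" using q by simp
    moreover have "Lp_norm (p / (p - q)) (\<lambda>x. u x powr (1 - p / (p - q))) (maximal_powr \<mu> v) < \<infinity>"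
      using cond unfolding if_not_P[OF False] .
    ultimately show ?thesis
      by (rule Lp_norm_finite_imp_AE[rotated 3])
         (auto simp: less_imp_neq[OF weight_pos[OF u], symmetric])
  qed
  then have finG: "AE x in lebesgue. maximal G x < \<infinity>" by (simp add: mp)
  define W where "W x = finite_real (maximal G x) powr \<mu>" for x
  have A: "A1 (rochberg_const (3 ^ DIM('a)) \<mu>) W"
    unfolding W_def by (rule A1_maximal_powr(1)[OF G less_imp_le[OF Gpos] nz finG \<mu>])
  have GW: "AE x in lebesgue. G x powr \<mu> \<le> W x"
    unfolding W_def by (rule A1_maximal_powr(2)[OF G less_imp_le[OF Gpos] nz finG \<mu>])
  have We: "AE x in lebesgue. ennreal (W x) = maximal_powr \<mu> v x"
    unfolding mp using finG by eventually_elim (auto simp: W_def finite_real_def ennreal_powr_def)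
  note WW = A1_weight[OF A]
  note [measurable] = weight_measurable[OF WW]
  have "\<exists>Z>0. \<forall>f. f \<in> borel_measurable lebesgue \<longrightarrow> (\<forall>x. 0 \<le> f x) \<longrightarrow>
    (\<integral>\<^sup>+x. ennreal (f x powr q * W x) \<partial>lebesgue) \<le> ennreal Z * ennreal_powr (Lp_norm p u (\<lambda>x. ennreal (f x))) q"
  proof (cases "p = 1 \<and> q = 1")
    case True
    then obtain c where "AE x in lebesgue. ennreal (inverse (u x)) * maximal_powr \<mu> v x \<le> ennreal c"
      using cond by (auto simp: ess_bounded_def)
    with We have Wle: "AE x in lebesgue. W x \<le> max 1 c * u x"
    proof eventually_elim
      case (elim x)
      have "ennreal (inverse (u x) * W x) \<le> ennreal (max 1 c)"
        using elim weight_pos[OF u, of x] weight_nonneg[OF WW, of x]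
        by (simp add: ennreal_mult) (meson ennreal_leI max.cobounded2 order_trans)
      then have "inverse (u x) * W x \<le> max 1 c" by (subst (asm) ennreal_le_iff) auto
      then show ?case using weight_pos[OF u, of x] by (simp add: field_simps)
    qed
    show ?thesis
    proof (intro exI[of _ "max 1 c"] conjI allI impI)
      fix f :: "'a \<Rightarrow> real" assume f[measurable]: "f \<in> borel_measurable lebesgue" and f0: "\<forall>x. 0 \<le> f x"
      have "(\<integral>\<^sup>+x. ennreal (f x powr q * W x) \<partial>lebesgue) \<le> (\<integral>\<^sup>+x. ennreal (max 1 c) * (ennreal (u x) * ennreal_powr (ennreal (f x)) p) \<partial>lebesgue)"
      proof (rule nn_integral_mono_AE)
        show "AE x in lebesgue. ennreal (f x powr q * W x) \<le> ennreal (max 1 c) * (ennreal (u x) * ennreal_powr (ennreal (f x)) p)"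
          using Wle
        proof eventually_elim
          case (elim x)
          then have "f x * W x \<le> f x * (max 1 c * u x)" using f0 by (intro mult_left_mono) auto
          then have "ennreal (f x * W x) \<le> ennreal (max 1 c * (u x * f x))" by (intro ennreal_leI) (simp add: mult_ac)
          then show ?case using True f0 weight_nonneg[OF u, of x] by (simp add: ennreal_mult)
        qed
      qed
      also have "\<dots> = ennreal (max 1 c) * (\<integral>\<^sup>+x. ennreal (u x) * ennreal_powr (ennreal (f x)) p \<partial>lebesgue)"
        by (rule nn_integral_cmult) measurable
      finally show "(\<integral>\<^sup>+x. ennreal (f x powr q * W x) \<partial>lebesgue) \<le> ennreal (max 1 c) * ennreal_powr (Lp_norm p u (\<lambda>x. ennreal (f x))) q"
        using True by (simp add: Lp_norm_eq)
    qed simp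
  next
    case False
    then have qp: "q < p" using q p by linarith
    define L where "L = Lp_norm (p / (p - q)) (\<lambda>x. u x powr (1 - p / (p - q))) (maximal_powr \<mu> v)"
    have LW: "Lp_norm (p / (p - q)) (\<lambda>x. u x powr (1 - p / (p - q))) (\<lambda>x. ennreal (W x)) = L"
      unfolding L_def by (rule Lp_norm_cong_AE[OF We]) measurable
    have "L < \<infinity>" using cond unfolding if_not_P[OF False] L_def .
    then obtain l where l: "L = ennreal l" "0 \<le> l" by (cases L) auto
    show ?thesis
    \<comment> \<open>Adding 1 makes the constant positive without discussing whether
      \<open>l\<close> vanishes.\<close>
    proof (intro exI[of _ "l + 1"] conjI allI impI)
      fix f :: "'a \<Rightarrow> real" assume f: "f \<in> borel_measurable lebesgue" and f0: "\<forall>x. 0 \<le> f x"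
      have "(\<integral>\<^sup>+x. ennreal (f x powr q * W x) \<partial>lebesgue) \<le> ennreal_powr (Lp_norm p u (\<lambda>x. ennreal (f x))) q * L"
        unfolding LW[symmetric] using f0 weight_nonneg[OF WW]
        by (intro nn_integral_Hoelder_weight[OF q(1) qp f] u) auto
      also have "\<dots> \<le> ennreal_powr (Lp_norm p u (\<lambda>x. ennreal (f x))) q * ennreal (l + 1)"
        unfolding l by (intro mult_left_mono ennreal_leI) auto
      finally show "(\<integral>\<^sup>+x. ennreal (f x powr q * W x) \<partial>lebesgue) \<le> ennreal (l + 1) * ennreal_powr (Lp_norm p u (\<lambda>x. ennreal (f x))) q"
        by (simp only: mult.commute)
    qed (use l in simp)
  qed
  then obtain Z where Z: "0 < Z" "\<And>f. f \<in> borel_measurable lebesgue \<Longrightarrow> (\<And>x. 0 \<le> f x) \<Longrightarrow>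
    (\<integral>\<^sup>+x. ennreal (f x powr q * W x) \<partial>lebesgue) \<le> ennreal Z * ennreal_powr (Lp_norm p u (\<lambda>x. ennreal (f x))) q"
    by blast
  obtain K where K: "0 < K" "\<And>f g (W :: 'a \<Rightarrow> real) y E. \<lbrakk>weak_A_infty_bound p0 \<phi> f g; A1 (rochberg_const (3 ^ DIM('a)) \<mu>) W; 0 < y;
      E \<in> sets lebesgue; bounded E; E \<subseteq> {x. y < g x \<and> maximal f x \<le> ennreal y}; AE x in lebesgue. maximal f x < \<infinity>\<rbrakk> \<Longrightarrow>
    ennreal (y powr q) * emeasure (weighted W) E \<le> ennreal K * (\<integral>\<^sup>+x. ennreal (f x powr q * W x) \<partial>lebesgue)"
    by (rule A1_distribution_bound[OF \<phi> p0 q(1), of "rochberg_const (3 ^ DIM('a)) \<mu>", where ?'a = 'a]) blast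
  show ?thesis
  proof (rule that[of "(K * Z) powr (1 / q)"])
    show "0 < (K * Z) powr (1 / q)" using K(1) Z(1) by simp
    fix f g :: "'a \<Rightarrow> real" and y :: real and E :: "'a set"
    assume H: "weak_A_infty_bound p0 \<phi> f g" and fin: "AE x in lebesgue. maximal f x < \<infinity>" and y: "0 < y"
      and E[measurable]: "E \<in> sets lebesgue" and bE: "bounded E" and Es: "E \<subseteq> {x. y < g x \<and> maximal f x \<le> ennreal y}"
    have f: "f \<in> borel_measurable lebesgue" "\<And>x. 0 \<le> f x" using H by (auto simp: weak_A_infty_bound_def)
    define N where "N = Lp_norm p u (\<lambda>x. ennreal (f x))"
    have "emeasure (weighted v) E \<le> emeasure (weighted W) E"
    proof (rule emeasure_weighted_mono_AE)
      show "AE x in lebesgue. x \<in> E \<longrightarrow> v x \<le> W x"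
        using GW by eventually_elim (use \<mu> weight_pos[OF v] in \<open>auto simp: G_def powr_powr less_imp_le\<close>)
    qed measurable
    then have "ennreal (y powr q) * emeasure (weighted v) E \<le> ennreal (y powr q) * emeasure (weighted W) E"
      by (intro mult_left_mono) auto
    also have "\<dots> \<le> ennreal K * (\<integral>\<^sup>+x. ennreal (f x powr q * W x) \<partial>lebesgue)"
      by (rule K(2)[OF H A y E bE Es fin])
    also have "\<dots> \<le> ennreal K * (ennreal Z * ennreal_powr N q)"
      unfolding N_def by (intro mult_left_mono Z(2) f) auto
    also have "\<dots> = ennreal (K * Z) * ennreal_powr N q" using K(1) Z(1) by (simp add: ennreal_mult mult.assoc)
    finally have "ennreal_powr (ennreal (y powr q) * emeasure (weighted v) E) (1 / q) \<le> ennreal_powr (ennreal (K * Z) * ennreal_powr N q) (1 / q)"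
      using q by (intro ennreal_powr_mono) auto
    then show "ennreal y * ennreal_powr (emeasure (weighted v) E) (1 / q) \<le> ennreal ((K * Z) powr (1 / q)) * Lp_norm p u (\<lambda>x. ennreal (f x))"
      using q y K(1) Z(1) by (simp add: ennreal_powr_mult ennreal_powr_powr powr_powr N_def)
  qed
qed

theorem theorem3p11:
  fixes p0 p q :: real
    and \<phi> :: "real \<Rightarrow> real"
    and u v :: "real ^ 'n \<Rightarrow> real"
  assumes "1 \<le> p0" and "1 \<le> p" and "0 < q"
    and "locally_bounded \<phi>"
    and "weight u" and "weight v"
    and "weak_type_pair p q u v"
    and "(\<exists>s \<mu>. 0 < s \<and> s < min p q \<and> 0 < \<mu> \<and> \<mu> < 1 \<and>
            strong_type_pair (\<mu> * (q / (q - s))) (\<mu> * (p / (p - s)))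
              (\<lambda>x. v x powr (1 - q / (q - s))) (\<lambda>x. u x powr (1 - p / (p - s))))
       \<or> (q \<le> 1 \<and> (\<exists>\<mu>. 0 < \<mu> \<and> \<mu> < 1 \<and>
            (if p = 1 \<and> q = 1
             then ess_bounded (\<lambda>x. ennreal (inverse (u x)) * maximal_powr \<mu> v x)
             else Lp_norm (p / (p - q)) (\<lambda>x. u x powr (1 - p / (p - q))) (maximal_powr \<mu> v) < \<infinity>)))"
  shows "\<exists>C>0. \<forall>f g :: real ^ 'n \<Rightarrow> real.
           f \<in> borel_measurable lebesgue \<longrightarrow> (\<forall>x. 0 \<le> f x) \<longrightarrow>
           g \<in> borel_measurable lebesgue \<longrightarrow> (\<forall>x. 0 \<le> g x) \<longrightarrow>
           (\<forall>w\<in>A_infty. weak_Lp_norm p0 w (\<lambda>x. ennreal (g x))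
              \<le> ennreal (\<phi> (enn2real (A_infty_const w))) * Lp_norm p0 w (\<lambda>x. ennreal (f x))) \<longrightarrow>
           weak_Lp_norm q v (\<lambda>x. ennreal (g x)) \<le> ennreal C * Lp_norm p u (\<lambda>x. ennreal (f x))"
proof -
  have "\<exists>C>0. \<forall>f g. weak_A_infty_bound p0 \<phi> f g \<longrightarrow>
    weak_Lp_norm q v (\<lambda>x. ennreal (g x)) \<le> ennreal C * Lp_norm p u (\<lambda>x. ennreal (f x))"
    using assms(8)
  proof (elim disjE exE conjE)
    fix s \<mu> assume s: "0 < s" "s < min p q" and \<mu>: "0 < \<mu>" "\<mu> < 1"
      and strong: "strong_type_pair (\<mu> * (q / (q - s))) (\<mu> * (p / (p - s)))
              (\<lambda>x. v x powr (1 - q / (q - s))) (\<lambda>x. u x powr (1 - p / (p - s)))"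
    have p0: "0 < p0" and sp: "s < p" and sq: "s < q" using s(2) assms(1) by auto
    show ?thesis
      by (rule bounded_sets_bound_of_strong_type[OF assms(4) p0 assms(5,6) s(1) sp sq \<mu> strong],
          rule weak_Lp_norm_bound_of_bounded_sets[OF assms(6,3,7)])
  next
    fix \<mu> assume q: "q \<le> 1" and \<mu>: "0 < \<mu>" "\<mu> < 1"
      and cond: "if p = 1 \<and> q = 1
             then ess_bounded (\<lambda>x. ennreal (inverse (u x)) * maximal_powr \<mu> v x)
             else Lp_norm (p / (p - q)) (\<lambda>x. u x powr (1 - p / (p - q))) (maximal_powr \<mu> v) < \<infinity>"
    have p0: "0 < p0" using assms(1) by simp
    show ?thesis
      by (rule bounded_sets_bound_of_maximal_powr[OF assms(4) p0 assms(5,6,3) q assms(2) \<mu> cond],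
          rule weak_Lp_norm_bound_of_bounded_sets[OF assms(6,3,7)])
  qed
  then show ?thesis unfolding weak_A_infty_bound_def by blast
qed

end
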